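(* Let $\varepsilon\in(0,1)$ be a constant and let $\mathcal{G}$ be the collection of all $k$-uniform $d$-regular linear hypergraphs with \[ d\le \frac{1-\varepsilon}{4}\cdot\frac{2^{k}}{k^2}. \] There exists an algorithm which, given as input a hypergraph $\Phi=(V,\mathscr{C})\in\mathcal{G}$ with $n=\lvert V\rvert$, outputs an independent set of $\Phi$ distributed exactly uniformly at random among all independent sets of $\Phi$, in expected time $O\left(-\frac{1}{\log(1-\varepsilon)}\cdot k^2d^2n\cdot(\log n+\log d)\right)$.
   Context: A hypergraph $\Phi=(V,\mathscr{C})$ consists of a finite vertex set $V$ and a collection $\mathscr{C}$ of subsets of $V$ (hyperedges). It is $k$-uniform if every hyperedge has exactly $k$ vertices, $d$-regular if every vertex lies in exactly $d$ hyperedges, and linear if any two distinct hyperedges share at most one vertex. A set $S\subseteq V$ is an independent set of $\Phi$ if $C\not\subseteq S$ for every $C\in\mathscr{C}$. *)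

theory Defs
  imports "HOL-Probability.Probability"
begin

section \<open>Hypergraphs and independent sets\<close>

definition hypergraph :: "'a set \<Rightarrow> 'a set set \<Rightarrow> bool" where
  "hypergraph V E \<longleftrightarrow> finite V \<and> (\<forall>C\<in>E. C \<subseteq> V)"

definition k_uniform :: "nat \<Rightarrow> 'a set set \<Rightarrow> bool" where
  "k_uniform k E \<longleftrightarrow> (\<forall>C\<in>E. card C = k)"

definition d_regular :: "nat \<Rightarrow> 'a set \<Rightarrow> 'a set set \<Rightarrow> bool" where
  "d_regular d V E \<longleftrightarrow> (\<forall>v\<in>V. card {C\<in>E. v \<in> C} = d)"

definition linear_hypergraph :: "'a set set \<Rightarrow> bool" where
  "linear_hypergraph E \<longleftrightarrow> (\<forall>C\<in>E. \<forall>D\<in>E. C \<noteq> D \<longrightarrow> card (C \<inter> D) \<le> 1)"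

definition independent_sets :: "'a set \<Rightarrow> 'a set set \<Rightarrow> 'a set set" where
  "independent_sets V E = {S. S \<subseteq> V \<and> (\<forall>C\<in>E. \<not> C \<subseteq> S)}"

text \<open>The condition \<open>1 \<le> k\<close> only makes the quotient by \<open>k\<^sup>2\<close> meaningful; without it, division
  by zero would admit the hypergraph whose only hyperedge is empty.\<close>

definition hypergraph_class :: "real \<Rightarrow> nat \<Rightarrow> nat \<Rightarrow> ('a set \<times> 'a set set) set" where
  "hypergraph_class \<epsilon> k d =
     {(V, E). hypergraph V E \<and> 1 \<le> k \<and> k_uniform k E \<and> d_regular d V E \<and> linear_hypergraph E \<and>
              real d \<le> (1 - \<epsilon>) / 4 * (2 ^ k / (real k)\<^sup>2)}"

section \<open>Randomized random-access machines\<close>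

text \<open>Programs for a unit-cost RAM with addition and (truncated) subtraction, finitely many
  registers per program, an unbounded memory of naturals with indirect addressing, and an
  instruction that tosses a fair coin. Multiplication and shifts are left out on purpose: with
  them, unit cost on unbounded naturals would be unreasonably powerful. \<open>LOAD i j\<close> is
  \<open>r i := m (r j)\<close> and \<open>STORE i j\<close> is \<open>m (r i) := r j\<close>; tests are for being nonzero.\<close>

datatype com =
    LIT nat nat
  | ADD nat nat nat
  | SUB nat nat nat
  | LOAD nat nat
  | STORE nat nat
  | FLIP nat
  | SEQ com com
  | IFNZ nat com com
  | WHILENZ nat com

text \<open>A state consists of the registers, the memory and the coin tosses still to come.\<close>

type_synonym state = "(nat \<Rightarrow> nat) \<times> (nat \<Rightarrow> nat) \<times> bool stream"

text \<open>\<open>exec c s t s'\<close>: started in \<open>s\<close>, the program \<open>c\<close> halts after exactly \<open>t\<close> steps in \<open>s'\<close>;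
  each basic instruction and each evaluation of a test is one step.\<close>

inductive exec :: "com \<Rightarrow> state \<Rightarrow> nat \<Rightarrow> state \<Rightarrow> bool" where
  Lit: "exec (LIT i a) (r, m, w) 1 (r(i := a), m, w)"
| Add: "exec (ADD i j l) (r, m, w) 1 (r(i := r j + r l), m, w)"
| Sub: "exec (SUB i j l) (r, m, w) 1 (r(i := r j - r l), m, w)"
| Load: "exec (LOAD i j) (r, m, w) 1 (r(i := m (r j)), m, w)"
| Store: "exec (STORE i j) (r, m, w) 1 (r, m(r i := r j), w)"
| Flip: "exec (FLIP i) (r, m, w) 1 (r(i := of_bool (shd w)), m, stl w)"
| Seq: "exec c1 s t1 s' \<Longrightarrow> exec c2 s' t2 s'' \<Longrightarrow> exec (SEQ c1 c2) s (t1 + t2) s''"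
| IfNonzero: "r i \<noteq> 0 \<Longrightarrow> exec c1 (r, m, w) t s' \<Longrightarrow> exec (IFNZ i c1 c2) (r, m, w) (t + 1) s'"
| IfZero: "r i = 0 \<Longrightarrow> exec c2 (r, m, w) t s' \<Longrightarrow> exec (IFNZ i c1 c2) (r, m, w) (t + 1) s'"
| WhileZero: "r i = 0 \<Longrightarrow> exec (WHILENZ i c) (r, m, w) 1 (r, m, w)"
| WhileNonzero: "r i \<noteq> 0 \<Longrightarrow> exec c (r, m, w) t1 s' \<Longrightarrow> exec (WHILENZ i c) s' t2 s'' \<Longrightarrow>
    exec (WHILENZ i c) (r, m, w) (t1 + t2 + 1) s''"

lemma exec_deterministic:
  "exec c s t s' \<Longrightarrow> exec c s u s'' \<Longrightarrow> t = u \<and> s' = s''"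
proof (induction arbitrary: u s'' rule: exec.induct)
  case (Lit i a r m w)
  from Lit.prems show ?case by cases simp
next
  case (Add i j l r m w)
  from Add.prems show ?case by cases simp
next
  case (Sub i j l r m w)
  from Sub.prems show ?case by cases simp
next
  case (Load i j r m w)
  from Load.prems show ?case by cases simp
next
  case (Store i j r m w)
  from Store.prems show ?case by cases simp
next
  case (Flip i r m w)
  from Flip.prems show ?case by cases simp
next
  case (Seq c1 s t1 s1 c2 t2 s2)
  from Seq.prems show ?case by cases (metis Seq.IH)
next
  case (IfNonzero r i c1 m w t s1 c2)
  from IfNonzero.prems show ?case by cases (metis IfNonzero.IH IfNonzero.hyps(1))+
next
  case (IfZero r i c2 m w t s1 c1)
  from IfZero.prems show ?case by cases (metis IfZero.IH IfZero.hyps(1))+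
next
  case (WhileZero r i c m w)
  from WhileZero.prems show ?case by cases (use WhileZero.hyps in simp_all)
next
  case (WhileNonzero r i c m w t1 s1 t2 s2)
  from WhileNonzero.prems show ?case
  proof cases
    case WhileZero
    then show ?thesis using WhileNonzero.hyps by simp
  next
    case prems: (WhileNonzero u1 s1' u2)
    have 1: "t1 = u1 \<and> s1 = s1'" by (rule WhileNonzero.IH(1)[OF prems(3)])
    have "t2 = u2 \<and> s2 = s''" by (rule WhileNonzero.IH(2)) (use 1 prems(4) in simp)
    then show ?thesis using 1 prems(1) by simp
  qed
qed

definition coin_space :: "bool stream measure" where
  "coin_space = stream_space (measure_pmf (pmf_of_set (UNIV :: bool set)))"

definition initial_state :: "nat list \<Rightarrow> bool stream \<Rightarrow> state" where
  "initial_state xs w = ((\<lambda>_. 0), (\<lambda>a. if a < length xs then xs ! a else 0), w)"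

definition halts_with :: "com \<Rightarrow> nat list \<Rightarrow> bool stream \<Rightarrow> (nat \<Rightarrow> nat) \<Rightarrow> bool" where
  "halts_with P xs w m \<longleftrightarrow> (\<exists>t r w'. exec P (initial_state xs w) t (r, m, w'))"

text \<open>The running time is infinite if the program does not halt on the given coin tosses.\<close>

definition running_time :: "com \<Rightarrow> nat list \<Rightarrow> bool stream \<Rightarrow> enat" where
  "running_time P xs w = Inf {enat t | t s. exec P (initial_state xs w) t s}"

definition expected_time :: "com \<Rightarrow> nat list \<Rightarrow> ennreal" where
  "expected_time P xs = (\<integral>\<^sup>+ w. ennreal_of_enat (running_time P xs w) \<partial>coin_space)"

section \<open>Hypergraphs as inputs, vertex sets as outputs\<close>

text \<open>\<open>vs\<close> enumerates the vertices without repetition, and \<open>es\<close> lists every hyperedge exactly once,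
  as a repetition-free list of positions in \<open>vs\<close>.\<close>

definition represents :: "'a list \<Rightarrow> nat list list \<Rightarrow> 'a set \<Rightarrow> 'a set set \<Rightarrow> bool" where
  "represents vs es V E \<longleftrightarrow>
     distinct vs \<and> set vs = V \<and>
     (\<forall>e\<in>set es. distinct e \<and> set e \<subseteq> {..<length vs}) \<and>
     distinct (map set es) \<and> (\<lambda>e. (!) vs ` set e) ` set es = E"

text \<open>The machine sees vertices as the numbers \<open>0, \<dots>, n - 1\<close>. Its input is the number of vertices,
  the number of hyperedges, and then each hyperedge preceded by its size.\<close>

definition input_word :: "'a list \<Rightarrow> nat list list \<Rightarrow> nat list" where
  "input_word vs es = length vs # length es # concat (map (\<lambda>e. length e # e) es)"

text \<open>The output is the vertex set whose indicator is left in the first \<open>n\<close> memory cells.\<close>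

definition output_set :: "'a list \<Rightarrow> (nat \<Rightarrow> nat) \<Rightarrow> 'a set" where
  "output_set vs m = {vs ! i | i. i < length vs \<and> m i \<noteq> 0}"

definition output_prob :: "com \<Rightarrow> 'a list \<Rightarrow> nat list list \<Rightarrow> 'a set \<Rightarrow> real" where
  "output_prob P vs es S =
     measure coin_space
       {w \<in> space coin_space. \<exists>m. halts_with P (input_word vs es) w m \<and> output_set vs m = S}"

end

theory Submission
  imports Defs
begin

text \<open>The sampler runs the Glauber dynamics with a systematic scan, read-once coupling from the past
  and a bounding chain. A block consists of \<open>T = O(log n)\<close> rounds; it coalesces if the lower and the
  upper bounding chain agree at its end. The state just before the second coalescing block is
  output, and stationarity of the uniform distribution makes it exactly uniform.

  A block fails to coalesce only if the space-time windows \<open>(C, t)\<close>, each consisting of the last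
  updates of the vertices of an edge \<open>C\<close> before time \<open>t\<close>, contain a path through all the rounds in which
  consecutive windows overlap and all coins show 1. A shortest such path is induced, so only
  consecutive windows overlap, and by linearity windows of distinct edges share at most one
  coin. Together with \<open>4 k\<^sup>2 d < 2\<^sup>k\<close> the union bound over induced paths decays geometrically, and
  a block coalesces with probability at least 1/2.

  The assumption also gives \<open>- ln (1 - \<epsilon>) \<le> k\<close>, hence the factor \<open>k\<^sup>2 / (- ln (1 - \<epsilon>))\<close> of the time bound
  is at least \<open>k\<close>, and one program serves all \<open>\<epsilon>\<close>.\<close>

text \<open>The remedy is to charge a path \<open>1/2\<close> per coin and, in addition, the number
  of coins through which it can still be continued: an induced path leaves its last window only
  through coins that no earlier window contains. A window with few fresh coins is likely but offers
  few continuations. Per such coin, windows of other edges contribute at most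
  \<open>1/2 - 1/(2 k)\<close> and windows of the same edge at most \<open>9/20 + 1/(2 k)\<close>,
  in total \<open>19/20\<close>. The share \<open>1/(2 k)\<close> is needed at \<open>k = 9\<close>,
  the smallest value that \<open>4 k^2 < 2^k\<close> leaves for a nonempty edge.

  The state after a coalescing block has the wrong law, being conditioned on coalescence. Running on
  through the failing blocks up to the next coalescing one corrects exactly this bias.\<close>

section \<open>The bounding chain and its windows\<close>

locale scan_hypergraph =
  fixes n :: nat and E :: "nat set set"
  assumes edge_subset: "C \<in> E \<Longrightarrow> C \<subseteq> {..<n}"
begin

definition blocked :: "nat set \<Rightarrow> nat \<Rightarrow> bool" where
  "blocked Y v \<longleftrightarrow> (\<exists>C\<in>E. v \<in> C \<and> C - {v} \<subseteq> Y)"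

text \<open>The set \<open>Y\<close> consulted for blocking is kept apart from the set
  \<open>X\<close> that changes, so that the true chain, with \<open>Y = X\<close>, and both bounds
  are instances.\<close>

definition upd :: "nat set \<Rightarrow> nat \<Rightarrow> bool \<Rightarrow> nat set \<Rightarrow> nat set" where
  "upd Y v c X = (if c \<and> \<not> blocked Y v then insert v X else X - {v})"

primrec chain :: "(nat \<Rightarrow> bool) \<Rightarrow> nat \<Rightarrow> nat set \<Rightarrow> nat set" where
  "chain f 0 X = X"
| "chain f (Suc t) X = upd (chain f t X) (t mod n) (f t) (chain f t X)"

text \<open>Lower and upper bounds for all chains run with the same coins, whatever their initial state.
  Blocking is antitone, so each bound is updated by looking at the other.\<close>

primrec bnd :: "(nat \<Rightarrow> bool) \<Rightarrow> nat \<Rightarrow> nat set \<times> nat set" where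
  "bnd f 0 = ({}, {..<n})"
| "bnd f (Suc t) = (upd (snd (bnd f t)) (t mod n) (f t) (fst (bnd f t)),
                    upd (fst (bnd f t)) (t mod n) (f t) (snd (bnd f t)))"

abbreviation lo where "lo f t \<equiv> fst (bnd f t)"
abbreviation hi where "hi f t \<equiv> snd (bnd f t)"

definition coalesced :: "(nat \<Rightarrow> bool) \<Rightarrow> nat \<Rightarrow> bool" where
  "coalesced f t \<longleftrightarrow> lo f t = hi f t"

lemma blocked_mono: "Y \<subseteq> Z \<Longrightarrow> blocked Y v \<Longrightarrow> blocked Z v"
  unfolding blocked_def by blast

lemma upd_mono: "Z \<subseteq> Y \<Longrightarrow> X \<subseteq> W \<Longrightarrow> upd Y v c X \<subseteq> upd Z v c W"
  using blocked_mono[of Z Y v] by (auto simp: upd_def)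

lemma mem_upd_other: "u \<noteq> v \<Longrightarrow> u \<in> upd Y v c X \<longleftrightarrow> u \<in> X"
  by (auto simp: upd_def)

lemma mem_upd_same: "v \<in> upd Y v c X \<longleftrightarrow> c \<and> \<not> blocked Y v"
  by (auto simp: upd_def)

lemma chain_between:
  assumes "X \<subseteq> {..<n}"
  shows "lo f t \<subseteq> chain f t X \<and> chain f t X \<subseteq> hi f t"
proof (induction t)
  case (Suc t)
  then show ?case by (simp add: upd_mono)
qed (use assms in simp)

lemma lo_subset_hi: "lo f t \<subseteq> hi f t"
  using chain_between[of "{}" f t] by blast

lemma hi_subset: "0 < n \<Longrightarrow> hi f t \<subseteq> {..<n}"
  by (induction t) (auto simp: upd_def)

lemma chain_coalesced: "X \<subseteq> {..<n} \<Longrightarrow> coalesced f t \<Longrightarrow> chain f t X = lo f t"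
  using chain_between[of X f t] by (auto simp: coalesced_def)

lemma chain_cong: "(\<And>s. s < t \<Longrightarrow> f s = g s) \<Longrightarrow> chain f t X = chain g t X"
  by (induction t) auto

lemma bnd_cong: "(\<And>s. s < t \<Longrightarrow> f s = g s) \<Longrightarrow> bnd f t = bnd g t"
  by (induction t) auto

lemma coalesced_cong: "(\<And>s. s < t \<Longrightarrow> f s = g s) \<Longrightarrow> coalesced f t = coalesced g t"
  using bnd_cong[of t f g] by (simp add: coalesced_def)

end

text \<open>Times with the same residue differ by a multiple of \<open>n\<close>, and here they lie
  within \<open>n\<close> consecutive times. Hence the last update of a vertex is unique.\<close>

lemma mod_eq_imp_eq_window:
  fixes s s' t n :: nat
  assumes "s \<le> t" "t < s + n" "s' \<le> t" "t < s' + n" "s mod n = s' mod n"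
  shows "s = s'"
proof -
  have aux: "a = b" if "a \<le> b" "b < a + n" "b mod n = a mod n" for a b :: nat
  proof -
    have "n dvd b - a" using that mod_eq_dvd_iff_nat by blast
    moreover have "b - a < n" using that by linarith
    ultimately have "b - a = 0" using nat_dvd_not_less by blast
    then show ?thesis using that by simp
  qed
  show ?thesis
    using aux[of s s'] aux[of s' s] assms by (cases "s \<le> s'") auto
qed

text \<open>The last update of \<open>u\<close> lies in the current round if \<open>u\<close> has
  already had its turn and in the previous round otherwise, which exists because
  \<open>n \<le> t\<close>.\<close>

lemma ex_window_mod:
  fixes u t n :: nat
  assumes "u < n" "n \<le> t"
  shows "\<exists>s. s \<le> t \<and> t < s + n \<and> s mod n = u"
proof -
  have t: "n * (t div n) + t mod n = t" "t mod n < n" using assms by auto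
  show ?thesis
  proof (cases "u \<le> t mod n")
    case True
    have "(n * (t div n) + u) mod n = u" using assms by simp
    moreover have "n * (t div n) + u \<le> t" "t < n * (t div n) + u + n" using t True by linarith+
    ultimately show ?thesis by blast
  next
    case False
    obtain q where q: "t div n = Suc q" using assms by (metis div_greater_zero_iff gr0_conv_Suc not_less0 gr0I)
    have "n * (t div n) = n * q + n" by (simp add: q)
    then have "n * q + u \<le> t" "t < n * q + u + n" using t False assms by linarith+
    moreover have "(n * q + u) mod n = u" using assms by simp
    ultimately show ?thesis by blast
  qed
qed

locale linear_scan = scan_hypergraph +
  fixes k d T :: nat
  assumes npos: "0 < n"
    and finE: "finite E"
    and edge_card: "C \<in> E \<Longrightarrow> card C = k"
    and degree: "v < n \<Longrightarrow> card {C \<in> E. v \<in> C} \<le> d"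
    and linear: "C \<in> E \<Longrightarrow> C' \<in> E \<Longrightarrow> C \<noteq> C' \<Longrightarrow> card (C \<inter> C') \<le> 1"
    and k9: "9 \<le> k"
    and kd: "4 * k\<^sup>2 * d < 2 ^ k"
begin

text \<open>\<open>win (C, t)\<close> is the set of the times at which the vertices of \<open>C\<close> were last updated up to time \<open>t\<close>.\<close>

definition win :: "nat set \<times> nat \<Rightarrow> nat set" where
  "win e = {s. s \<le> snd e \<and> snd e < s + n \<and> s mod n \<in> fst e}"

text \<open>Demanding \<open>n \<le> t\<close> makes every window complete, with \<open>k\<close>
  elements. Admitting only times at which a vertex of the edge is updated keeps the windows of
  distinct nodes distinct.\<close>

definition nodes :: "(nat set \<times> nat) set" where
  "nodes = {(C, t). C \<in> E \<and> t mod n \<in> C \<and> n \<le> t \<and> t < T * n}"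

lemma finite_nodes: "finite nodes"
  by (rule finite_subset[of _ "E \<times> {..<T * n}"]) (auto simp: nodes_def finE)

lemma finite_win [simp]: "finite (win e)"
  by (rule finite_subset[of _ "{..snd e}"]) (auto simp: win_def)

lemma finite_edge: "C \<in> E \<Longrightarrow> finite C"
  using edge_subset finite_subset by blast

lemma inj_on_win: "inj_on (\<lambda>s. s mod n) (win e)"
  by (auto simp: inj_on_def win_def intro: mod_eq_imp_eq_window[of _ "snd e" n])

lemma image_win:
  assumes "e \<in> nodes"
  shows "(\<lambda>s. s mod n) ` win e = fst e"
proof -
  have e: "fst e \<in> E" "n \<le> snd e" using assms by (auto simp: nodes_def)
  then have "u < n" if "u \<in> fst e" for u using that edge_subset by blast
  then have "\<exists>s. s \<le> snd e \<and> snd e < s + n \<and> s mod n = u" if "u \<in> fst e" for u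
    using that ex_window_mod[of u n "snd e"] e(2) by blast
  then show ?thesis by (force simp: win_def image_iff)
qed

lemma card_win: "e \<in> nodes \<Longrightarrow> card (win e) = k"
  using card_image[OF inj_on_win, of e] image_win[of e] edge_card[of "fst e"]
  by (auto simp: nodes_def)

lemma snd_in_win: "e \<in> nodes \<Longrightarrow> snd e \<in> win e"
  using npos by (auto simp: nodes_def win_def)

lemma card_win_diff_sym:
  assumes "e \<in> nodes" "e' \<in> nodes"
  shows "card (win e - win e') = card (win e' - win e)"
  using assms card_win by (metis card_Diff_subset_Int finite_Int finite_win inf_commute)

text \<open>A shared time is the update of a shared vertex, and by linearity there is at most
  one.\<close>

lemma card_win_diff_other:
  assumes e: "e \<in> nodes" "e' \<in> nodes" "fst e \<noteq> fst e'"
  shows "k - 1 \<le> card (win e' - win e)"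
proof -
  have C: "fst e \<in> E" "fst e' \<in> E" using e by (auto simp: nodes_def)
  have "(\<lambda>s. s mod n) ` (win e' \<inter> win e) \<subseteq> fst e' \<inter> fst e"
    by (auto simp: win_def)
  then have "card ((\<lambda>s. s mod n) ` (win e' \<inter> win e)) \<le> card (fst e' \<inter> fst e)"
    using C finite_edge by (intro card_mono) auto
  then have "card (win e' \<inter> win e) \<le> 1"
    using linear[OF C(2) C(1)] e(3)
    by (subst (asm) card_image) (auto intro: inj_on_subset[OF inj_on_win[of e]])
  then show ?thesis using card_win[OF e(2)] by (simp add: card_Diff_subset_Int)
qed

text \<open>Overlap forces \<open>t < t' + n\<close>, so no update after \<open>t'\<close> has
  dropped out of the window at \<open>t\<close>. The difference thus measures the shift between the
  windows in updates of \<open>C\<close>.\<close>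

lemma card_win_diff_same:
  assumes "(C, t) \<in> nodes" "(C, t') \<in> nodes" "win (C, t') \<inter> win (C, t) \<noteq> {}" "t' < t"
  shows "card (win (C, t) - win (C, t')) = card {s. t' < s \<and> s \<le> t \<and> s mod n \<in> C}"
proof -
  obtain s where "s \<le> t'" "t < s + n" using assms(3) by (auto simp: win_def)
  then have "t < t' + n" by linarith
  then have "win (C, t) - win (C, t') = {s. t' < s \<and> s \<le> t \<and> s mod n \<in> C}"
    using assms(4) by (auto simp: win_def)
  then show ?thesis by simp
qed

lemma card_win_diff_pos:
  assumes e: "e \<in> nodes" "e' \<in> nodes" "e \<noteq> e'" "win e' \<inter> win e \<noteq> {}"
  shows "1 \<le> card (win e' - win e)"
proof (cases "fst e = fst e'")
  case False
  then show ?thesis using card_win_diff_other[OF e(1,2)] k9 by linarith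
next
  case True
  \<comment> \<open>Equal sizes turn inclusion into equality, and a window determines its time as
    its largest element.\<close>
  have "\<not> win e' \<subseteq> win e"
  proof
    assume "win e' \<subseteq> win e"
    then have eq: "win e' = win e" using card_win[OF e(1)] card_win[OF e(2)]
      by (intro card_subset_eq) auto
    have "snd e \<in> win e'" "snd e' \<in> win e"
      using snd_in_win[OF e(1)] snd_in_win[OF e(2)] eq by simp_all
    then have "snd e \<le> snd e'" "snd e' \<le> snd e" by (simp_all add: win_def)
    then show False using True e(3) by (simp add: prod_eq_iff)
  qed
  then have "win e' - win e \<noteq> {}" by blast
  then show ?thesis by (simp add: Suc_le_eq card_gt_0_iff)
qed

end

section \<open>Weights of overlapping windows\<close>

text \<open>The bound is the full tail from \<open>M\<close> on of the series of
  \<open>j / 2^j\<close>; the expressions \<open>2 (j + 1) / 2^j\<close> telescope.\<close>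

lemma sum_half_power_le:
  assumes "M \<le> k"
  shows "(\<Sum>j\<in>{M..<k}. (1/2) ^ j * real j) \<le> 2 * (real M + 1) * (1/2) ^ M"
proof -
  have "(\<Sum>j\<in>{M..<k}. (1/2) ^ j * real j) + 2 * (real k + 1) * (1/2) ^ k = 2 * (real M + 1) * (1/2) ^ M"
    using assms
  proof (induction k rule: dec_induct)
    case (step i)
    have "2 * (real (Suc i) + 1) * (1/2) ^ Suc i = 2 * (real i + 1) * (1/2) ^ i - (1/2) ^ i * real i"
      by (simp add: algebra_simps add_divide_distrib)
    moreover have "(\<Sum>j\<in>{M..<Suc i}. (1/2) ^ j * real j) = (\<Sum>j\<in>{M..<i}. (1/2) ^ j * real j) + (1/2) ^ i * real i"
      using step(1) by (simp add: sum.atLeastLessThan_Suc)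
    ultimately show ?case using step(3) by linarith
  qed simp
  then show ?thesis by (smt (verit) mult_nonneg_nonneg of_nat_0_le_iff zero_le_power divide_nonneg_nonneg)
qed

lemma Suc_mult_half_power_le: "8 \<le> m \<Longrightarrow> (real m + 1) * (1/2) ^ m \<le> 9 / 256"
proof (induction m rule: dec_induct)
  case base
  then show ?case by (simp add: power_divide)
next
  case (step m)
  have "(real (Suc m) + 1) * (1/2) ^ Suc m \<le> (real m + 1) * (1/2) ^ m"
    by (simp add: algebra_simps)
  then show ?case using step by linarith
qed

text \<open>Here \<open>a\<close> is the number of coins available for attaching and
  \<open>M\<close> the least possible shift. The left side is twice the tail of the series, once for
  each direction in time; \<open>1 / (2 k)\<close> is what the other edges leave over from
  \<open>1/2\<close>.\<close>

lemma same_edge_weight_bound: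
  fixes a k :: nat
  assumes "1 \<le> a" "a \<le> k" "9 \<le> k"
  defines "M \<equiv> max 1 (k - a)"
  shows "4 * (real M + 1) * (1/2) ^ M \<le> (9/20 + 1 / (2 * real k)) * real a"
proof (cases "k - a \<le> 1")
  case True
  then have M: "M = 1" by (simp add: M_def)
  have a: "real k - 1 \<le> real a" using True assms by linarith
  \<comment> \<open>At \<open>k = 9\<close> the product \<open>9/20 * 8\<close> is only 3.6; the
    summand \<open>1 / (2 * real k)\<close> lifts it above 4.\<close>
  have "4 \<le> (9/20 + 1 / (2 * real k)) * (real k - 1)"
  proof -
    have "1 / real k \<le> 1 / 9" using assms by (intro divide_left_mono) auto
    moreover have "(9/20 + 1 / (2 * real k)) * (real k - 1) = 9/20 * (real k - 1) + 1/2 - 1/2 * (1 / real k)"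
      using assms by (simp add: field_simps)
    moreover have "real k \<ge> 9" using assms by simp
    ultimately show ?thesis by argo
  qed
  also have "\<dots> \<le> (9/20 + 1 / (2 * real k)) * real a"
    using a by (intro mult_left_mono) auto
  finally show ?thesis by (simp add: M)
next
  case False
  then have M: "M = k - a" by (simp add: M_def)
  have "4 * (real M + 1) * (1/2) ^ M \<le> 9/20 * real a"
  proof (cases "8 \<le> M")
    case True
    have "4 * (real M + 1) * (1/2) ^ M = 4 * ((real M + 1) * (1/2) ^ M)" by simp
    also have "\<dots> \<le> 9/20 * real a"
      using Suc_mult_half_power_le[OF True] assms(1) by linarith
    finally show ?thesis .
  next
    case False
    \<comment> \<open>Six numerical cases with \<open>a\<close> at least \<open>9 - M\<close>; the
      tightest is \<open>M = 2\<close>, with 3 against 3.15.\<close>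
    then have "M \<in> {2,3,4,5,6,7}" using \<open>\<not> k - a \<le> 1\<close> M by auto
    moreover have "real a \<ge> 9 - real M" using M assms by linarith
    ultimately show ?thesis by (auto simp: power_divide)
  qed
  also have "\<dots> \<le> (9/20 + 1 / (2 * real k)) * real a" by (intro mult_right_mono) auto
  finally show ?thesis .
qed

context linear_scan
begin

text \<open>The set \<open>D\<close> stands for the coins of \<open>win e\<close> through which an
  induced path may still leave \<open>e\<close>.\<close>

definition nbrs :: "nat set \<times> nat \<Rightarrow> nat set \<Rightarrow> (nat set \<times> nat) set" where
  "nbrs e D = {e' \<in> nodes. e' \<noteq> e \<and> win e' \<inter> win e \<noteq> {} \<and> win e' \<inter> win e \<subseteq> D}"

text \<open>The probability that \<open>j\<close> fresh coins all show 1, times the number, again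
  \<open>j\<close>, of coins through which the path can then go on.\<close>

definition wt :: "nat \<Rightarrow> real" where
  "wt j = (1/2) ^ j * real j"

lemma wt_nonneg: "0 \<le> wt j"
  by (simp add: wt_def)

lemma finite_nbrs: "finite (nbrs e D)"
  by (rule finite_subset[OF _ finite_nodes]) (auto simp: nbrs_def)

lemma card_win_diff_less:
  assumes "e \<in> nodes" "win e \<inter> win e' \<noteq> {}"
  shows "card (win e - win e') \<le> k - 1"
proof -
  have "card (win e \<inter> win e') \<ge> 1" using assms(2) by (simp add: Suc_le_eq card_gt_0_iff)
  then show ?thesis using card_win[OF assms(1)] by (simp add: card_Diff_subset_Int)
qed

text \<open>A window is found by choosing the shared coin \<open>s\<close> in \<open>D\<close>, one
  of at most \<open>d\<close> edges through the vertex updated at \<open>s\<close>, and one of at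
  most \<open>k\<close> update times of that edge in the \<open>n\<close> steps from
  \<open>s\<close> on.\<close>

lemma card_nbrs_other:
  assumes "e \<in> nodes" "D \<subseteq> win e"
  shows "card {e' \<in> nbrs e D. fst e' \<noteq> fst e} \<le> card D * (d * k)"
proof -
  define W where "W s C = {t. s \<le> t \<and> t < s + n \<and> t mod n \<in> C}" for s and C :: "nat set"
  define U where "U s = (\<Union>C\<in>{C \<in> E. s mod n \<in> C}. Pair C ` W s C)" for s
  have finW: "finite (W s C)" for s C
    by (rule finite_subset[of _ "{..<s+n}"]) (auto simp: W_def)
  have finD: "finite D" using assms(2) finite_subset finite_win by blast
  have "inj_on (\<lambda>t. t mod n) (W s C)" for s C
  proof (rule inj_onI)
    fix x y assume xy: "x \<in> W s C" "y \<in> W s C" "x mod n = y mod n"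
    have "s \<le> x" "x < s + n" "s \<le> y" "y < s + n" using xy by (auto simp: W_def)
    then show "x = y"
      using mod_eq_imp_eq_window[of x "max x y" n y] xy(3) by (simp add: max_def split: if_splits)
  qed
  then have cW: "card (W s C) \<le> k" if "C \<in> E" for s C
    using that card_inj_on_le[of "\<lambda>t. t mod n" "W s C" C] finite_edge edge_card by (force simp: W_def)
  have cU: "card (U s) \<le> d * k" for s
  proof -
    have "card (U s) \<le> (\<Sum>C\<in>{C \<in> E. s mod n \<in> C}. card (Pair C ` W s C))"
      unfolding U_def by (intro card_UN_le) (auto simp: finE)
    also have "\<dots> \<le> (\<Sum>C\<in>{C \<in> E. s mod n \<in> C}. k)"
      by (intro sum_mono) (auto intro: order.trans[OF card_image_le[OF finW] cW])
    also have "\<dots> \<le> d * k" using degree[of "s mod n"] npos by simp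
    finally show ?thesis .
  qed
  have finU: "finite (U s)" for s by (auto simp: U_def finE finW)
  have "{e' \<in> nbrs e D. fst e' \<noteq> fst e} \<subseteq> (\<Union>s\<in>D. U s)"
  proof
    fix e' assume "e' \<in> {e' \<in> nbrs e D. fst e' \<noteq> fst e}"
    then have e': "e' \<in> nodes" "win e' \<inter> win e \<noteq> {}" "win e' \<inter> win e \<subseteq> D" by (auto simp: nbrs_def)
    then obtain s where s: "s \<in> win e'" "s \<in> D" by blast
    have "e' \<in> U s" using s(1) e'(1) by (cases e') (auto simp: U_def W_def win_def nodes_def)
    then show "e' \<in> (\<Union>s\<in>D. U s)" using s(2) by blast
  qed
  then have "card {e' \<in> nbrs e D. fst e' \<noteq> fst e} \<le> card (\<Union>s\<in>D. U s)"
    using finD finU by (intro card_mono) auto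
  also have "\<dots> \<le> (\<Sum>s\<in>D. card (U s))" using finD by (rule card_UN_le)
  also have "\<dots> \<le> (\<Sum>s\<in>D. d * k)" by (intro sum_mono cU)
  finally show ?thesis by simp
qed

text \<open>By linearity exactly one coin is shared, so every weight is \<open>wt (k - 1)\<close>.
  The product of this weight with the number of windows is controlled by
  \<open>4 k^2 d < 2^k\<close>.\<close>

lemma sum_nbrs_other:
  assumes "e \<in> nodes" "D \<subseteq> win e"
  shows "(\<Sum>e'\<in>{e' \<in> nbrs e D. fst e' \<noteq> fst e}. wt (card (win e' - win e)))
           \<le> real (card D) * (1/2 - 1 / (2 * real k))"
proof -
  let ?A = "{e' \<in> nbrs e D. fst e' \<noteq> fst e}"
  have "card (win e' - win e) = k - 1" if "e' \<in> ?A" for e'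
  proof (rule antisym)
    have e': "e' \<in> nodes" "fst e \<noteq> fst e'" "win e' \<inter> win e \<noteq> {}" using that by (auto simp: nbrs_def)
    show "card (win e' - win e) \<le> k - 1" by (rule card_win_diff_less[OF e'(1,3)])
    show "k - 1 \<le> card (win e' - win e)" by (rule card_win_diff_other[OF assms(1) e'(1,2)])
  qed
  then have "(\<Sum>e'\<in>?A. wt (card (win e' - win e))) = real (card ?A) * wt (k - 1)" by simp
  also have "\<dots> \<le> real (card D * (d * k)) * wt (k - 1)"
    using card_nbrs_other[OF assms] by (intro mult_right_mono wt_nonneg) linarith
  also have "\<dots> = real (card D) * (real (d * k) * wt (k - 1))" by simp
  also have "\<dots> \<le> real (card D) * (1/2 - 1 / (2 * real k))"
  proof (intro mult_left_mono)
    have "real (4 * k\<^sup>2 * d) \<le> real (2 ^ k)" using kd of_nat_le_iff less_imp_le by blast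
    then have *: "4 * (real k)\<^sup>2 * real d \<le> 2 ^ k" by simp
    have "real (d * k) * wt (k - 1) = (4 * (real k)\<^sup>2 * real d) / 2 ^ k * ((real k - 1) / (2 * real k))"
    proof -
      have aux: "(x * b) * (c / y) = 4 * x\<^sup>2 * b / (2 * y) * (c / (2 * x))" if "x \<noteq> 0" "y \<noteq> 0"
        for x y b c :: real using that by (simp add: field_simps power2_eq_square)
      have "(2::real) ^ k = 2 * 2 ^ (k - 1)" using k9 by (cases k) auto
      moreover have "real (k - 1) = real k - 1" using k9 by simp
      moreover have "real (d * k) * wt (k - 1) = (real k * real d) * (real (k - 1) / 2 ^ (k - 1))"
        by (simp add: wt_def power_divide)
      ultimately show ?thesis using aux[of "real k" "2 ^ (k - 1)" "real d" "real k - 1"] k9 by simp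
    qed
    also have "\<dots> \<le> 1 * ((real k - 1) / (2 * real k))"
      using * k9 by (intro mult_right_mono) auto
    also have "\<dots> = 1/2 - 1 / (2 * real k)" using k9 by (simp add: field_simps)
    finally show "real (d * k) * wt (k - 1) \<le> 1/2 - 1 / (2 * real k)" .
  qed simp
  finally show ?thesis .
qed

lemma sum_inj_wt_le:
  assumes "inj_on g A" "g ` A \<subseteq> {M..<k}"
  shows "(\<Sum>x\<in>A. wt (g x)) \<le> (\<Sum>j\<in>{M..<k}. wt j)"
proof -
  have "(\<Sum>x\<in>A. wt (g x)) = (\<Sum>j\<in>g ` A. wt j)" using sum.reindex[OF assms(1), of wt] by simp
  also have "\<dots> \<le> (\<Sum>j\<in>{M..<k}. wt j)" using assms(2) by (intro sum_mono2) (auto simp: wt_nonneg)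
  finally show ?thesis .
qed

text \<open>A window of the same edge that meets \<open>win e\<close> only within \<open>D\<close> is shifted by at least \<open>k - card D\<close>
  updates of that edge, and every shift occurs at most once in either direction.\<close>

lemma sum_nbrs_same:
  assumes e: "e \<in> nodes" "D \<subseteq> win e"
  shows "(\<Sum>e'\<in>{e' \<in> nbrs e D. fst e' = fst e}. wt (card (win e' - win e)))
           \<le> 2 * (\<Sum>j\<in>{max 1 (k - card D)..<k}. wt j)"
proof -
  obtain C t where et: "e = (C, t)" by (cases e)
  let ?g = "\<lambda>e'. card (win e' - win e)"
  let ?M = "max 1 (k - card D)"
  let ?h = "\<lambda>a b. {s. a < s \<and> s \<le> b \<and> s mod n \<in> C}"
  define P where "P = {e' \<in> nbrs e D. fst e' = fst e \<and> snd e < snd e'}"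
  define Q where "Q = {e' \<in> nbrs e D. fst e' = fst e \<and> snd e' < snd e}"
  have range: "?g e' \<in> {?M..<k}" if "e' \<in> nbrs e D" for e'
  proof -
    have e': "e' \<in> nodes" "e' \<noteq> e" "win e' \<inter> win e \<noteq> {}" "win e' \<inter> win e \<subseteq> D"
      using that by (auto simp: nbrs_def)
    have "1 \<le> ?g e'" using card_win_diff_pos[OF e(1) e'(1)] e' by blast
    moreover have "?g e' < k" using card_win_diff_less[OF e'(1,3)] k9 by linarith
    moreover have "k - card D \<le> ?g e'"
    proof -
      have "win e - D \<subseteq> win e - win e'" using e'(4) by blast
      then have "card (win e - D) \<le> card (win e - win e')" by (intro card_mono) auto
      moreover have "card (win e - D) = k - card D"
        using e card_win finite_subset[OF e(2) finite_win] by (simp add: card_Diff_subset)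
      ultimately show ?thesis using card_win_diff_sym[OF e(1) e'(1)] by simp
    qed
    ultimately show ?thesis by simp
  qed
  have finh: "finite (?h a b)" for a b by (rule finite_subset[of _ "{..b}"]) auto
  have gP: "?g (C, t') = card (?h t t')" if "(C, t') \<in> P" for t'
    using that card_win_diff_same[of C t' t] e(1) unfolding et P_def nbrs_def by auto
  have gQ: "?g (C, t') = card (?h t' t)" if "(C, t') \<in> Q" for t'
    using that card_win_diff_same[of C t t'] card_win_diff_sym[of "(C, t)" "(C, t')"] e(1)
    unfolding et Q_def nbrs_def by auto
  have CP: "fst x = C" if "x \<in> P \<union> Q" for x using that by (auto simp: P_def Q_def et)
  have modC: "snd x mod n \<in> C" if "x \<in> P \<union> Q" for x using that by (auto simp: P_def Q_def et nbrs_def nodes_def)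
  \<comment> \<open>The update at \<open>t2\<close> is counted in the larger shift but not in the
    smaller one, so shifts in one direction never repeat.\<close>
  have lessP: "?g (C, t1) < ?g (C, t2)" if "(C, t1) \<in> P" "(C, t2) \<in> P" "t1 < t2" for t1 t2
  proof -
    have "t2 \<in> ?h t t2" "t2 \<notin> ?h t t1" using that modC[of "(C, t2)"] by (auto simp: P_def et)
    moreover have "?h t t1 \<subseteq> ?h t t2" using that by auto
    ultimately show ?thesis unfolding gP[OF that(1)] gP[OF that(2)]
      by (intro psubset_card_mono finh) blast
  qed
  have lessQ: "?g (C, t2) < ?g (C, t1)" if "(C, t1) \<in> Q" "(C, t2) \<in> Q" "t1 < t2" for t1 t2
  proof -
    have "t2 \<in> ?h t1 t" "t2 \<notin> ?h t2 t" using that modC[of "(C, t2)"] by (auto simp: Q_def et)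
    moreover have "?h t2 t \<subseteq> ?h t1 t" using that by auto
    ultimately show ?thesis unfolding gQ[OF that(1)] gQ[OF that(2)]
      by (intro psubset_card_mono finh) blast
  qed
  have "inj_on ?g P"
  proof (rule inj_onI)
    fix x y assume xy: "x \<in> P" "y \<in> P" "?g x = ?g y"
    obtain t1 t2 where "x = (C, t1)" "y = (C, t2)" using CP xy by (metis UnI1 prod.collapse)
    then show "x = y" using lessP[of t1 t2] lessP[of t2 t1] xy by (cases t1 t2 rule: linorder_cases) auto
  qed
  then have sP: "(\<Sum>e'\<in>P. wt (?g e')) \<le> (\<Sum>j\<in>{?M..<k}. wt j)"
    using range by (intro sum_inj_wt_le) (auto simp: P_def)
  have "inj_on ?g Q"
  proof (rule inj_onI)
    fix x y assume xy: "x \<in> Q" "y \<in> Q" "?g x = ?g y"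
    obtain t1 t2 where "x = (C, t1)" "y = (C, t2)" using CP xy by (metis UnI2 prod.collapse)
    then show "x = y" using lessQ[of t1 t2] lessQ[of t2 t1] xy by (cases t1 t2 rule: linorder_cases) auto
  qed
  then have sQ: "(\<Sum>e'\<in>Q. wt (?g e')) \<le> (\<Sum>j\<in>{?M..<k}. wt j)"
    using range by (intro sum_inj_wt_le) (auto simp: Q_def)
  have "{e' \<in> nbrs e D. fst e' = fst e} = P \<union> Q"
    by (auto simp: P_def Q_def nbrs_def prod_eq_iff)
  moreover have "(\<Sum>e'\<in>P \<union> Q. wt (?g e')) = (\<Sum>e'\<in>P. wt (?g e')) + (\<Sum>e'\<in>Q. wt (?g e'))"
    using finite_nbrs[of e D] by (intro sum.union_disjoint) (auto simp: P_def Q_def)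
  ultimately show ?thesis using sP sQ by simp
qed

text \<open>The contraction behind the union bound: the two terms \<open>1 / (2 k)\<close> cancel,
  which leaves \<open>1/2 + 9/20\<close> per coin of \<open>D\<close>.\<close>

lemma sum_nbrs_le:
  assumes e: "e \<in> nodes" "D \<subseteq> win e"
  shows "(\<Sum>e'\<in>nbrs e D. wt (card (win e' - win e))) \<le> 19/20 * real (card D)"
proof (cases "D = {}")
  case True
  then have "nbrs e D = {}" by (auto simp: nbrs_def)
  then show ?thesis by simp
next
  case False
  have finD: "finite D" using e finite_subset finite_win by blast
  have D: "1 \<le> card D" "card D \<le> k"
    using False finD e card_mono[OF finite_win e(2)] card_win[OF e(1)] by (auto simp: Suc_le_eq card_gt_0_iff)
  let ?g = "\<lambda>e'. wt (card (win e' - win e))"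
  let ?M = "max 1 (k - card D)"
  have "nbrs e D = {e' \<in> nbrs e D. fst e' \<noteq> fst e} \<union> {e' \<in> nbrs e D. fst e' = fst e}" by blast
  then have "(\<Sum>e'\<in>nbrs e D. ?g e') =
      (\<Sum>e'\<in>{e' \<in> nbrs e D. fst e' \<noteq> fst e}. ?g e') + (\<Sum>e'\<in>{e' \<in> nbrs e D. fst e' = fst e}. ?g e')"
    using finite_nbrs[of e D] by (subst sum.union_disjoint[symmetric]) (auto intro: sum.cong)
  also have "\<dots> \<le> real (card D) * (1/2 - 1 / (2 * real k)) + 2 * (\<Sum>j\<in>{?M..<k}. wt j)"
    using sum_nbrs_other[OF e] sum_nbrs_same[OF e] by linarith
  also have "\<dots> \<le> real (card D) * (1/2 - 1 / (2 * real k)) + 2 * (2 * (real ?M + 1) * (1/2) ^ ?M)"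
    using sum_half_power_le[of ?M k] D k9 by (auto simp: wt_def)
  also have "\<dots> \<le> real (card D) * (1/2 - 1 / (2 * real k)) + (9/20 + 1 / (2 * real k)) * real (card D)"
  proof -
    have "2 * (2 * (real ?M + 1) * (1/2) ^ ?M) = 4 * (real ?M + 1) * (1/2) ^ ?M"
      by simp
    then show ?thesis using same_edge_weight_bound[OF D k9] by linarith
  qed
  also have "\<dots> = 19/20 * real (card D)" by (simp add: algebra_simps)
  finally show ?thesis .
qed

end

section \<open>Percolation paths\<close>

text \<open>In a walk of least length any forward chord or repeated neighbour would be a shortcut.
  Excluding forward chords is what a path built node by node requires.\<close>

lemma shortest_walk_induced:
  assumes "(x, y) \<in> R\<^sup>*"
  obtains g l where "g 0 = x" "g l = y" "\<And>i. i < l \<Longrightarrow> (g i, g (Suc i)) \<in> R"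
    "\<And>i j. i + 2 \<le> j \<Longrightarrow> j \<le> l \<Longrightarrow> (g i, g j) \<notin> R"
    "\<And>i. i < l \<Longrightarrow> g i \<noteq> g (Suc i)"
proof -
  define l where "l = (LEAST l. (x, y) \<in> R ^^ l)"
  have l: "(x, y) \<in> R ^^ l" using assms unfolding l_def rtrancl_power by (metis (mono_tags) LeastI_ex)
  have least: "l \<le> l'" if "(x, y) \<in> R ^^ l'" for l' using that unfolding l_def by (rule Least_le)
  obtain g where g: "g 0 = x" "g l = y" "\<And>i. i < l \<Longrightarrow> (g i, g (Suc i)) \<in> R"
    using l by (auto simp: relpow_fun_conv)
  have seg: "(g a, g b) \<in> R ^^ (b - a)" if "a \<le> b" "b \<le> l" for a b
    using that g(3) by (auto simp: relpow_fun_conv intro!: exI[of _ "\<lambda>i. g (a + i)"])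
  have "(g i, g j) \<notin> R" if "i + 2 \<le> j" "j \<le> l" for i j
  proof
    assume "(g i, g j) \<in> R"
    then have "(x, g j) \<in> R ^^ Suc i" using seg[of 0 i] g(1) that by (auto intro: relpow_Suc_I)
    then have "(x, y) \<in> R ^^ Suc i O R ^^ (l - j)" using seg[of j l] g(2) that by blast
    then have "(x, y) \<in> R ^^ (Suc i + (l - j))" by (simp only: relpow_add)
    then show False using least that by fastforce
  qed
  moreover have "g i \<noteq> g (Suc i)" if "i < l" for i
  proof
    assume "g i = g (Suc i)"
    then have "(x, y) \<in> R ^^ i O R ^^ (l - Suc i)"
      using seg[of 0 i] seg[of "Suc i" l] g(1,2) that by fastforce
    then have "(x, y) \<in> R ^^ (i + (l - Suc i))" by (simp only: relpow_add)
    then show False using least that by fastforce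
  qed
  ultimately show ?thesis using that g by blast
qed

text \<open>A list that is true on \<open>D\<close> is determined by its true positions outside
  \<open>D\<close>.\<close>

lemma card_bool_lists_true_on_le:
  assumes "D \<subseteq> {..<N}"
  shows "real (card {l :: bool list. length l = N \<and> (\<forall>s\<in>D. l ! s)}) \<le> 2 ^ N * (1/2) ^ card D"
proof -
  let ?A = "{l :: bool list. length l = N \<and> (\<forall>s\<in>D. l ! s)}"
  let ?g = "\<lambda>l :: bool list. {s. s < N \<and> l ! s} - D"
  have "inj_on ?g ?A"
  proof (rule inj_onI)
    fix l l' assume l: "l \<in> ?A" "l' \<in> ?A" "?g l = ?g l'"
    show "l = l'"
    proof (rule nth_equalityI)
      fix i assume "i < length l"
      then show "l ! i = l' ! i" using l by (cases "i \<in> D") (auto simp: set_eq_iff)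
    qed (use l in simp)
  qed
  then have "card ?A \<le> card (Pow ({..<N} - D))" by (rule card_inj_on_le) auto
  also have "\<dots> = 2 ^ (N - card D)"
    using assms finite_subset[OF assms] by (simp add: card_Pow card_Diff_subset)
  finally have "real (card ?A) \<le> 2 ^ (N - card D)" by (metis of_nat_le_iff of_nat_numeral of_nat_power)
  also have "\<dots> = 2 ^ N * (1/2) ^ card D"
    using card_mono[OF _ assms] by (simp add: power_diff power_divide)
  finally show ?thesis .
qed

section \<open>How discrepancies between the two bounds arise and persist\<close>

context scan_hypergraph
begin

text \<open>Only discrepancies created by an update are recorded: once a vertex has been updated,
  any discrepancy at it stems from its last update.\<close>

definition bad :: "(nat \<Rightarrow> bool) \<Rightarrow> nat \<Rightarrow> bool" where
  "bad f t \<longleftrightarrow> t mod n \<in> hi f (Suc t) \<and> t mod n \<notin> lo f (Suc t)"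

lemma bnd_unchanged:
  assumes "s \<le> t" "\<And>s'. s \<le> s' \<Longrightarrow> s' < t \<Longrightarrow> s' mod n \<noteq> u"
  shows "(u \<in> hi f t \<longleftrightarrow> u \<in> hi f s) \<and> (u \<in> lo f t \<longleftrightarrow> u \<in> lo f s)"
  using assms
proof (induction t rule: dec_induct)
  case (step t)
  have "t mod n \<noteq> u" using step by auto
  moreover have "(u \<in> hi f t \<longleftrightarrow> u \<in> hi f s) \<and> (u \<in> lo f t \<longleftrightarrow> u \<in> lo f s)"
    using step by (meson less_SucI)
  ultimately show ?case by (simp add: mem_upd_other)
qed simp

lemma bnd_last_update:
  assumes "s \<le> t" "t < s + n" "s mod n = u" "t mod n \<noteq> u"
  shows "s < t" "u \<in> hi f t \<longleftrightarrow> u \<in> hi f (Suc s)" "u \<in> lo f t \<longleftrightarrow> u \<in> lo f (Suc s)"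
proof -
  show s: "s < t" using assms by (metis le_neq_implies_less)
  have "s' mod n \<noteq> u" if "Suc s \<le> s'" "s' < t" for s'
    using mod_eq_imp_eq_window[of s t n s'] assms that by auto
  then show "u \<in> hi f t \<longleftrightarrow> u \<in> hi f (Suc s)" "u \<in> lo f t \<longleftrightarrow> u \<in> lo f (Suc s)"
    using bnd_unchanged[of "Suc s" t u f] s by auto
qed

text \<open>Both bounds see the same coin, so they part only if some edge blocks with respect to
  \<open>hi\<close> but not with respect to \<open>lo\<close>; a vertex in which it fails to block
  is itself a discrepancy.\<close>

lemma bad_blocked:
  assumes "bad f t"
  obtains C u where "f t" "C \<in> E" "t mod n \<in> C" "C - {t mod n} \<subseteq> hi f t"
    "u \<in> C" "u \<noteq> t mod n" "u \<in> hi f t" "u \<notin> lo f t"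
proof -
  have "f t" "\<not> blocked (lo f t) (t mod n)" "blocked (hi f t) (t mod n)"
    using assms by (auto simp: bad_def mem_upd_same)
  then show ?thesis using that unfolding blocked_def by blast
qed

lemma not_coalesced_imp_bad:
  assumes "\<not> coalesced f (T * n)" "1 \<le> T" "0 < n"
  shows "\<exists>t. (T - 1) * n \<le> t \<and> t < T * n \<and> bad f t"
proof -
  obtain u where u: "u \<in> hi f (T * n)" "u \<notin> lo f (T * n)"
    using assms lo_subset_hi[of f "T * n"] by (auto simp: coalesced_def)
  have un: "u < n" using hi_subset[OF assms(3)] u by blast
  define t where "t = (T - 1) * n + u"
  have Tn: "T * n = (T - 1) * n + n" using assms(2) by (cases T) auto
  have t: "t mod n = u" "(T - 1) * n \<le> t" "t < T * n" using un Tn by (auto simp: t_def)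
  have "s' mod n \<noteq> u" if "Suc t \<le> s'" "s' < T * n" for s'
    using mod_eq_imp_eq_window[of t s' n s'] that t Tn by auto
  then have "bad f t" unfolding bad_def t(1)
    using bnd_unchanged[of "Suc t" "T * n" u f] t u by auto
  then show ?thesis using t by blast
qed

text \<open>Covers the inputs without edges separately from the window estimate. For
  \<open>n = 0\<close> both bounds are empty from the start.\<close>

lemma no_edges_coalesced: "E = {} \<Longrightarrow> 1 \<le> T \<Longrightarrow> coalesced f (T * n)"
proof (cases "n = 0")
  case True
  then have "T * n = 0" by simp
  then have "lo f (T * n) = {}" "hi f (T * n) = {..<n}" by (simp_all only: bnd.simps fst_conv snd_conv)
  moreover have "{..<n} = {}" using True by blast
  ultimately show ?thesis unfolding coalesced_def by (simp only:)
next
  case False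
  assume "E = {}" "1 \<le> T"
  then show ?thesis using not_coalesced_imp_bad[of f T] False by (metis bad_blocked empty_iff gr0I)
qed

end

context linear_scan
begin

text \<open>The other vertices of the blocking edge lie in \<open>hi\<close>, hence were put there
  by a coin 1 at their last update. This uses \<open>n \<le> t\<close>, as \<open>hi\<close> also
  contains every vertex not yet updated. The last update of the discrepant vertex continues the
  search backwards.\<close>

lemma bad_step:
  assumes "bad f t" "n \<le> t"
  shows "\<exists>C\<in>E. t mod n \<in> C \<and> (\<forall>s\<in>win (C, t). f s) \<and> (\<exists>s\<in>win (C, t). s < t \<and> bad f s)"
proof -
  obtain C u where C: "f t" "C \<in> E" "t mod n \<in> C" "C - {t mod n} \<subseteq> hi f t"
    and u: "u \<in> C" "u \<noteq> t mod n" "u \<in> hi f t" "u \<notin> lo f t"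
    using bad_blocked[OF assms(1)] by metis
  have "f s" if s: "s \<in> win (C, t)" for s
  proof (cases "s mod n = t mod n")
    case True
    then have "s = t" using s mod_eq_imp_eq_window[of s t n t] npos by (auto simp: win_def)
    then show ?thesis using C by simp
  next
    case False
    have "s mod n \<in> hi f (Suc s)"
      using bnd_last_update(2)[of s t "s mod n" f] s C(4) False by (auto simp: win_def)
    then show ?thesis by (auto simp: mem_upd_same)
  qed
  moreover obtain s where s: "s \<le> t" "t < s + n" "s mod n = u"
    using ex_window_mod[of u n t] assms u C edge_subset by blast
  have "s < t" "bad f s"
    using bnd_last_update(1)[OF s] bnd_last_update(2,3)[OF s, of f] u s(3)
    by (auto simp: bad_def simp del: bnd.simps)
  moreover have "s \<in> win (C, t)" using s u by (auto simp: win_def)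
  ultimately show ?thesis using C by blast
qed

section \<open>Walks through windows all of whose coins show 1\<close>

definition on :: "(nat \<Rightarrow> bool) \<Rightarrow> (nat set \<times> nat) set" where
  "on f = {e \<in> nodes. \<forall>s\<in>win e. f s}"

definition overlap :: "(nat \<Rightarrow> bool) \<Rightarrow> ((nat set \<times> nat) \<times> (nat set \<times> nat)) set" where
  "overlap f = {(e, e'). e \<in> on f \<and> e' \<in> on f \<and> win e \<inter> win e' \<noteq> {}}"

text \<open>Descent by \<open>bad_step\<close> ends at a discrepancy of round 0, which carries no
  window; the window that led to it ends before \<open>2 * n\<close>.\<close>

lemma bad_walk:
  "bad f t \<Longrightarrow> n \<le> t \<Longrightarrow> t < T * n \<Longrightarrow>
    \<exists>C e'. (C, t) \<in> on f \<and> ((C, t), e') \<in> (overlap f)\<^sup>* \<and> snd e' < 2 * n"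
proof (induction t rule: less_induct)
  case (less t)
  obtain C s where C: "C \<in> E" "t mod n \<in> C" "\<And>s. s \<in> win (C, t) \<Longrightarrow> f s"
    and s: "s \<in> win (C, t)" "s < t" "bad f s"
    using bad_step[OF less.prems(1,2)] by blast
  have e: "(C, t) \<in> on f" using C less.prems by (auto simp: on_def nodes_def)
  show ?case
  proof (cases "n \<le> s")
    case True
    then obtain C' e' where C': "(C', s) \<in> on f" "((C', s), e') \<in> (overlap f)\<^sup>*" "snd e' < 2 * n"
      using less.IH[of s] s less.prems by auto
    have "s \<in> win (C', s)" using snd_in_win[of "(C', s)"] C'(1) by (auto simp: on_def)
    then have "((C, t), (C', s)) \<in> overlap f" using e C' s by (auto simp: overlap_def)
    then show ?thesis using e C' by (meson converse_rtrancl_into_rtrancl)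
  next
    case False
    then have "t < 2 * n" using s by (auto simp: win_def)
    then show ?thesis using e by (metis rtrancl.rtrancl_refl snd_conv)
  qed
qed

text \<open>Induced paths are stored with the most recent node first. The next node may only attach at a
  time in \<open>dset\<close>, which is why a path is weighted by the size of that set.\<close>

definition cov :: "(nat set \<times> nat) list \<Rightarrow> nat set" where
  "cov p = \<Union> (win ` set p)"

definition dset :: "(nat set \<times> nat) list \<Rightarrow> nat set" where
  "dset p = win (hd p) - cov (tl p)"

definition ext :: "(nat set \<times> nat) list \<Rightarrow> (nat set \<times> nat) set" where
  "ext p = {e' \<in> nodes. e' \<noteq> hd p \<and> win e' \<inter> win (hd p) \<noteq> {} \<and> win e' \<inter> cov (tl p) = {}}"

primrec paths :: "nat \<Rightarrow> (nat set \<times> nat) list set" where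
  "paths 0 = (\<lambda>e. [e]) ` {e \<in> nodes. (T - 1) * n \<le> snd e}"
| "paths (Suc s) = (\<lambda>(p, e). e # p) ` Sigma (paths s) ext"

lemma paths_nodes: "p \<in> paths s \<Longrightarrow> p \<noteq> [] \<and> set p \<subseteq> nodes"
proof (induction s arbitrary: p)
  case (Suc s)
  then obtain q e where "p = e # q" "q \<in> paths s" "e \<in> nodes" by (auto simp: ext_def)
  then show ?case using Suc.IH[of q] by auto
qed auto

lemma finite_ext: "finite (ext p)"
  by (rule finite_subset[OF _ finite_nodes]) (auto simp: ext_def)

lemma finite_paths: "finite (paths s)"
  by (induction s) (auto simp: finite_nodes finite_ext)

lemma finite_cov [simp]: "finite (cov p)"
  by (simp add: cov_def)

lemma cov_eq: "p \<noteq> [] \<Longrightarrow> cov p = win (hd p) \<union> cov (tl p)"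
  by (cases p) (auto simp: cov_def)

lemma cov_Cons: "cov (e # p) = win e \<union> cov p"
  by (auto simp: cov_def)

text \<open>As the new window avoids all older ones except the last, its coins outside the last
  window are exactly the fresh ones. Their number is both the growth of \<open>cov\<close> and the
  size of the next \<open>dset\<close>, which is why \<open>wt\<close> has its form.\<close>

lemma ext_new_coins:
  assumes "p \<noteq> []" "e \<in> ext p"
  shows "dset (e # p) = win e - win (hd p)" "card (cov (e # p)) = card (cov p) + card (win e - win (hd p))"
proof -
  show 1: "dset (e # p) = win e - win (hd p)"
    using assms cov_eq[OF assms(1)] by (auto simp: dset_def ext_def)
  have "cov (e # p) = cov p \<union> (win e - win (hd p))" using cov_eq[OF assms(1)] by (auto simp: cov_Cons)
  moreover have "cov p \<inter> (win e - win (hd p)) = {}"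
    using cov_eq[OF assms(1)] assms by (auto simp: ext_def)
  ultimately show "card (cov (e # p)) = card (cov p) + card (win e - win (hd p))"
    by (simp add: card_Un_disjoint)
qed

definition pwt :: "(nat set \<times> nat) list \<Rightarrow> real" where
  "pwt p = (1/2) ^ card (cov p) * real (card (dset p))"

lemma sum_ext_le:
  assumes "p \<in> paths s"
  shows "(\<Sum>e\<in>ext p. pwt (e # p)) \<le> 19/20 * pwt p"
proof -
  have p: "p \<noteq> []" "hd p \<in> nodes" using paths_nodes[OF assms] by (auto dest: hd_in_set)
  have "(\<Sum>e\<in>ext p. pwt (e # p)) = (\<Sum>e\<in>ext p. (1/2) ^ card (cov p) * wt (card (win e - win (hd p))))"
    using ext_new_coins[OF p(1)] by (intro sum.cong) (auto simp: pwt_def wt_def power_add)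
  also have "\<dots> = (1/2) ^ card (cov p) * (\<Sum>e\<in>ext p. wt (card (win e - win (hd p))))"
    by (simp add: sum_distrib_left)
  also have "\<dots> \<le> (1/2) ^ card (cov p) * (\<Sum>e\<in>nbrs (hd p) (dset p). wt (card (win e - win (hd p))))"
    by (intro mult_left_mono sum_mono2 finite_nbrs) (auto simp: ext_def nbrs_def dset_def wt_nonneg)
  also have "\<dots> \<le> (1/2) ^ card (cov p) * (19/20 * real (card (dset p)))"
    by (intro mult_left_mono sum_nbrs_le p) (auto simp: dset_def)
  finally show ?thesis by (simp add: pwt_def)
qed

text \<open>The last round offers at most \<open>n * d\<close> starting windows, one for each time
  and each edge at the vertex updated then.\<close>

lemma sum_paths_0: "(\<Sum>p\<in>paths 0. pwt p) \<le> real n * real d * (real k * (1/2) ^ k)"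
proof -
  let ?top = "{e \<in> nodes. (T - 1) * n \<le> snd e}"
  let ?I = "{(T - 1) * n..<T * n}"
  have "pwt [e] = real k * (1/2) ^ k" if "e \<in> ?top" for e
    using that card_win[of e] by (simp add: pwt_def dset_def cov_def)
  then have "(\<Sum>p\<in>paths 0. pwt p) = real (card ?top) * (real k * (1/2) ^ k)"
    by (simp add: sum.reindex inj_on_def)
  also have "\<dots> \<le> real (n * d) * (real k * (1/2) ^ k)"
  proof (intro mult_right_mono of_nat_mono)
    have "?top \<subseteq> (\<Union>t\<in>?I. (\<lambda>C. (C, t)) ` {C \<in> E. t mod n \<in> C})"
      by (auto simp: nodes_def)
    then have "card ?top \<le> card (\<Union>t\<in>?I. (\<lambda>C. (C, t)) ` {C \<in> E. t mod n \<in> C})"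
      by (intro card_mono) (auto simp: finE)
    also have "\<dots> \<le> (\<Sum>t\<in>?I. card ((\<lambda>C. (C, t)) ` {C \<in> E. t mod n \<in> C}))"
      by (intro card_UN_le) auto
    also have "\<dots> \<le> (\<Sum>t\<in>?I. d)"
    proof (intro sum_mono)
      fix t
      have "card ((\<lambda>C. (C, t)) ` {C \<in> E. t mod n \<in> C}) \<le> card {C \<in> E. t mod n \<in> C}"
        by (intro card_image_le) (simp add: finE)
      also have "\<dots> \<le> d" using degree npos by simp
      finally show "card ((\<lambda>C. (C, t)) ` {C \<in> E. t mod n \<in> C}) \<le> d" .
    qed
    also have "\<dots> \<le> n * d" by (cases T) auto
    finally show "card ?top \<le> n * d" .
  qed auto
  finally show ?thesis by simp
qed

lemma sum_paths_le: "(\<Sum>p\<in>paths s. pwt p) \<le> (19/20) ^ s * (real n * real d * (real k * (1/2) ^ k))"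
proof (induction s)
  case 0
  then show ?case using sum_paths_0 by simp
next
  case (Suc s)
  have "(\<Sum>p\<in>paths (Suc s). pwt p) = (\<Sum>(p, e)\<in>Sigma (paths s) ext. pwt (e # p))"
    by (simp add: sum.reindex inj_on_def split_beta)
  also have "\<dots> = (\<Sum>p\<in>paths s. \<Sum>e\<in>ext p. pwt (e # p))"
    by (simp add: sum.Sigma finite_paths finite_ext)
  also have "\<dots> \<le> (\<Sum>p\<in>paths s. 19/20 * pwt p)" by (intro sum_mono sum_ext_le)
  also have "\<dots> = 19/20 * (\<Sum>p\<in>paths s. pwt p)" by (simp add: sum_distrib_left)
  also have "\<dots> \<le> 19/20 * ((19/20) ^ s * (real n * real d * (real k * (1/2) ^ k)))"
    using Suc by (intro mult_left_mono) auto
  finally show ?case by simp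
qed

text \<open>The number of coins for a continuation is never 0, so the weights dominate the
  probabilities in the union bound.\<close>

lemma pwt_ge: "p \<in> paths s \<Longrightarrow> (1/2) ^ card (cov p) \<le> pwt p"
proof -
  assume p: "p \<in> paths s"
  have "1 \<le> card (dset p)"
  proof (cases s)
    case 0
    then show ?thesis using p card_win k9 by (auto simp: dset_def cov_def)
  next
    case (Suc s')
    then obtain q e where q: "p = e # q" "q \<in> paths s'" "e \<in> ext q" using p by auto
    then have "hd q \<in> nodes" "q \<noteq> []" using paths_nodes[OF q(2)] by (auto dest: hd_in_set)
    then show ?thesis
      using ext_new_coins(1)[of q e] card_win_diff_pos[of "hd q" e] q by (auto simp: ext_def)
  qed
  then show ?thesis
    using mult_left_mono[of 1 "real (card (dset p))" "(1/2) ^ card (cov p)"] by (simp add: pwt_def)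
qed

text \<open>One overlap goes back in time by at most \<open>n\<close>. A walk from the last round to
  a time below \<open>2 * n\<close> therefore has at least \<open>T - 2\<close> steps, of which the
  first \<open>T - 2\<close> are kept.\<close>

lemma not_coalesced_imp_path:
  assumes "\<not> coalesced f (T * n)" "2 \<le> T"
  shows "\<exists>p\<in>paths (T - 2). \<forall>s\<in>cov p. f s"
proof -
  obtain t where t: "(T - 1) * n \<le> t" "t < T * n" "bad f t"
    using not_coalesced_imp_bad[of f T] assms npos by auto
  have "1 * n \<le> (T - 1) * n" using assms(2) by (intro mult_right_mono) auto
  then have "n \<le> t" using t(1) by linarith
  then obtain C e' where C: "(C, t) \<in> on f" "((C, t), e') \<in> (overlap f)\<^sup>*" "snd e' < 2 * n"
    using bad_walk[OF t(3) _ t(2)] by blast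
  obtain g l where g: "g 0 = (C, t)" "g l = e'" "\<And>i. i < l \<Longrightarrow> (g i, g (Suc i)) \<in> overlap f"
    "\<And>i j. i + 2 \<le> j \<Longrightarrow> j \<le> l \<Longrightarrow> (g i, g j) \<notin> overlap f"
    "\<And>i. i < l \<Longrightarrow> g i \<noteq> g (Suc i)"
    using shortest_walk_induced[OF C(2)] by metis
  have on: "g i \<in> on f" if "i \<le> l" for i
    using that C(1) g(1) g(3)[of "i - 1"] by (cases i) (auto simp: overlap_def)
  have "t \<le> snd (g i) + i * n" if "i \<le> l" for i
    using that
  proof (induction i)
    case 0
    then show ?case using g(1) by simp
  next
    case (Suc i)
    have "win (g i) \<inter> win (g (Suc i)) \<noteq> {}" using g(3)[of i] Suc by (auto simp: overlap_def)
    then have "snd (g i) \<le> snd (g (Suc i)) + n" by (auto simp: win_def)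
    then show ?case using Suc by auto
  qed
  then have "(T - 1) * n < 2 * n + l * n" using C(3) g(2) t(1) by fastforce
  then have "(T - 1) * n < (2 + l) * n" by (simp add: algebra_simps)
  then have "T - 1 < 2 + l" by (metis mult_less_cancel2)
  then have len: "T - 2 \<le> l" by linarith
  have "map g (rev [0..<Suc i]) \<in> paths i" if "i \<le> l" for i
    using that
  proof (induction i)
    case 0
    then show ?case using C(1) t g(1) by (auto simp: on_def)
  next
    case (Suc i)
    let ?p = "map g (rev [0..<Suc i])"
    have IH: "?p \<in> paths i" using Suc by simp
    have hd: "hd ?p = g i" and tl: "tl ?p = map g (rev [0..<i])" by simp_all
    \<comment> \<open>All nodes of the walk are in \<open>on f\<close>, so the absence of a chord
      means disjoint windows.\<close>
    have "win (g (Suc i)) \<inter> win (g j) = {}" if "j < i" for j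
      using g(4)[of j "Suc i"] Suc.prems that on[of j] on[of "Suc i"] by (auto simp: overlap_def)
    then have "win (g (Suc i)) \<inter> cov (tl ?p) = {}" unfolding tl by (auto simp: cov_def disjoint_iff)
    then have "g (Suc i) \<in> ext ?p"
      using g(3)[of i] g(5)[of i] Suc.prems unfolding ext_def hd by (auto simp: overlap_def on_def)
    then have "g (Suc i) # ?p \<in> paths (Suc i)" using IH by (auto simp del: upt_Suc)
    then show ?case by simp
  qed
  then have "map g (rev [0..<Suc (T - 2)]) \<in> paths (T - 2)" using len by simp
  moreover have "f s" if s: "s \<in> cov (map g (rev [0..<Suc (T - 2)]))" for s
  proof -
    obtain a where a: "a < Suc (T - 2)" "s \<in> win (g a)"
      using s by (auto simp: cov_def simp del: upt_Suc)
    have "a \<le> l" using a(1) len by linarith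
    then show ?thesis using on[of a] a(2) by (simp add: on_def)
  qed
  ultimately show ?thesis by blast
qed

lemma card_not_coalesced_le:
  assumes "2 \<le> T"
  shows "real (card {l. length l = T * n \<and> \<not> coalesced ((!) l) (T * n)})
    \<le> 2 ^ (T * n) * ((19/20) ^ (T - 2) * (real n * real d * (real k * (1/2) ^ k)))"
proof -
  let ?N = "T * n"
  let ?A = "\<lambda>p. {l :: bool list. length l = ?N \<and> (\<forall>s\<in>cov p. l ! s)}"
  have fin: "finite (?A p)" for p
    using finite_lists_length_eq[of "UNIV :: bool set" ?N] by (rule rev_finite_subset) auto
  have "{l. length l = ?N \<and> \<not> coalesced ((!) l) ?N} \<subseteq> (\<Union>p\<in>paths (T - 2). ?A p)"
    using not_coalesced_imp_path[OF _ assms] by auto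
  then have "card {l. length l = ?N \<and> \<not> coalesced ((!) l) ?N} \<le> card (\<Union>p\<in>paths (T - 2). ?A p)"
    using finite_paths fin by (intro card_mono) auto
  also have "\<dots> \<le> (\<Sum>p\<in>paths (T - 2). card (?A p))" by (intro card_UN_le finite_paths)
  finally have "real (card {l. length l = ?N \<and> \<not> coalesced ((!) l) ?N}) \<le> real (\<Sum>p\<in>paths (T - 2). card (?A p))"
    by (rule of_nat_mono)
  also have "\<dots> = (\<Sum>p\<in>paths (T - 2). real (card (?A p)))" by (rule of_nat_sum)
  also have "\<dots> \<le> (\<Sum>p\<in>paths (T - 2). 2 ^ ?N * pwt p)"
  proof (rule sum_mono)
    fix p assume p: "p \<in> paths (T - 2)"
    have "win e \<subseteq> {..<?N}" if "e \<in> nodes" for e using that by (auto simp: win_def nodes_def)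
    then have "cov p \<subseteq> {..<?N}" using paths_nodes[OF p] unfolding cov_def by blast
    then have "real (card (?A p)) \<le> 2 ^ ?N * (1/2) ^ card (cov p)" by (rule card_bool_lists_true_on_le)
    also have "\<dots> \<le> 2 ^ ?N * pwt p" using pwt_ge[OF p] by (intro mult_left_mono) auto
    finally show "real (card (?A p)) \<le> 2 ^ ?N * pwt p" .
  qed
  also have "\<dots> = 2 ^ ?N * (\<Sum>p\<in>paths (T - 2). pwt p)" by (simp add: sum_distrib_left)
  also have "\<dots> \<le> 2 ^ ?N * ((19/20) ^ (T - 2) * (real n * real d * (real k * (1/2) ^ k)))"
    by (intro mult_left_mono sum_paths_le) auto
  finally show ?thesis .
qed

text \<open>Since \<open>(19/20)^14 < 1/2\<close>, fourteen rounds per doubling of \<open>n\<close>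
  pay for the factor \<open>n\<close> of the starting windows; the two extra rounds make up for the
  \<open>T - 2\<close> in the path length.\<close>

lemma card_not_coalesced_le_half:
  assumes "T = 2 + 14 * L" "n \<le> 2 ^ L"
  shows "real (card {l. length l = T * n \<and> \<not> coalesced ((!) l) (T * n)}) \<le> 2 ^ (T * n) / 2"
proof -
  have "(19/20) ^ (T - 2) = ((19/20) ^ 14 :: real) ^ L" using assms(1) by (simp add: power_mult)
  also have "\<dots> \<le> (1/2) ^ L" by (intro power_mono) (simp_all add: power_divide)
  finally have 1: "(19/20 :: real) ^ (T - 2) \<le> (1/2) ^ L" .
  have "real (4 * k\<^sup>2 * d) \<le> real (2 ^ k)" using kd of_nat_le_iff less_imp_le by blast
  then have "4 * (real k * (real k * real d)) \<le> 2 ^ k" by (simp add: power2_eq_square mult_ac)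
  moreover have "1 * (real k * real d) \<le> real k * (real k * real d)"
    using k9 by (intro mult_right_mono) auto
  ultimately have 2: "real d * (real k * (1/2) ^ k) \<le> 1/4" by (simp add: power_divide field_simps)
  have "(19/20) ^ (T - 2) * (real n * real d * (real k * (1/2) ^ k))
      = ((19/20) ^ (T - 2) * real n) * (real d * (real k * (1/2) ^ k))" by simp
  also have "\<dots> \<le> ((1/2) ^ L * 2 ^ L) * (1/4)"
  proof (intro mult_mono 1 2)
    show "real n \<le> 2 ^ L" using assms(2) by (metis of_nat_le_iff of_nat_numeral of_nat_power)
  qed auto
  also have "\<dots> \<le> 1/2" by (simp add: power_divide)
  finally have "(19/20) ^ (T - 2) * (real n * real d * (real k * (1/2) ^ k)) \<le> 1/2" .
  then have "2 ^ (T * n) * ((19/20) ^ (T - 2) * (real n * real d * (real k * (1/2) ^ k))) \<le> 2 ^ (T * n) * (1/2)"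
    by (intro mult_left_mono) auto
  moreover have "2 \<le> T" using assms(1) by simp
  ultimately show ?thesis using card_not_coalesced_le by linarith
qed

end

section \<open>Stationarity of the uniform distribution\<close>

lemma sum_lists_snoc:
  "(\<Sum>l | length l = Suc t. h l) = (\<Sum>l | length l = t. \<Sum>c\<in>UNIV. h (l @ [c :: bool]))"
proof -
  have "{l :: bool list. length l = Suc t} = (\<lambda>(l, c). l @ [c]) ` ({l. length l = t} \<times> UNIV)"
    by (auto simp: image_iff length_Suc_conv_rev)
  then have "(\<Sum>l | length l = Suc t. h l) = (\<Sum>(l, c)\<in>{l. length l = t} \<times> UNIV. h (l @ [c]))"
    by (simp add: sum.reindex inj_on_def split_beta)
  then show ?thesis by (simp add: sum.cartesian_product)
qed

lemma sum_lists_Cons: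
  "(\<Sum>l | length l = Suc t. h l) = (\<Sum>c\<in>UNIV. \<Sum>l | length l = t. h ((c :: bool) # l))"
proof -
  have "{l :: bool list. length l = Suc t} = (\<lambda>(c, l). c # l) ` (UNIV \<times> {l. length l = t})"
    by (auto simp: image_iff length_Suc_conv)
  then have "(\<Sum>l | length l = Suc t. h l) = (\<Sum>(c, l)\<in>UNIV \<times> {l. length l = t}. h (c # l))"
    by (simp add: sum.reindex inj_on_def split_beta)
  then show ?thesis by (simp add: sum.cartesian_product)
qed

lemma finite_bool_lists: "finite {l :: bool list. length l = N}"
  using finite_lists_length_eq[of "UNIV :: bool set" N] by simp

lemma card_bool_lists: "card {l :: bool list. length l = N} = 2 ^ N"
  using card_lists_length_eq[of "UNIV :: bool set" N] by simp

context scan_hypergraph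
begin

definition indep :: "nat set set" where
  "indep = {X. X \<subseteq> {..<n} \<and> (\<forall>C\<in>E. \<not> C \<subseteq> X)}"

lemma finite_indep: "finite indep"
  by (rule finite_subset[of _ "Pow {..<n}"]) (auto simp: indep_def)

lemma upd_indep: "X \<in> indep \<Longrightarrow> v < n \<Longrightarrow> upd X v c X \<in> indep"
  unfolding indep_def upd_def blocked_def by auto

lemma chain_indep:
  assumes "X \<in> indep" "0 < n \<or> t = 0"
  shows "chain f t X \<in> indep"
  using assms by (induction t) (auto intro!: upd_indep)

lemma blocked_indep: "X \<in> indep \<Longrightarrow> blocked X v \<Longrightarrow> v \<notin> X"
  unfolding indep_def blocked_def by blast

text \<open>The uniform distribution is preserved because the update is one component of an involution on
  pairs of a coin and a state.\<close>

lemma sum_upd_indep: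
  fixes g :: "nat set \<Rightarrow> real"
  assumes "v < n"
  shows "(\<Sum>c\<in>UNIV. \<Sum>x\<in>indep. g (upd x v c x)) = 2 * (\<Sum>x\<in>indep. g x)"
proof -
  \<comment> \<open>The new coin remembers what the update erases, the old membership of
    \<open>v\<close>. If \<open>v\<close> is blocked it was absent and stays absent, so the coin is
    kept.\<close>
  define \<phi> where "\<phi> a = (if blocked (snd a) v then fst a else v \<in> snd a, upd (snd a) v (fst a) (snd a))" for a
  have inv: "\<phi> (\<phi> a) = a" if "a \<in> UNIV \<times> indep" for a
  proof (cases "blocked (snd a) v")
    case True
    then have "v \<notin> snd a" using blocked_indep that by auto
    then have "\<phi> a = a" using True by (auto simp: \<phi>_def upd_def prod_eq_iff)
    then show ?thesis by simp
  next
    case False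
    moreover have "blocked (insert v X) v = blocked X v" "blocked (X - {v}) v = blocked X v" for X
      by (auto simp: blocked_def)
    ultimately show ?thesis by (auto simp: \<phi>_def upd_def prod_eq_iff)
  qed
  have closed: "\<phi> a \<in> UNIV \<times> indep" if "a \<in> UNIV \<times> indep" for a
    using that upd_indep[OF _ assms] by (auto simp: \<phi>_def)
  have snd: "snd (\<phi> a) = upd (snd a) v (fst a) (snd a)" for a by (simp add: \<phi>_def)
  have "(\<Sum>a\<in>UNIV \<times> indep. g (upd (snd a) v (fst a) (snd a))) = (\<Sum>a\<in>(UNIV :: bool set) \<times> indep. g (snd a))"
    by (rule sum.reindex_bij_witness[where i = \<phi> and j = \<phi>]) (simp_all only: inv closed snd)
  then show ?thesis by (simp add: sum.cartesian_product' UNIV_bool)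
qed

text \<open>Summing over the last coin first leaves a function of the state before the last update,
  to which the induction hypothesis applies; hence the induction generalises
  \<open>g\<close>.\<close>

lemma sum_chain_indep:
  fixes g :: "nat set \<Rightarrow> real"
  assumes "0 < n \<or> t = 0"
  shows "(\<Sum>l | length l = t. \<Sum>x\<in>indep. g (chain ((!) l) t x)) = 2 ^ t * (\<Sum>x\<in>indep. g x)"
  using assms
proof (induction t arbitrary: g)
  case (Suc t)
  then have n: "t mod n < n" by simp
  have c: "chain ((!) (l @ [c])) t x = chain ((!) l) t x" if "length l = t" for l c x
    using that by (intro chain_cong) (auto simp: nth_append)
  have "(\<Sum>l | length l = Suc t. \<Sum>x\<in>indep. g (chain ((!) l) (Suc t) x)) =
     (\<Sum>l | length l = t. \<Sum>x\<in>indep. \<Sum>c\<in>UNIV. g (upd (chain ((!) l) t x) (t mod n) c (chain ((!) l) t x)))"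
    unfolding sum_lists_snoc
  proof (rule sum.cong[OF refl])
    fix l :: "bool list" assume "l \<in> {l. length l = t}"
    then have l: "length l = t" by simp
    have "(\<Sum>b\<in>UNIV. \<Sum>x\<in>indep. g (chain ((!) (l @ [b])) (Suc t) x)) =
        (\<Sum>b\<in>UNIV. \<Sum>x\<in>indep. g (upd (chain ((!) l) t x) (t mod n) b (chain ((!) l) t x)))"
      by (simp add: c[OF l] l nth_append)
    also have "\<dots> = (\<Sum>x\<in>indep. \<Sum>b\<in>UNIV. g (upd (chain ((!) l) t x) (t mod n) b (chain ((!) l) t x)))"
      by (rule sum.swap)
    finally show "(\<Sum>b\<in>UNIV. \<Sum>x\<in>indep. g (chain ((!) (l @ [b])) (Suc t) x)) = \<dots>" .
  qed
  also have "\<dots> = 2 ^ t * (\<Sum>x\<in>indep. \<Sum>c\<in>UNIV. g (upd x (t mod n) c x))"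
    using Suc.IH[of "\<lambda>y. \<Sum>c\<in>UNIV. g (upd y (t mod n) c y)"] Suc.prems by auto
  also have "(\<Sum>x\<in>indep. \<Sum>c\<in>UNIV. g (upd x (t mod n) c x)) = 2 * (\<Sum>x\<in>indep. g x)"
    using sum_upd_indep[OF n, of g] by (subst sum.swap) simp
  finally show ?case by simp
qed simp

end

section \<open>Coin tosses\<close>

interpretation coin: prob_space coin_space
  unfolding coin_space_def by (intro prob_space.prob_space_stream_space measure_pmf.prob_space_axioms)

lemma sets_coin_space: "sets coin_space = sets (stream_space (count_space UNIV))"
  unfolding coin_space_def by (intro sets_stream_space_cong) simp

lemma space_coin_space [simp]: "space coin_space = UNIV"
  unfolding coin_space_def by (simp add: space_stream_space)

lemma coin_measurable_cong: "measurable coin_space M = measurable (stream_space (count_space UNIV)) M"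
  by (intro measurable_cong_sets sets_coin_space refl)

text \<open>Lists of tosses carry the discrete sigma-algebra, so an event decided by
  \<open>M\<close> tosses is a preimage under \<open>stake M\<close>.\<close>

lemma sets_coin_prefix:
  assumes "\<And>w w'. stake M w = stake M w' \<Longrightarrow> w \<in> A \<Longrightarrow> w' \<in> A"
  shows "A \<in> sets coin_space"
proof -
  have "stake M \<in> measurable coin_space (count_space UNIV)"
    unfolding coin_measurable_cong by measurable
  then have "stake M -` (stake M ` A) \<inter> space coin_space \<in> sets coin_space"
    by (rule measurable_sets) simp
  moreover have "stake M -` (stake M ` A) = A"
  proof (intro equalityI subsetI)
    fix w assume "w \<in> stake M -` (stake M ` A)"
    then obtain w' where w': "w' \<in> A" "stake M w' = stake M w" by auto
    show "w \<in> A" by (rule assms[OF w'(2,1)])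
  qed auto
  ultimately show ?thesis by simp
qed

lemma measurable_coin_shift [measurable]: "(\<lambda>w. l @- w) \<in> measurable coin_space coin_space"
proof (induction l)
  case (Cons c l)
  have "(\<lambda>w. c ## (l @- w)) \<in> measurable coin_space (stream_space (measure_pmf (pmf_of_set (UNIV :: bool set))))"
    using Cons unfolding coin_space_def by (intro measurable_Stream) auto
  then show ?case by (simp add: coin_space_def)
qed simp

text \<open>Independence of the first \<open>N\<close> tosses from the rest, phrased as an average
  over these tosses.\<close>

lemma nn_integral_coin_space:
  assumes "f \<in> borel_measurable coin_space"
  shows "(\<integral>\<^sup>+w. f w \<partial>coin_space) = (\<Sum>l | length l = N. \<integral>\<^sup>+w. f (l @- w) \<partial>coin_space) / 2 ^ N"
  using assms
proof (induction N arbitrary: f)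
  case (Suc N)
  have m: "(\<lambda>w. f (c ## w)) \<in> borel_measurable coin_space" for c
    using measurable_compose[OF measurable_coin_shift[of "[c]"] Suc.prems] by simp
  have "(\<integral>\<^sup>+w. f w \<partial>coin_space) =
     (\<integral>\<^sup>+c. (\<integral>\<^sup>+w. f (c ## w) \<partial>coin_space) \<partial>measure_pmf (pmf_of_set UNIV))"
    using Suc.prems unfolding coin_space_def
    by (intro prob_space.nn_integral_stream_space measure_pmf.prob_space_axioms)
  also have "\<dots> = (\<Sum>c\<in>UNIV. \<integral>\<^sup>+w. f (c ## w) \<partial>coin_space) / 2"
    by (simp add: nn_integral_pmf_of_set)
  also have "\<dots> = (\<Sum>c\<in>UNIV. (\<Sum>l | length l = N. \<integral>\<^sup>+w. f (c ## (l @- w)) \<partial>coin_space) / 2 ^ N) / 2"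
    by (intro arg_cong2[where f = "(/)"] sum.cong refl Suc.IH m)
  also have "\<dots> = (\<Sum>l | length l = Suc N. \<integral>\<^sup>+w. f (l @- w) \<partial>coin_space) / 2 ^ Suc N"
  proof -
    have "inverse (2 * 2 ^ N :: ennreal) = inverse 2 * inverse (2 ^ N)"
      by (intro ennreal_inverse_mult) (auto simp: power_less_top_ennreal)
    then show ?thesis
      unfolding sum_lists_Cons by (simp add: UNIV_bool divide_ennreal_def ring_distribs mult_ac)
  qed
  finally show ?case .
qed (simp add: divide_ennreal_def)

lemma measure_coin_space:
  assumes "A \<in> sets coin_space"
  shows "measure coin_space A = (\<Sum>l | length l = N. measure coin_space {w. l @- w \<in> A}) / 2 ^ N"
proof -
  have m: "{w. l @- w \<in> A} \<in> sets coin_space" for l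
    using measurable_sets[OF measurable_coin_shift[of l] assms] by (simp add: vimage_def)
  have "ennreal (measure coin_space A) = (\<integral>\<^sup>+w. indicator A w \<partial>coin_space)"
    using assms by (simp add: coin.emeasure_eq_measure)
  also have "\<dots> = (\<Sum>l | length l = N. \<integral>\<^sup>+w. indicator A (l @- w) \<partial>coin_space) / 2 ^ N"
    using assms by (intro nn_integral_coin_space) simp
  also have "\<dots> = (\<Sum>l | length l = N. \<integral>\<^sup>+w. indicator {w. l @- w \<in> A} w \<partial>coin_space) / 2 ^ N"
    by (simp add: indicator_def)
  also have "\<dots> = (\<Sum>l | length l = N. ennreal (measure coin_space {w. l @- w \<in> A})) / 2 ^ N"
    using m by (simp add: coin.emeasure_eq_measure)
  also have "\<dots> = ennreal (\<Sum>l | length l = N. measure coin_space {w. l @- w \<in> A}) / ennreal (2 ^ N)"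
    by (simp add: sum_ennreal ennreal_power[symmetric])
  also have "\<dots> = ennreal ((\<Sum>l | length l = N. measure coin_space {w. l @- w \<in> A}) / 2 ^ N)"
    by (intro divide_ennreal) (auto intro: sum_nonneg)
  finally show ?thesis by (subst (asm) ennreal_inj) (auto intro!: divide_nonneg_nonneg sum_nonneg)
qed

section \<open>Read-once coupling from the past\<close>

context scan_hypergraph
begin

text \<open>\<open>outp N J c x y w\<close>: what is output within \<open>J\<close> blocks of \<open>N\<close> coins each, when \<open>c\<close> coalescing blocks
  are still awaited, \<open>x\<close> is the current state and \<open>y\<close> the state before the last block.\<close>

primrec outp :: "nat \<Rightarrow> nat \<Rightarrow> nat \<Rightarrow> nat set \<Rightarrow> nat set \<Rightarrow> bool stream \<Rightarrow> nat set option" where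
  "outp N 0 c x y w = (if c = 0 then Some y else None)"
| "outp N (Suc J) c x y w = (if c = 0 then Some y else
     outp N J (c - of_bool (coalesced ((!!) w) N)) (chain ((!!) w) N x) x (sdrop N w))"

text \<open>The budget \<open>J\<close> keeps the recursion primitive and the value dependent on
  finitely many tosses; the true number of blocks is the supremum over \<open>J\<close>.\<close>

primrec blocks :: "nat \<Rightarrow> nat \<Rightarrow> nat \<Rightarrow> bool stream \<Rightarrow> nat" where
  "blocks N 0 c w = 0"
| "blocks N (Suc J) c w = (if c = 0 then 0 else
     Suc (blocks N J (c - of_bool (coalesced ((!!) w) N)) (sdrop N w)))"

definition outputs :: "nat \<Rightarrow> nat \<Rightarrow> nat set \<Rightarrow> nat set \<Rightarrow> nat set \<Rightarrow> bool stream set" where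
  "outputs N c x y S = {w. \<exists>J. outp N J c x y w = Some S}"

lemma stake_split:
  assumes "stake (N + M) w = stake (N + M) w'"
  shows "stake N w = stake N w'" "stake M (sdrop N w) = stake M (sdrop N w')"
proof -
  have "stake N w @ stake M (sdrop N w) = stake N w' @ stake M (sdrop N w')"
    using assms by (simp only: stake_add)
  then show "stake N w = stake N w'" "stake M (sdrop N w) = stake M (sdrop N w')"
    by (metis append_eq_append_conv length_stake)+
qed

lemma stake_eq_block:
  assumes "stake N w = stake N w'"
  shows "chain ((!!) w) N x = chain ((!!) w') N x" "coalesced ((!!) w) N = coalesced ((!!) w') N"
proof -
  have eq: "w !! s = w' !! s" if "s < N" for s using assms that by (metis stake_nth)
  show "chain ((!!) w) N x = chain ((!!) w') N x" by (rule chain_cong) (rule eq)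
  show "coalesced ((!!) w) N = coalesced ((!!) w') N" by (rule coalesced_cong) (rule eq)
qed

lemma outp_prefix: "stake (J * N) w = stake (J * N) w' \<Longrightarrow> outp N J c x y w = outp N J c x y w'"
proof (induction J arbitrary: c x y w w')
  case (Suc J)
  then have "stake (N + J * N) w = stake (N + J * N) w'" by simp
  note s = stake_split[OF this]
  show ?case by (simp add: stake_eq_block[OF s(1)] Suc.IH[OF s(2)])
qed simp

lemma blocks_prefix: "stake (J * N) w = stake (J * N) w' \<Longrightarrow> blocks N J c w = blocks N J c w'"
proof (induction J arbitrary: c w w')
  case (Suc J)
  then have "stake (N + J * N) w = stake (N + J * N) w'" by simp
  note s = stake_split[OF this]
  show ?case by (simp add: stake_eq_block[OF s(1)] Suc.IH[OF s(2)])
qed simp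

lemma sets_outputs: "outputs N c x y S \<in> sets coin_space"
proof -
  have "{w. outp N J c x y w = Some S} \<in> sets coin_space" for J
  proof (rule sets_coin_prefix[of "J * N"])
    fix w w' assume s: "stake (J * N) w = stake (J * N) w'" and "w \<in> {w. outp N J c x y w = Some S}"
    then show "w' \<in> {w. outp N J c x y w = Some S}" using outp_prefix[OF s, of c x y] by simp
  qed
  then have "(\<Union>J. {w. outp N J c x y w = Some S}) \<in> sets coin_space" by blast
  moreover have "(\<Union>J. {w. outp N J c x y w = Some S}) = outputs N c x y S" by (auto simp: outputs_def)
  ultimately show ?thesis by simp
qed

lemma measurable_blocks: "(\<lambda>w. ennreal (real (blocks N J c w))) \<in> borel_measurable coin_space"
proof -
  have "blocks N J c \<in> measurable coin_space (count_space UNIV)"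
  proof (rule measurableI)
    show "blocks N J c -` A \<inter> space coin_space \<in> sets coin_space" for A
    proof (rule sets_coin_prefix[of "J * N"])
      fix w w' assume s: "stake (J * N) w = stake (J * N) w'" and "w \<in> blocks N J c -` A \<inter> space coin_space"
      then show "w' \<in> blocks N J c -` A \<inter> space coin_space" using blocks_prefix[OF s, of c] by simp
    qed
  qed simp
  then show ?thesis by measurable
qed

lemma outputs_0: "outputs N 0 x y S = (if y = S then UNIV else {})"
proof -
  have "outp N J 0 x y w = Some y" for J w by (cases J) auto
  then show ?thesis by (auto simp: outputs_def)
qed

lemma outputs_pos:
  assumes "0 < c"
  shows "w \<in> outputs N c x y S \<longleftrightarrow>
    sdrop N w \<in> outputs N (c - of_bool (coalesced ((!!) w) N)) (chain ((!!) w) N x) x S"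
proof -
  have "(\<exists>J. outp N J c x y w = Some S) \<longleftrightarrow> (\<exists>J. outp N (Suc J) c x y w = Some S)"
    using assms by (metis bot_nat_0.not_eq_extremum not0_implies_Suc option.distinct(1) outp.simps(1))
  then show ?thesis using assms by (simp add: outputs_def)
qed

lemma block_shift:
  assumes "length l = N"
  shows "chain ((!!) (l @- w)) N x = chain ((!) l) N x" "coalesced ((!!) (l @- w)) N = coalesced ((!) l) N"
  using assms by (auto intro!: chain_cong coalesced_cong)

lemma measure_outputs_pos:
  assumes "0 < c"
  shows "measure coin_space (outputs N c x y S) =
    (\<Sum>l | length l = N. measure coin_space
       (outputs N (c - of_bool (coalesced ((!) l) N)) (chain ((!) l) N x) x S)) / 2 ^ N"
proof -
  have "{w. l @- w \<in> outputs N c x y S} = outputs N (c - of_bool (coalesced ((!) l) N)) (chain ((!) l) N x) x S"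
    if "length l = N" for l
    using outputs_pos[OF assms] block_shift[OF that] that by (auto simp: sdrop_shift)
  then have "(\<Sum>l | length l = N. measure coin_space {w. l @- w \<in> outputs N c x y S}) =
      (\<Sum>l | length l = N. measure coin_space
       (outputs N (c - of_bool (coalesced ((!) l) N)) (chain ((!) l) N x) x S))"
    by (intro sum.cong) simp_all
  then show ?thesis using measure_coin_space[OF sets_outputs, of N c x y S N] by simp
qed

text \<open>Let \<open>g\<close> and \<open>h\<close> be the output probabilities with one resp. two coalescing blocks awaited. Summing
  the recursion for \<open>g\<close> over all independent sets and using stationarity evaluates the sum of \<open>g\<close> over the
  coalescing blocks; then the constant \<open>\<pi>\<close> solves the recursion for \<open>h\<close>, which is a contraction.\<close>

lemma measure_outputs_two:
  assumes n: "0 < n \<or> N = 0" and x: "x \<in> indep"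
    and pos: "{l. length l = N \<and> coalesced ((!) l) N} \<noteq> {}"
  shows "measure coin_space (outputs N 2 x y S) = of_bool (S \<in> indep) / real (card indep)"
proof -
  define A where "A = {l. length l = N \<and> coalesced ((!) l) N}"
  define B where "B = {l. length l = N \<and> \<not> coalesced ((!) l) N}"
  define F where "F l = chain ((!) l) N" for l
  define g where "g x = measure coin_space (outputs N 1 x {} S)" for x
  define h where "h x = measure coin_space (outputs N 2 x {} S)" for x
  have fin: "finite A" "finite B"
    using finite_bool_lists[of N] by (auto simp: A_def B_def intro: rev_finite_subset)
  have AB: "{l. length l = N} = A \<union> B" "A \<inter> B = {}" by (auto simp: A_def B_def)
  have split: "(\<Sum>l | length l = N. f l) = (\<Sum>l\<in>A. f l) + (\<Sum>l\<in>B. f l)" for f :: "bool list \<Rightarrow> real"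
    unfolding AB(1) using fin AB(2) by (rule sum.union_disjoint)
  have cAB: "real (card A) + real (card B) = 2 ^ N"
    using split[of "\<lambda>_. 1"] card_bool_lists[of N] by simp
  have cA: "0 < card A" using pos fin by (auto simp: A_def card_gt_0_iff)
  have I: "0 < card indep" using x finite_indep by (auto simp: card_gt_0_iff)
  have Fin: "F l x \<in> indep" if "x \<in> indep" for l x using chain_indep[OF that n] by (simp add: F_def)
  have Fconst: "F l x = lo ((!) l) N" if "x \<in> indep" "l \<in> A" for l x
    using that chain_coalesced[of x "(!) l" N] by (auto simp: F_def A_def indep_def)
  \<comment> \<open>While a coalescing block is awaited, \<open>y\<close> is overwritten before it
    can be output.\<close>
  have old: "measure coin_space (outputs N c x y S) = measure coin_space (outputs N c x {} S)" if "0 < c" for c x y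
    unfolding measure_outputs_pos[OF that, of N x y] measure_outputs_pos[OF that, of N x "{}"] ..
  \<comment> \<open>With one block awaited, a coalescing block ends the run and the state
    \<open>x\<close> before it is output.\<close>
  have g: "2 ^ N * g x = real (card A) * of_bool (x = S) + (\<Sum>l\<in>B. g (F l x))" for x
  proof -
    have "2 ^ N * g x = (\<Sum>l | length l = N. measure coin_space
       (outputs N (1 - of_bool (coalesced ((!) l) N)) (chain ((!) l) N x) x S))"
      unfolding g_def by (subst measure_outputs_pos) auto
    also have "\<dots> = (\<Sum>l\<in>A. of_bool (x = S)) + (\<Sum>l\<in>B. g (F l x))"
      unfolding split using old[of 1 _ x] coin.prob_space
      by (intro arg_cong2[where f = "(+)"] sum.cong refl) (simp_all add: A_def B_def F_def g_def outputs_0)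
    finally show ?thesis by simp
  qed
  have h: "2 ^ N * h x = (\<Sum>l\<in>A. g (F l x)) + (\<Sum>l\<in>B. h (F l x))" for x
  proof -
    have "2 ^ N * h x = (\<Sum>l | length l = N. measure coin_space
       (outputs N (2 - of_bool (coalesced ((!) l) N)) (chain ((!) l) N x) x S))"
      unfolding h_def by (subst measure_outputs_pos) auto
    also have "\<dots> = (\<Sum>l\<in>A. g (F l x)) + (\<Sum>l\<in>B. h (F l x))"
      unfolding split using old[of 1 _ x] old[of 2 _ x]
      by (intro arg_cong2[where f = "(+)"] sum.cong refl) (simp_all add: A_def B_def F_def g_def h_def)
    finally show ?thesis .
  qed
  define \<pi> where "\<pi> = of_bool (S \<in> indep) / real (card indep)"
  have sumA: "(\<Sum>l\<in>A. g (lo ((!) l) N)) = real (card A) * \<pi>"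
  proof -
    have "2 ^ N * (\<Sum>x\<in>indep. g x) = (\<Sum>x\<in>indep. real (card A) * of_bool (x = S) + (\<Sum>l\<in>B. g (F l x)))"
      by (simp add: sum_distrib_left g)
    also have "\<dots> = real (card A) * of_bool (S \<in> indep) + (\<Sum>x\<in>indep. \<Sum>l\<in>B. g (F l x))"
      using finite_indep by (simp add: sum.distrib sum_distrib_left[symmetric] of_bool_def sum.delta')
    also have "(\<Sum>x\<in>indep. \<Sum>l\<in>B. g (F l x)) = (\<Sum>l\<in>B. \<Sum>x\<in>indep. g (F l x))" by (rule sum.swap)
    finally have 1: "2 ^ N * (\<Sum>x\<in>indep. g x) = real (card A) * of_bool (S \<in> indep) + (\<Sum>l\<in>B. \<Sum>x\<in>indep. g (F l x))" .
    \<comment> \<open>Stationarity holds for all blocks taken together. Comparison with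
      \<open>1\<close> cancels the failing blocks, although neither part is stationary by
      itself.\<close>
    have 2: "2 ^ N * (\<Sum>x\<in>indep. g x) = (\<Sum>l\<in>A. \<Sum>x\<in>indep. g (F l x)) + (\<Sum>l\<in>B. \<Sum>x\<in>indep. g (F l x))"
      unfolding split[symmetric] F_def using sum_chain_indep[OF n, of g] by simp
    \<comment> \<open>A coalescing block forgets its initial state, so the sum over \<open>x\<close>
      becomes a factor.\<close>
    have "(\<Sum>l\<in>A. \<Sum>x\<in>indep. g (F l x)) = real (card indep) * (\<Sum>l\<in>A. g (lo ((!) l) N))"
      by (simp add: Fconst sum_distrib_left cong: sum.cong)
    then have "real (card indep) * (\<Sum>l\<in>A. g (lo ((!) l) N)) = real (card A) * of_bool (S \<in> indep)"
      using 1 2 by linarith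
    then show ?thesis using I by (simp add: \<pi>_def field_simps)
  qed
  define \<delta> where "\<delta> x = h x - \<pi>" for x
  have \<delta>: "2 ^ N * \<delta> x = (\<Sum>l\<in>B. \<delta> (F l x))" if "x \<in> indep" for x
  proof -
    have "2 ^ N * h x = real (card A) * \<pi> + (\<Sum>l\<in>B. h (F l x))"
      using h[of x] sumA Fconst[OF that] by (simp cong: sum.cong)
    moreover have "2 ^ N * \<pi> = real (card A) * \<pi> + real (card B) * \<pi>" using cAB by (metis distrib_right)
    ultimately show ?thesis by (simp add: \<delta>_def sum_subtractf right_diff_distrib)
  qed
  \<comment> \<open>Maximum principle: the largest deviation is bounded by an average of deviations
    over the failing blocks, whose total mass is below 1, and hence is 0.\<close>
  define M where "M = Max ((\<lambda>x. \<bar>\<delta> x\<bar>) ` indep)"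
  have M: "\<bar>\<delta> x\<bar> \<le> M" if "x \<in> indep" for x using that finite_indep by (simp add: M_def)
  have "M \<in> (\<lambda>x. \<bar>\<delta> x\<bar>) ` indep" unfolding M_def using finite_indep x by (intro Max_in) auto
  then obtain z where z: "z \<in> indep" "M = \<bar>\<delta> z\<bar>" by blast
  have "2 ^ N * M = \<bar>2 ^ N * \<delta> z\<bar>" by (simp add: z abs_mult)
  also have "\<dots> \<le> (\<Sum>l\<in>B. \<bar>\<delta> (F l z)\<bar>)" unfolding \<delta>[OF z(1)] by (rule sum_abs)
  also have "\<dots> \<le> (\<Sum>l\<in>B. M)" by (intro sum_mono M Fin z)
  finally have "2 ^ N * M \<le> real (card B) * M" by simp
  then have "real (card A) * M \<le> 0" using cAB by (metis add_le_same_cancel2 distrib_right)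
  then have "M \<le> 0" using cA by (simp add: mult_le_0_iff)
  then have "h x = \<pi>" using M[OF x] by (simp add: \<delta>_def)
  then show ?thesis using old[of 2 x y] by (simp add: h_def \<pi>_def)
qed

text \<open>This is the wait for \<open>c\<close> successes of probability at least
  \<open>1/2\<close>. One block costs 1, a success lowers the remaining bound by 2, and on average
  the two balance.\<close>

lemma nn_integral_blocks_le:
  assumes half: "real (card {l. length l = N \<and> \<not> coalesced ((!) l) N}) \<le> 2 ^ N / 2"
  shows "(\<integral>\<^sup>+w. ennreal (real (blocks N J c w)) \<partial>coin_space) \<le> ennreal (2 * real c)"
proof (induction J arbitrary: c)
  case (Suc J)
  show ?case
  proof (cases "c = 0")
    case False
    have suc: "ennreal (real (Suc b)) = 1 + ennreal (real b)" for b
    proof -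
      have "ennreal (real (Suc b)) = ennreal (1 + real b)" by simp
      also have "\<dots> = 1 + ennreal (real b)" by (subst ennreal_plus) simp_all
      finally show ?thesis .
    qed
    have e1: "emeasure coin_space UNIV = 1" using coin.emeasure_space_1 by simp
    define r where "r l = 1 + 2 * real (c - of_bool (coalesced ((!) l) N))" for l
    have rnn: "0 \<le> r l" for l by (simp add: r_def)
    have "(\<integral>\<^sup>+w. ennreal (real (blocks N (Suc J) c w)) \<partial>coin_space) =
        (\<Sum>l | length l = N. \<integral>\<^sup>+w. ennreal (real (blocks N (Suc J) c (l @- w))) \<partial>coin_space) / 2 ^ N"
      by (rule nn_integral_coin_space[OF measurable_blocks])
    also have "\<dots> \<le> (\<Sum>l | length l = N. ennreal (r l)) / 2 ^ N"
    proof (intro divide_right_mono_ennreal sum_mono)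
      fix l :: "bool list" assume "l \<in> {l. length l = N}"
      then have l: "length l = N" by simp
      let ?c = "c - of_bool (coalesced ((!) l) N)"
      have "(\<integral>\<^sup>+w. ennreal (real (blocks N (Suc J) c (l @- w))) \<partial>coin_space) =
          (\<integral>\<^sup>+w. 1 + ennreal (real (blocks N J ?c w)) \<partial>coin_space)"
        using False l by (intro nn_integral_cong) (simp add: block_shift sdrop_shift suc del: of_nat_Suc)
      also have "\<dots> = 1 + (\<integral>\<^sup>+w. ennreal (real (blocks N J ?c w)) \<partial>coin_space)"
        using e1 by (subst nn_integral_add) (simp_all add: measurable_blocks)
      also have "\<dots> \<le> 1 + ennreal (2 * real ?c)" by (intro add_left_mono Suc.IH)
      also have "\<dots> = ennreal (r l)" by (simp add: r_def)
      finally show "(\<integral>\<^sup>+w. ennreal (real (blocks N (Suc J) c (l @- w))) \<partial>coin_space) \<le> ennreal (r l)" .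
    qed
    also have "\<dots> = ennreal (\<Sum>l | length l = N. r l) / ennreal (2 ^ N)"
      using rnn by (simp add: sum_ennreal ennreal_power[symmetric])
    also have "\<dots> = ennreal ((\<Sum>l | length l = N. r l) / 2 ^ N)"
      by (intro divide_ennreal) (simp_all add: sum_nonneg rnn)
    also have "\<dots> \<le> ennreal (2 * real c)"
    proof (rule ennreal_leI)
      have "r l = (2 * real c - 1) + 2 * of_bool (\<not> coalesced ((!) l) N)" for l
        using False by (auto simp: r_def of_nat_diff)
      then have "(\<Sum>l | length l = N. r l) =
          2 ^ N * (2 * real c - 1) + 2 * (\<Sum>l | length l = N. of_bool (\<not> coalesced ((!) l) N))"
        by (simp add: sum.distrib sum_distrib_left[symmetric] card_bool_lists)
      also have "(\<Sum>l | length l = N. of_bool (\<not> coalesced ((!) l) N)) =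
          real (card {l. length l = N \<and> \<not> coalesced ((!) l) N})"
        using finite_bool_lists[of N] by (simp add: sum_of_bool_eq Collect_conj_eq)
      also have "2 ^ N * (2 * real c - 1) + 2 * real (card {l. length l = N \<and> \<not> coalesced ((!) l) N})
          \<le> 2 ^ N * (2 * real c - 1) + 2 * (2 ^ N / 2)" using half by linarith
      also have "\<dots> = 2 ^ N * (2 * real c)" by (simp add: algebra_simps)
      finally show "(\<Sum>l | length l = N. r l) / 2 ^ N \<le> 2 * real c" by (simp add: field_simps)
    qed
    finally show ?thesis .
  qed simp
qed simp

lemma incseq_blocks: "blocks N J c w \<le> blocks N (Suc J) c w"
proof (induction J arbitrary: c w)
  case (Suc J)
  show ?case
    using Suc.IH blocks.simps(2)[of N "Suc J" c w] blocks.simps(2)[of N J c w] by (metis Suc_le_mono order_refl)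
qed simp

text \<open>Monotone convergence removes the budget \<open>J\<close>.\<close>

lemma nn_integral_SUP_blocks_le:
  assumes half: "real (card {l. length l = N \<and> \<not> coalesced ((!) l) N}) \<le> 2 ^ N / 2"
  shows "(\<integral>\<^sup>+w. (SUP J. ennreal (real (blocks N J c w))) \<partial>coin_space) \<le> ennreal (2 * real c)"
proof -
  have "incseq (\<lambda>J w. ennreal (real (blocks N J c w)))"
    using incseq_blocks by (auto intro!: incseq_SucI ennreal_leI simp: le_fun_def)
  then have "(\<integral>\<^sup>+w. (SUP J. ennreal (real (blocks N J c w))) \<partial>coin_space) =
      (SUP J. \<integral>\<^sup>+w. ennreal (real (blocks N J c w)) \<partial>coin_space)"
    by (intro nn_integral_monotone_convergence_SUP measurable_blocks)
  also have "\<dots> \<le> ennreal (2 * real c)" by (intro SUP_least nn_integral_blocks_le half)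
  finally show ?thesis .
qed

end

section \<open>A calculus for programs\<close>

inductive_cases LitE: "exec (LIT i a) s t s'"
inductive_cases AddE: "exec (ADD i j l) s t s'"
inductive_cases SubE: "exec (SUB i j l) s t s'"
inductive_cases LoadE: "exec (LOAD i j) s t s'"
inductive_cases StoreE: "exec (STORE i j) s t s'"
inductive_cases FlipE: "exec (FLIP i) s t s'"
inductive_cases SeqE: "exec (SEQ c1 c2) s t s'"
inductive_cases WhileE: "exec (WHILENZ i c) s t s'"

text \<open>Total correctness: a halting run exists, and by determinism it is the only one. The
  postcondition also receives the number of steps, so time bounds are proved along with
  correctness.\<close>

definition wp :: "com \<Rightarrow> (nat \<Rightarrow> (nat \<Rightarrow> nat) \<Rightarrow> (nat \<Rightarrow> nat) \<Rightarrow> bool stream \<Rightarrow> bool) \<Rightarrow>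
    (nat \<Rightarrow> nat) \<Rightarrow> (nat \<Rightarrow> nat) \<Rightarrow> bool stream \<Rightarrow> bool" where
  "wp c Q r m w \<longleftrightarrow> (\<exists>t r' m' w'. exec c (r, m, w) t (r', m', w') \<and> Q t r' m' w')"

lemma wp_mono: "wp c Q r m w \<Longrightarrow> (\<And>t r' m' w'. Q t r' m' w' \<Longrightarrow> Q' t r' m' w') \<Longrightarrow> wp c Q' r m w"
  unfolding wp_def by blast

lemma wp_basic [simp]:
  "wp (LIT i a) Q r m w \<longleftrightarrow> Q 1 (r(i := a)) m w"
  "wp (ADD i j l) Q r m w \<longleftrightarrow> Q 1 (r(i := r j + r l)) m w"
  "wp (SUB i j l) Q r m w \<longleftrightarrow> Q 1 (r(i := r j - r l)) m w"
  "wp (LOAD i j) Q r m w \<longleftrightarrow> Q 1 (r(i := m (r j))) m w"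
  "wp (STORE i j) Q r m w \<longleftrightarrow> Q 1 r (m(r i := r j)) w"
  "wp (FLIP i) Q r m w \<longleftrightarrow> Q 1 (r(i := of_bool (shd w))) m (stl w)"
  unfolding wp_def
  by (auto elim!: LitE AddE SubE LoadE StoreE FlipE intro!: exec.intros exI)

lemma wp_SEQ [simp]: "wp (SEQ c1 c2) Q r m w \<longleftrightarrow> wp c1 (\<lambda>t. wp c2 (\<lambda>u. Q (t + u))) r m w"
proof
  assume "wp (SEQ c1 c2) Q r m w"
  then show "wp c1 (\<lambda>t. wp c2 (\<lambda>u. Q (t + u))) r m w"
    unfolding wp_def by (auto elim!: SeqE) (metis prod.collapse)
next
  assume "wp c1 (\<lambda>t. wp c2 (\<lambda>u. Q (t + u))) r m w"
  then show "wp (SEQ c1 c2) Q r m w"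
    unfolding wp_def by (blast intro: exec.Seq)
qed

fun seqs :: "com list \<Rightarrow> com" where
  "seqs [] = LIT 0 0"
| "seqs [c] = c"
| "seqs (c # c' # cs) = SEQ c (seqs (c' # cs))"

primrec writes :: "com \<Rightarrow> nat set" where
  "writes (LIT i a) = {i}"
| "writes (ADD i j l) = {i}"
| "writes (SUB i j l) = {i}"
| "writes (LOAD i j) = {i}"
| "writes (STORE i j) = {}"
| "writes (FLIP i) = {i}"
| "writes (SEQ c1 c2) = writes c1 \<union> writes c2"
| "writes (IFNZ i c1 c2) = writes c1 \<union> writes c2"
| "writes (WHILENZ i c) = writes c"

text \<open>The frame rule, which lets loop invariants mention only the registers that
  change.\<close>

lemma exec_not_writes: "exec c s t s' \<Longrightarrow> i \<notin> writes c \<Longrightarrow> fst s' i = fst s i"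
  by (induction rule: exec.induct) auto

text \<open>Meant for loops whose number \<open>N\<close> of iterations is known; the invariant is
  indexed by the iterations done. Each of them pays \<open>B\<close> for the body and 1 for its
  test, and the last 1 is the failing test.\<close>

lemma wp_while:
  assumes init: "I 0 r m w"
    and step: "\<And>j r' m' w'. j < N \<Longrightarrow> (\<forall>i. i \<notin> writes c \<longrightarrow> r' i = r i) \<Longrightarrow> I j r' m' w' \<Longrightarrow>
      r' x \<noteq> 0 \<and> wp c (\<lambda>t r'' m'' w''. t \<le> B \<and> I (Suc j) r'' m'' w'') r' m' w'"
    and final: "\<And>r' m' w'. I N r' m' w' \<Longrightarrow> r' x = 0"
  shows "wp (WHILENZ x c)
    (\<lambda>t r' m' w'. t \<le> N * (B + 1) + 1 \<and> I N r' m' w' \<and> (\<forall>i. i \<notin> writes c \<longrightarrow> r' i = r i)) r m w"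
proof -
  have "wp (WHILENZ x c)
    (\<lambda>t r'' m'' w''. t \<le> (N - j) * (B + 1) + 1 \<and> I N r'' m'' w'' \<and> (\<forall>i. i \<notin> writes c \<longrightarrow> r'' i = r i)) r' m' w'"
    if "j \<le> N" "I j r' m' w'" "\<forall>i. i \<notin> writes c \<longrightarrow> r' i = r i" for j r' m' w'
    using that
  proof (induction "N - j" arbitrary: j r' m' w')
    case 0
    then have I: "I N r' m' w'" by simp
    have "exec (WHILENZ x c) (r', m', w') 1 (r', m', w')" by (rule exec.WhileZero) (rule final[OF I])
    then show ?case using I 0(4) unfolding wp_def
      by (intro exI[of _ "1 :: nat"] exI[of _ r'] exI[of _ m'] exI[of _ w']) simp
  next
    case (Suc k)
    then have j: "j < N" "N - j = Suc (N - Suc j)" by auto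
    obtain t1 r1 m1 w1 where 1: "exec c (r', m', w') t1 (r1, m1, w1)" "t1 \<le> B" "I (Suc j) r1 m1 w1"
      and x: "r' x \<noteq> 0"
      using step[OF j(1) Suc.prems(3,2)] unfolding wp_def by blast
    have f1: "\<forall>i. i \<notin> writes c \<longrightarrow> r1 i = r i"
      using exec_not_writes[OF 1(1)] Suc.prems(3) by simp
    obtain t2 r2 m2 w2 where 2: "exec (WHILENZ x c) (r1, m1, w1) t2 (r2, m2, w2)"
      "t2 \<le> (N - Suc j) * (B + 1) + 1" "I N r2 m2 w2" "\<forall>i. i \<notin> writes c \<longrightarrow> r2 i = r i"
      using Suc.hyps(1)[of "Suc j", OF _ _ 1(3) f1] j Suc.hyps(2) unfolding wp_def by auto
    have "t1 + t2 + 1 \<le> (N - j) * (B + 1) + 1" using 1(2) 2(2) unfolding j(2) by simp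
    then show ?case
      using exec.WhileNonzero[OF x 1(1) 2(1)] 2(3,4) unfolding wp_def by blast
  qed
  from this[of 0] init show ?thesis by simp
qed

text \<open>Registers: 0 and 31 hold the constants 0 and 1; 2 to 6 hold \<open>n\<close>, the number of edges, \<open>k\<close>, \<open>d\<close> and the
  number of rounds of a block; 7 to 12 hold the base addresses of the arrays of the lower chain, the
  upper chain, the current state, the state before the block, the fill pointers and the incidence
  table; 13 counts the coalescing blocks still awaited. All branching is done by truncated
  subtraction. While vertex \<open>v\<close> is being updated its own entries are set to 1, so an edge
  through \<open>v\<close> blocks iff all of its \<open>k\<close> entries are 1.\<close>

definition entry_body :: com where
  "entry_body = seqs [LOAD 28 21, ADD 29 7 28, LOAD 29 29, ADD 22 22 29, ADD 29 8 28, LOAD 29 29,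
     ADD 23 23 29, ADD 29 9 28, LOAD 29 29, ADD 24 24 29, ADD 21 21 31, SUB 20 20 31]"

definition edge_body :: com where
  "edge_body = seqs [LOAD 21 17, ADD 17 17 31, LIT 22 0, LIT 23 0, LIT 24 0, ADD 20 4 0,
     WHILENZ 20 entry_body, SUB 28 4 22, SUB 28 31 28, ADD 25 25 28, SUB 28 4 23, SUB 28 31 28,
     ADD 26 26 28, SUB 28 4 24, SUB 28 31 28, ADD 27 27 28, SUB 19 19 31]"

text \<open>Registers 25, 26 and 27 count the edges that block with respect to the lower bound, the
  upper bound and the current state. The counters of the two bounds are exchanged when the new
  entries, coin minus counter, are written.\<close>

definition vertex_body :: com where
  "vertex_body = seqs [FLIP 18, ADD 28 7 16, STORE 28 31, ADD 28 8 16, STORE 28 31, ADD 28 9 16,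
     STORE 28 31, LIT 25 0, LIT 26 0, LIT 27 0, ADD 19 5 0, WHILENZ 19 edge_body,
     SUB 29 18 26, ADD 28 7 16, STORE 28 29, SUB 29 18 25, ADD 28 8 16, STORE 28 29,
     SUB 29 18 27, ADD 28 9 16, STORE 28 29, ADD 16 16 31, SUB 15 15 31]"

text \<open>The rows of the incidence table are stored in the order of the scan, so the pointer in
  register 17 runs through them once per round and no row address needs a multiplication.\<close>

definition round_body :: com where
  "round_body = seqs [LIT 16 0, ADD 17 12 0, ADD 15 2 0, WHILENZ 15 vertex_body, SUB 14 14 31]"

definition init_body :: com where
  "init_body = seqs [ADD 28 7 16, STORE 28 0, ADD 28 8 16, STORE 28 31, ADD 28 9 16, LOAD 29 28,
     ADD 28 10 16, STORE 28 29, ADD 16 16 31, SUB 15 15 31]"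

definition test_body :: com where
  "test_body = seqs [ADD 28 8 16, LOAD 28 28, ADD 29 7 16, LOAD 29 29, SUB 28 28 29, ADD 30 30 28,
     ADD 16 16 31, SUB 15 15 31]"

definition block_body :: com where
  "block_body = seqs [LIT 16 0, ADD 15 2 0, WHILENZ 15 init_body, ADD 14 6 0, WHILENZ 14 round_body,
     LIT 16 0, ADD 15 2 0, LIT 30 0, WHILENZ 15 test_body, SUB 28 31 30, SUB 13 13 28]"

lemma writes_bodies:
  "writes entry_body = {20,21,22,23,24,28,29}"
  "writes edge_body = {17,19,20,21,22,23,24,25,26,27,28,29}"
  "writes vertex_body = {15,16,17,18,19,20,21,22,23,24,25,26,27,28,29}"
  "writes round_body = {14,15,16,17,18,19,20,21,22,23,24,25,26,27,28,29}"
  "writes init_body = {15,16,28,29}"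
  "writes test_body = {15,16,28,29,30}"
proof -
  show 1: "writes entry_body = {20,21,22,23,24,28,29}" by (auto simp: entry_body_def)
  show 2: "writes edge_body = {17,19,20,21,22,23,24,25,26,27,28,29}" by (auto simp: edge_body_def 1)
  show 3: "writes vertex_body = {15,16,17,18,19,20,21,22,23,24,25,26,27,28,29}" by (auto simp: vertex_body_def 2)
  show "writes round_body = {14,15,16,17,18,19,20,21,22,23,24,25,26,27,28,29}" by (auto simp: round_body_def 3)
  show "writes init_body = {15,16,28,29}" by (auto simp: init_body_def)
  show "writes test_body = {15,16,28,29,30}" by (auto simp: test_body_def)
qed

text \<open>The machine obtains \<open>d\<close> by dividing \<open>d * n\<close> by
  \<open>n\<close> through repeated subtraction. For \<open>n = 0\<close> that loop stops at once
  with 0, and \<open>no_vertices\<close> fixes \<open>d\<close> accordingly.\<close>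

locale ram_input =
  fixes n k d T :: nat and es :: "nat list list"
  assumes edges: "e \<in> set es \<Longrightarrow> distinct e \<and> length e = k \<and> set e \<subseteq> {..<n}"
    and edge_deg: "v < n \<Longrightarrow> card {c. c < length es \<and> v \<in> set (es ! c)} = d"
    and no_vertices: "n = 0 \<Longrightarrow> d = 0"
begin

sublocale scan_hypergraph n "set ` set es"
  by unfold_locales (use edges in auto)

text \<open>The length of the input word. The work space starts there: five arrays of length
  \<open>n\<close>, then the table at \<open>tb\<close>.\<close>

definition L :: nat where "L = 2 + length es + length es * k"

text \<open>Skips the two header words and the length word in front of each edge.\<close>

definition ea :: "nat \<Rightarrow> nat" where "ea c = 3 + c * (k + 1)"

definition tb :: nat where "tb = L + 5 * n"

definition edge_words :: "(nat \<Rightarrow> nat) \<Rightarrow> bool" where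
  "edge_words m \<longleftrightarrow> (\<forall>c<length es. \<forall>j<k. m (ea c + j) = es ! c ! j)"

text \<open>Blocking does not depend on the order of the edges in a row, so only the set of entries
  is specified.\<close>

definition table :: "(nat \<Rightarrow> nat) \<Rightarrow> bool" where
  "table m \<longleftrightarrow> (\<forall>v<n. (\<lambda>j. m (tb + v * d + j)) ` {..<d} =
     ea ` {c. c < length es \<and> v \<in> set (es ! c)})"

definition bits :: "(nat \<Rightarrow> nat) \<Rightarrow> nat \<Rightarrow> nat set \<Rightarrow> bool" where
  "bits m b Y \<longleftrightarrow> (\<forall>v<n. m (b + v) = of_bool (v \<in> Y))"

definition regs :: "(nat \<Rightarrow> nat) \<Rightarrow> bool" where
  "regs r \<longleftrightarrow> r 0 = 0 \<and> r 31 = 1 \<and> r 2 = n \<and> r 4 = k \<and> r 5 = d \<and> r 6 = T \<and> r 7 = L \<and> r 8 = L + n \<and>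
     r 9 = L + 2 * n \<and> r 10 = L + 3 * n \<and> r 12 = tb"

definition hits :: "nat \<Rightarrow> nat set \<Rightarrow> nat \<Rightarrow> nat" where
  "hits c A j = (\<Sum>i<j. of_bool (es ! c ! i \<in> A))"

text \<open>Truncated subtraction as a test: \<open>k - hits c A k\<close> vanishes exactly if all
  \<open>k\<close> entries are hit.\<close>

lemma hits_full:
  assumes "c < length es"
  shows "Suc 0 - (k - hits c A k) = of_bool (set (es ! c) \<subseteq> A)"
proof -
  have len: "length (es ! c) = k" using edges assms by simp
  have hits: "hits c A k = card {i. i < k \<and> es ! c ! i \<in> A}"
    by (simp add: hits_def sum_of_bool_eq Collect_conj_eq lessThan_def)
  show ?thesis
  proof (cases "set (es ! c) \<subseteq> A")
    case True
    then have "{i. i < k \<and> es ! c ! i \<in> A} = {..<k}" using len by (auto simp: set_conv_nth)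
    then show ?thesis using True hits by simp
  next
    case False
    then obtain i where "i < k" "es ! c ! i \<notin> A" using len by (auto simp: set_conv_nth)
    then have "{i. i < k \<and> es ! c ! i \<in> A} \<subset> {..<k}" by auto
    then have "hits c A k < k" using hits psubset_card_mono[of "{..<k}"] by auto
    then show ?thesis using False by simp
  qed
qed

lemma entry_loop:
  assumes r: "regs r" "r 20 = k" "r 21 = ea c" "r 22 = 0" "r 23 = 0" "r 24 = 0"
    and c: "c < length es" and m: "edge_words m" "bits m L A" "bits m (L + n) B" "bits m (L + 2 * n) C"
  shows "wp (WHILENZ 20 entry_body) (\<lambda>t r' m' w'. t \<le> 13 * k + 1 \<and> m' = m \<and> w' = w \<and>
    r' 22 = hits c A k \<and> r' 23 = hits c B k \<and> r' 24 = hits c C k \<and>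
    (\<forall>i. i \<notin> {20,21,22,23,24,28,29} \<longrightarrow> r' i = r i)) r m w"
proof -
  define I where "I j r' m' w' \<longleftrightarrow> m' = m \<and> w' = w \<and> r' 20 = k - j \<and> r' 21 = ea c + j \<and>
    r' 22 = hits c A j \<and> r' 23 = hits c B j \<and> r' 24 = hits c C j" for j and r' m' :: "nat \<Rightarrow> nat" and w'
  have "wp (WHILENZ 20 entry_body)
    (\<lambda>t r' m' w'. t \<le> k * (12 + 1) + 1 \<and> I k r' m' w' \<and> (\<forall>i. i \<notin> writes entry_body \<longrightarrow> r' i = r i)) r m w"
  proof (rule wp_while)
    show "I 0 r m w" using r by (simp add: I_def hits_def)
  next
    fix j r' m' w'
    assume j: "j < k" and f: "\<forall>i. i \<notin> writes entry_body \<longrightarrow> r' i = r i" and I: "I j r' m' w'"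
    have r': "r' 31 = 1" "r' 7 = L" "r' 8 = L + n" "r' 9 = L + 2 * n"
      using f r(1) by (simp_all add: writes_bodies regs_def)
    have u: "m (ea c + j) = es ! c ! j" using m(1) c j by (simp add: edge_words_def)
    have "es ! c ! j < n" using edges[of "es ! c"] c j by (metis lessThan_iff nth_mem subsetD)
    then have b: "m (L + es ! c ! j) = of_bool (es ! c ! j \<in> A)" "m (L + n + es ! c ! j) = of_bool (es ! c ! j \<in> B)"
      "m (L + 2 * n + es ! c ! j) = of_bool (es ! c ! j \<in> C)" using m by (simp_all add: bits_def)
    have I': "m' = m" "w' = w" "r' 20 = k - j" "r' 21 = ea c + j"
      "r' 22 = hits c A j" "r' 23 = hits c B j" "r' 24 = hits c C j" using I by (simp_all add: I_def)
    have h: "hits c Y (Suc j) = hits c Y j + of_bool (es ! c ! j \<in> Y)" for Y by (simp add: hits_def)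
    show "r' 20 \<noteq> 0 \<and> wp entry_body (\<lambda>t r'' m'' w''. t \<le> 12 \<and> I (Suc j) r'' m'' w'') r' m' w'"
      using j by (simp add: entry_body_def I_def I' r' u b h)
  qed (simp add: I_def)
  then show ?thesis
    by (rule wp_mono) (auto simp: I_def writes_bodies)
qed

lemma edge_loop:
  assumes r: "regs r" "r 19 = d" "r 17 = tb + v * d" "r 25 = 0" "r 26 = 0" "r 27 = 0"
    and v: "v < n" and m: "edge_words m" "table m" "bits m L A" "bits m (L + n) B" "bits m (L + 2 * n) C"
  shows "wp (WHILENZ 19 edge_body) (\<lambda>t r' m' w'. t \<le> d * (13 * k + 19) + 1 \<and> m' = m \<and> w' = w \<and>
    r' 17 = tb + v * d + d \<and>
    (r' 25 = 0 \<longleftrightarrow> \<not> (\<exists>e\<in>set es. v \<in> set e \<and> set e \<subseteq> A)) \<and>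
    (r' 26 = 0 \<longleftrightarrow> \<not> (\<exists>e\<in>set es. v \<in> set e \<and> set e \<subseteq> B)) \<and>
    (r' 27 = 0 \<longleftrightarrow> \<not> (\<exists>e\<in>set es. v \<in> set e \<and> set e \<subseteq> C)) \<and>
    (\<forall>i. i \<notin> {17,19,20,21,22,23,24,25,26,27,28,29} \<longrightarrow> r' i = r i)) r m w"
proof -
  have tab: "(\<lambda>j. m (tb + v * d + j)) ` {..<d} = ea ` {c. c < length es \<and> v \<in> set (es ! c)}"
    using m(2) v by (simp add: table_def)
  have "\<forall>j\<in>{..<d}. \<exists>c. m (tb + v * d + j) = ea c \<and> c < length es \<and> v \<in> set (es ! c)"
    using tab by blast
  then obtain cf where cf: "\<And>j. j < d \<Longrightarrow> m (tb + v * d + j) = ea (cf j) \<and> cf j < length es \<and> v \<in> set (es ! cf j)"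
    by (metis lessThan_iff)
  have surj: "\<exists>j<d. cf j = c" if c: "c < length es" "v \<in> set (es ! c)" for c
  proof -
    have "ea c \<in> (\<lambda>j. m (tb + v * d + j)) ` {..<d}" unfolding tab using c by blast
    then obtain j where "j < d" "ea c = m (tb + v * d + j)" by auto
    then have "c * Suc k = cf j * Suc k" using cf[of j] by (simp add: ea_def)
    then have "c = cf j" using mult_cancel2[of c "Suc k" "cf j"] by simp
    then show ?thesis using \<open>j < d\<close> by blast
  qed
  define F where "F Y j = (\<Sum>i<j. of_bool (set (es ! cf i) \<subseteq> Y) :: nat)" for Y j
  have F0: "F Y d = 0 \<longleftrightarrow> \<not> (\<exists>e\<in>set es. v \<in> set e \<and> set e \<subseteq> Y)" for Y
  proof -
    have "F Y d = 0 \<longleftrightarrow> (\<forall>i<d. \<not> set (es ! cf i) \<subseteq> Y)" by (auto simp: F_def)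
    also have "\<dots> \<longleftrightarrow> \<not> (\<exists>e\<in>set es. v \<in> set e \<and> set e \<subseteq> Y)"
      using cf surj by (metis in_set_conv_nth)
    finally show ?thesis .
  qed
  define I where "I j r' m' w' \<longleftrightarrow> m' = m \<and> w' = w \<and> r' 19 = d - j \<and> r' 17 = tb + v * d + j \<and>
    r' 25 = F A j \<and> r' 26 = F B j \<and> r' 27 = F C j" for j and r' m' :: "nat \<Rightarrow> nat" and w'
  have "wp (WHILENZ 19 edge_body)
    (\<lambda>t r' m' w'. t \<le> d * ((13 * k + 18) + 1) + 1 \<and> I d r' m' w' \<and> (\<forall>i. i \<notin> writes edge_body \<longrightarrow> r' i = r i)) r m w"
  proof (rule wp_while)
    show "I 0 r m w" using r by (simp add: I_def F_def)
  next
    fix j r' m' w'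
    assume j: "j < d" and f: "\<forall>i. i \<notin> writes edge_body \<longrightarrow> r' i = r i" and I: "I j r' m' w'"
    have r': "regs r'" using f r(1) by (simp add: writes_bodies regs_def)
    have r'': "r' 0 = 0" "r' 31 = 1" "r' 4 = k" using r' by (simp_all add: regs_def)
    have I': "m' = m" "w' = w" "r' 19 = d - j" "r' 17 = tb + v * d + j"
      "r' 25 = F A j" "r' 26 = F B j" "r' 27 = F C j" using I by (simp_all add: I_def)
    have Fs: "F Y (Suc j) = F Y j + of_bool (set (es ! cf j) \<subseteq> Y)" for Y by (simp add: F_def)
    show "r' 19 \<noteq> 0 \<and> wp edge_body (\<lambda>t r'' m'' w''. t \<le> 13 * k + 18 \<and> I (Suc j) r'' m'' w'') r' m' w'"
      unfolding edge_body_def using j cf[OF j] r' m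
      apply (simp add: I' r'')
      apply (rule wp_mono, rule entry_loop[where c = "cf j" and A = A and B = B and C = C])
                 apply (simp_all add: regs_def I_def I' Fs hits_full r'')
      done
  qed (simp add: I_def)
  then show ?thesis
    by (rule wp_mono) (simp add: I_def writes_bodies F0 algebra_simps)
qed

end

section \<open>One block\<close>

context ram_input
begin

text \<open>The four arrays between \<open>L\<close> and \<open>L + 4 * n\<close> are all that a
  block may change; the input, the fill pointers and the table survive.\<close>

definition agree :: "(nat \<Rightarrow> nat) \<Rightarrow> (nat \<Rightarrow> nat) \<Rightarrow> bool" where
  "agree m m' \<longleftrightarrow> (\<forall>a. a < L \<or> L + 4 * n \<le> a \<longrightarrow> m' a = m a)"

lemma ea_less: "c < length es \<Longrightarrow> j < k \<Longrightarrow> ea c + j < L"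
proof -
  assume "c < length es" "j < k"
  then have "Suc c * Suc k \<le> length es * Suc k" by (intro mult_right_mono) auto
  then show "ea c + j < L" using \<open>j < k\<close> by (simp add: ea_def L_def)
qed

lemma edge_words_agree: "agree m m' \<Longrightarrow> edge_words m \<Longrightarrow> edge_words m'"
  by (simp add: edge_words_def agree_def ea_less)

lemma table_agree: "agree m m' \<Longrightarrow> table m \<Longrightarrow> table m'"
  by (simp add: table_def agree_def tb_def)

lemma blocked_iff: "blocked Y v \<longleftrightarrow> (\<exists>e\<in>set es. v \<in> set e \<and> set e \<subseteq> insert v Y)"
  unfolding blocked_def by auto

lemma bits_store3:
  fixes p q s :: bool
  assumes "v < n" "bits m L A" "bits m (L + n) B" "bits m (L + 2 * n) C"
  defines "m' \<equiv> m(L + v := of_bool p, L + n + v := of_bool q, L + 2 * n + v := of_bool s)"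
  shows "bits m' L (if p then insert v A else A - {v})"
    "bits m' (L + n) (if q then insert v B else B - {v})"
    "bits m' (L + 2 * n) (if s then insert v C else C - {v})"
    "\<forall>a. a < L \<or> L + 3 * n \<le> a \<longrightarrow> m' a = m a"
  using assms(1-4) by (auto simp: bits_def m'_def)

lemma of_bool_minus: "of_bool b - (x :: nat) = of_bool (b \<and> x = 0)"
  by auto

lemma vertex_step:
  assumes r: "regs r" "r 16 = v" "r 17 = tb + v * d" and v: "v < n"
    and m: "edge_words m" "table m" "bits m L A" "bits m (L + n) B" "bits m (L + 2 * n) C"
  shows "wp vertex_body (\<lambda>t r' m' w'. t \<le> d * (13 * k + 19) + 23 \<and> w' = stl w \<and>
     bits m' L (upd B v (shd w) A) \<and> bits m' (L + n) (upd A v (shd w) B) \<and>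
     bits m' (L + 2 * n) (upd C v (shd w) C) \<and> (\<forall>a. a < L \<or> L + 3 * n \<le> a \<longrightarrow> m' a = m a) \<and>
     r' 15 = r 15 - 1 \<and> r' 16 = Suc v \<and> r' 17 = tb + v * d + d) r m w"
proof -
  define m1 where "m1 = m(L + v := Suc 0, L + n + v := Suc 0, L + 2 * n + v := Suc 0)"
  have b1: "bits m1 L (insert v A)" "bits m1 (L + n) (insert v B)" "bits m1 (L + 2 * n) (insert v C)"
    and a1: "\<forall>a. a < L \<or> L + 3 * n \<le> a \<longrightarrow> m1 a = m a"
    using bits_store3[OF v m(3-5), of True True True] by (simp_all add: m1_def)
  have "agree m m1" using a1 by (auto simp: agree_def)
  then have em: "edge_words m1" "table m1" using m edge_words_agree table_agree by auto
  have r': "r 0 = 0" "r 31 = Suc 0" "r 4 = k" "r 5 = d" "r 7 = L" "r 8 = L + n" "r 9 = L + 2 * n"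
    using r(1) by (simp_all add: regs_def)
  define r1 where "r1 = r(18 := of_bool (shd w), 28 := L + 2 * n + v, 25 := 0, 26 := 0, 27 := 0, 19 := d)"
  have loop: "wp (WHILENZ 19 edge_body) (\<lambda>t r' m' w'. t \<le> d * (13 * k + 19) + 1 \<and> m' = m1 \<and> w' = stl w \<and>
    r' 17 = tb + v * d + d \<and>
    (r' 25 = 0 \<longleftrightarrow> \<not> blocked A v) \<and> (r' 26 = 0 \<longleftrightarrow> \<not> blocked B v) \<and> (r' 27 = 0 \<longleftrightarrow> \<not> blocked C v) \<and>
    (\<forall>i. i \<notin> {17,19,20,21,22,23,24,25,26,27,28,29} \<longrightarrow> r' i = r1 i)) r1 m1 (stl w)"
    unfolding blocked_iff using r v em b1 by (intro edge_loop) (auto simp: r1_def regs_def)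
  have post: "bits m2 L (upd B v (shd w) A)" "bits m2 (L + n) (upd A v (shd w) B)"
      "bits m2 (L + 2 * n) (upd C v (shd w) C)" "\<forall>a. a < L \<or> L + 3 * n \<le> a \<longrightarrow> m2 a = m a"
    if "m2 = m1(L + v := of_bool (shd w \<and> \<not> blocked B v), L + n + v := of_bool (shd w \<and> \<not> blocked A v),
      L + 2 * n + v := of_bool (shd w \<and> \<not> blocked C v))" for m2
  proof -
    \<comment> \<open>The temporary insertion of \<open>v\<close> leaves no trace after the final
      write.\<close>
    have eq: "(if p then insert v (insert v Y) else insert v Y - {v}) = (if p then insert v Y else Y - {v})"
      for p and Y :: "nat set" by auto
    note st = bits_store3[OF v b1, of "shd w \<and> \<not> blocked B v" "shd w \<and> \<not> blocked A v" "shd w \<and> \<not> blocked C v",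
      folded that, unfolded eq, folded upd_def]
    show "bits m2 L (upd B v (shd w) A)" by (rule st(1))
    show "bits m2 (L + n) (upd A v (shd w) B)" by (rule st(2))
    show "bits m2 (L + 2 * n) (upd C v (shd w) C)" by (rule st(3))
    show "\<forall>a. a < L \<or> L + 3 * n \<le> a \<longrightarrow> m2 a = m a" using st(4) a1 by simp
  qed
  show ?thesis
    unfolding vertex_body_def
  proof (simp add: r r' m1_def[symmetric] r1_def[symmetric], rule wp_mono[OF loop], goal_cases)
    case (1 t r2 m2 w2)
    then have fr: "\<And>i. i \<notin> {17,19,20,21,22,23,24,25,26,27,28,29} \<Longrightarrow> r2 i = r1 i" by blast
    have r2: "r2 7 = L" "r2 8 = L + n" "r2 9 = L + 2 * n" "r2 15 = r 15" "r2 16 = v" "r2 31 = Suc 0"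
      "r2 18 = of_bool (shd w)" using fr by (simp_all add: r1_def r r')
    have st: "m2 = m1" "w2 = stl w" "t \<le> d * (13 * k + 19) + 1" "r2 17 = tb + v * d + d"
      "r2 25 = 0 \<longleftrightarrow> \<not> blocked A v" "r2 26 = 0 \<longleftrightarrow> \<not> blocked B v" "r2 27 = 0 \<longleftrightarrow> \<not> blocked C v"
      using 1 by blast+
    show ?case using post[OF refl] st(3) by (simp add: r2 st(1,2,4-7) of_bool_minus)
  qed
qed

text \<open>The coins of the whole block are \<open>f\<close>, while \<open>w\<close> is the stream
  left at the start of round \<open>i\<close>; modulo \<open>n\<close> the time
  \<open>i * n + j\<close> is vertex \<open>j\<close>.\<close>

lemma vertex_loop:
  assumes r: "regs r" "r 16 = 0" "r 17 = tb" "r 15 = n"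
    and m: "edge_words m" "table m" "bits m L (lo f (i * n))" "bits m (L + n) (hi f (i * n))"
      "bits m (L + 2 * n) (chain f (i * n) X)"
    and w: "\<And>j. f (i * n + j) = w !! j"
  shows "wp (WHILENZ 15 vertex_body) (\<lambda>t r' m' w'. t \<le> n * (d * (13 * k + 19) + 24) + 1 \<and> w' = sdrop n w \<and>
     bits m' L (lo f (Suc i * n)) \<and> bits m' (L + n) (hi f (Suc i * n)) \<and>
     bits m' (L + 2 * n) (chain f (Suc i * n) X) \<and> (\<forall>a. a < L \<or> L + 3 * n \<le> a \<longrightarrow> m' a = m a) \<and>
     (\<forall>i. i \<notin> {15,16,17,18,19,20,21,22,23,24,25,26,27,28,29} \<longrightarrow> r' i = r i)) r m w"
proof -
  define I where "I j r' m' w' \<longleftrightarrow> r' 15 = n - j \<and> r' 16 = j \<and> r' 17 = tb + j * d \<and> w' = sdrop j w \<and>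
    bits m' L (lo f (i * n + j)) \<and> bits m' (L + n) (hi f (i * n + j)) \<and>
    bits m' (L + 2 * n) (chain f (i * n + j) X) \<and> (\<forall>a. a < L \<or> L + 3 * n \<le> a \<longrightarrow> m' a = m a)"
    for j and r' m' :: "nat \<Rightarrow> nat" and w'
  have "wp (WHILENZ 15 vertex_body)
    (\<lambda>t r' m' w'. t \<le> n * ((d * (13 * k + 19) + 23) + 1) + 1 \<and> I n r' m' w' \<and> (\<forall>i. i \<notin> writes vertex_body \<longrightarrow> r' i = r i)) r m w"
  proof (rule wp_while)
    show "I 0 r m w" using r m by (simp add: I_def)
  next
    fix j r' m' w'
    assume j: "j < n" and f: "\<forall>i. i \<notin> writes vertex_body \<longrightarrow> r' i = r i" and I: "I j r' m' w'"
    have r': "regs r'" using f r(1) by (simp add: writes_bodies regs_def)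
    have I': "r' 15 = n - j" "r' 16 = j" "r' 17 = tb + j * d" "w' = sdrop j w"
      "bits m' L (lo f (i * n + j))" "bits m' (L + n) (hi f (i * n + j))"
      "bits m' (L + 2 * n) (chain f (i * n + j) X)" "\<forall>a. a < L \<or> L + 3 * n \<le> a \<longrightarrow> m' a = m a"
      using I by (simp_all add: I_def)
    have "agree m m'" using I'(8) by (auto simp: agree_def)
    then have em: "edge_words m'" "table m'" using m edge_words_agree table_agree by auto
    have coin: "shd w' = f (i * n + j)" "stl w' = sdrop (Suc j) w" using w I'(4) by (simp_all add: sdrop_simps)
    show "r' 15 \<noteq> 0 \<and> wp vertex_body (\<lambda>t r'' m'' w''. t \<le> d * (13 * k + 19) + 23 \<and> I (Suc j) r'' m'' w'') r' m' w'"
    proof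
      show "r' 15 \<noteq> 0" using I'(1) j by simp
      show "wp vertex_body (\<lambda>t r'' m'' w''. t \<le> d * (13 * k + 19) + 23 \<and> I (Suc j) r'' m'' w'') r' m' w'"
      proof (rule wp_mono, rule vertex_step[OF r' I'(2,3) j em I'(5-7)], elim conjE, intro conjI)
        fix t :: nat and r'' m'' :: "nat \<Rightarrow> nat" and w''
        assume q: "w'' = stl w'" "bits m'' L (upd (hi f (i * n + j)) j (shd w') (lo f (i * n + j)))"
          "bits m'' (L + n) (upd (lo f (i * n + j)) j (shd w') (hi f (i * n + j)))"
          "bits m'' (L + 2 * n) (upd (chain f (i * n + j) X) j (shd w') (chain f (i * n + j) X))"
          "\<forall>a. a < L \<or> L + 3 * n \<le> a \<longrightarrow> m'' a = m' a" "r'' 15 = r' 15 - 1" "r'' 16 = Suc j" "r'' 17 = tb + j * d + d"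
        show "I (Suc j) r'' m'' w''"
          unfolding I_def using q I'(1,8) j by (simp add: coin)
      qed
    qed
  qed (simp add: I_def)
  then show ?thesis
    by (rule wp_mono) (simp add: I_def writes_bodies add.commute)
qed

lemma round_loop:
  assumes r: "regs r" "r 14 = T"
    and m: "edge_words m" "table m" "bits m L {}" "bits m (L + n) {..<n}" "bits m (L + 2 * n) X"
  shows "wp (WHILENZ 14 round_body) (\<lambda>t r' m' w'. t \<le> T * (n * (d * (13 * k + 19) + 24) + 6) + 1 \<and>
     w' = sdrop (T * n) w \<and>
     bits m' L (lo ((!!) w) (T * n)) \<and> bits m' (L + n) (hi ((!!) w) (T * n)) \<and>
     bits m' (L + 2 * n) (chain ((!!) w) (T * n) X) \<and> (\<forall>a. a < L \<or> L + 3 * n \<le> a \<longrightarrow> m' a = m a) \<and>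
     (\<forall>i. i \<notin> {14,15,16,17,18,19,20,21,22,23,24,25,26,27,28,29} \<longrightarrow> r' i = r i)) r m w"
proof -
  define I where "I j r' m' w' \<longleftrightarrow> r' 14 = T - j \<and> w' = sdrop (j * n) w \<and>
    bits m' L (lo ((!!) w) (j * n)) \<and> bits m' (L + n) (hi ((!!) w) (j * n)) \<and>
    bits m' (L + 2 * n) (chain ((!!) w) (j * n) X) \<and> (\<forall>a. a < L \<or> L + 3 * n \<le> a \<longrightarrow> m' a = m a)"
    for j and r' m' :: "nat \<Rightarrow> nat" and w'
  have "wp (WHILENZ 14 round_body)
    (\<lambda>t r' m' w'. t \<le> T * ((n * (d * (13 * k + 19) + 24) + 5) + 1) + 1 \<and> I T r' m' w' \<and> (\<forall>i. i \<notin> writes round_body \<longrightarrow> r' i = r i)) r m w"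
  proof (rule wp_while)
    show "I 0 r m w" using r m by (simp add: I_def)
  next
    fix j r' m' w'
    assume j: "j < T" and f: "\<forall>i. i \<notin> writes round_body \<longrightarrow> r' i = r i" and I: "I j r' m' w'"
    have r': "regs r'" using f r(1) by (simp add: writes_bodies regs_def)
    have r'': "r' 0 = 0" "r' 31 = Suc 0" "r' 2 = n" "r' 12 = tb" using r' by (simp_all add: regs_def)
    have I': "r' 14 = T - j" "w' = sdrop (j * n) w"
      "bits m' L (lo ((!!) w) (j * n))" "bits m' (L + n) (hi ((!!) w) (j * n))"
      "bits m' (L + 2 * n) (chain ((!!) w) (j * n) X)" "\<forall>a. a < L \<or> L + 3 * n \<le> a \<longrightarrow> m' a = m a"
      using I by (simp_all add: I_def)
    have "agree m m'" using I'(6) by (auto simp: agree_def)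
    then have em: "edge_words m'" "table m'" using m edge_words_agree table_agree by auto
    define r1 where "r1 = r'(16 := 0, 17 := tb, 15 := n)"
    have loop: "wp (WHILENZ 15 vertex_body) (\<lambda>t r' m'' w''. t \<le> n * (d * (13 * k + 19) + 24) + 1 \<and> w'' = sdrop n w' \<and>
     bits m'' L (lo ((!!) w) (Suc j * n)) \<and> bits m'' (L + n) (hi ((!!) w) (Suc j * n)) \<and>
     bits m'' (L + 2 * n) (chain ((!!) w) (Suc j * n) X) \<and> (\<forall>a. a < L \<or> L + 3 * n \<le> a \<longrightarrow> m'' a = m' a) \<and>
     (\<forall>i. i \<notin> {15,16,17,18,19,20,21,22,23,24,25,26,27,28,29} \<longrightarrow> r' i = r1 i)) r1 m' w'"
      by (rule vertex_loop) (use r' em I' in \<open>simp_all add: r1_def regs_def sdrop_snth add.commute\<close>)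
    show "r' 14 \<noteq> 0 \<and> wp round_body (\<lambda>t r'' m'' w''. t \<le> n * (d * (13 * k + 19) + 24) + 5 \<and> I (Suc j) r'' m'' w'') r' m' w'"
    proof
      show "r' 14 \<noteq> 0" using I'(1) j by simp
      show "wp round_body (\<lambda>t r'' m'' w''. t \<le> n * (d * (13 * k + 19) + 24) + 5 \<and> I (Suc j) r'' m'' w'') r' m' w'"
        unfolding round_body_def
        apply (simp add: r'' r1_def[symmetric])
        apply (rule wp_mono[OF loop])
        using I'(6) apply (simp add: I_def r1_def r'' I'(1,2) sdrop_add add.commute)
        done
    qed
  qed (simp add: I_def)
  then show ?thesis
    by (rule wp_mono) (simp add: I_def writes_bodies algebra_simps)
qed

lemma init_loop:
  assumes r: "regs r" "r 15 = n" "r 16 = 0" and m: "bits m (L + 2 * n) X"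
  shows "wp (WHILENZ 15 init_body) (\<lambda>t r' m' w'. t \<le> n * 11 + 1 \<and> w' = w \<and>
     bits m' L {} \<and> bits m' (L + n) {..<n} \<and> bits m' (L + 2 * n) X \<and> bits m' (L + 3 * n) X \<and> agree m m' \<and>
     (\<forall>i. i \<notin> {15,16,28,29} \<longrightarrow> r' i = r i)) r m w"
proof -
  define I where "I j r' m' w' \<longleftrightarrow> r' 15 = n - j \<and> r' 16 = j \<and> w' = w \<and>
    (\<forall>v<j. m' (L + v) = 0 \<and> m' (L + n + v) = 1 \<and> m' (L + 3 * n + v) = of_bool (v \<in> X)) \<and>
    bits m' (L + 2 * n) X \<and> agree m m'"
    for j and r' m' :: "nat \<Rightarrow> nat" and w'
  have "wp (WHILENZ 15 init_body)
    (\<lambda>t r' m' w'. t \<le> n * (10 + 1) + 1 \<and> I n r' m' w' \<and> (\<forall>i. i \<notin> writes init_body \<longrightarrow> r' i = r i)) r m w"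
  proof (rule wp_while)
    show "I 0 r m w" using r m by (simp add: I_def agree_def)
  next
    fix j r' m' w'
    assume j: "j < n" and f: "\<forall>i. i \<notin> writes init_body \<longrightarrow> r' i = r i" and I: "I j r' m' w'"
    have r': "r' 0 = 0" "r' 31 = Suc 0" "r' 7 = L" "r' 8 = L + n" "r' 9 = L + 2 * n" "r' 10 = L + 3 * n"
      using f r(1) by (simp_all add: writes_bodies regs_def)
    have I': "r' 15 = n - j" "r' 16 = j" "w' = w"
      "\<And>v. v < j \<Longrightarrow> m' (L + v) = 0 \<and> m' (L + n + v) = 1 \<and> m' (L + 3 * n + v) = of_bool (v \<in> X)"
      "bits m' (L + 2 * n) X" "agree m m'"
      using I by (simp_all add: I_def)
    have Xj: "m' (L + 2 * n + j) = of_bool (j \<in> X)" using I'(5) j by (simp add: bits_def)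
    define m2 where "m2 = m'(L + j := 0, L + n + j := Suc 0, L + 3 * n + j := of_bool (j \<in> X))"
    have 1: "m2 (L + v) = 0 \<and> m2 (L + n + v) = Suc 0 \<and> m2 (L + 3 * n + v) = of_bool (v \<in> X)" if "v < Suc j" for v
      using that j I'(4)[of v] by (auto simp: m2_def less_Suc_eq)
    have 2: "bits m2 (L + 2 * n) X" using I'(5) j by (simp add: bits_def m2_def)
    have 3: "agree m m2" using I'(6) j by (simp add: agree_def m2_def)
    show "r' 15 \<noteq> 0 \<and> wp init_body (\<lambda>t r'' m'' w''. t \<le> 10 \<and> I (Suc j) r'' m'' w'') r' m' w'"
      using j 1 2 3 by (simp add: init_body_def I_def I'(1,2,3) r' Xj m2_def[symmetric])
  qed (simp add: I_def)
  then show ?thesis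
    by (rule wp_mono) (simp add: I_def writes_bodies bits_def)
qed

lemma test_loop:
  assumes r: "regs r" "r 15 = n" "r 16 = 0" "r 30 = 0" and m: "bits m L A" "bits m (L + n) B"
    and AB: "A \<subseteq> B" "B \<subseteq> {..<n}"
  shows "wp (WHILENZ 15 test_body) (\<lambda>t r' m' w'. t \<le> n * 9 + 1 \<and> w' = w \<and> m' = m \<and>
     (r' 30 = 0 \<longleftrightarrow> A = B) \<and> (\<forall>i. i \<notin> {15,16,28,29,30} \<longrightarrow> r' i = r i)) r m w"
proof -
  define g where "g j = (\<Sum>v<j. of_bool (v \<in> B) - of_bool (v \<in> A) :: nat)" for j
  have g: "g n = 0 \<longleftrightarrow> A = B"
  proof -
    have "g n = 0 \<longleftrightarrow> (\<forall>v<n. v \<in> B \<longrightarrow> v \<in> A)" by (auto simp: g_def)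
    then show ?thesis using AB by blast
  qed
  define I where "I j r' m' w' \<longleftrightarrow> r' 15 = n - j \<and> r' 16 = j \<and> w' = w \<and> m' = m \<and> r' 30 = g j"
    for j and r' m' :: "nat \<Rightarrow> nat" and w'
  have "wp (WHILENZ 15 test_body)
    (\<lambda>t r' m' w'. t \<le> n * (8 + 1) + 1 \<and> I n r' m' w' \<and> (\<forall>i. i \<notin> writes test_body \<longrightarrow> r' i = r i)) r m w"
  proof (rule wp_while)
    show "I 0 r m w" using r m by (simp add: I_def g_def)
  next
    fix j r' m' w'
    assume j: "j < n" and f: "\<forall>i. i \<notin> writes test_body \<longrightarrow> r' i = r i" and I: "I j r' m' w'"
    have r': "r' 31 = Suc 0" "r' 7 = L" "r' 8 = L + n"
      using f r(1) by (simp_all add: writes_bodies regs_def)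
    have I': "r' 15 = n - j" "r' 16 = j" "w' = w" "m' = m" "r' 30 = g j"
      using I by (simp_all add: I_def)
    have b: "m (L + j) = of_bool (j \<in> A)" "m (L + n + j) = of_bool (j \<in> B)" using m j by (simp_all add: bits_def)
    have gS: "g (Suc j) = g j + (of_bool (j \<in> B) - of_bool (j \<in> A))" by (simp add: g_def)
    show "r' 15 \<noteq> 0 \<and> wp test_body (\<lambda>t r'' m'' w''. t \<le> 8 \<and> I (Suc j) r'' m'' w'') r' m' w'"
      using j by (simp add: test_body_def I_def I' r' b gS)
  qed (simp add: I_def)
  then show ?thesis
    by (rule wp_mono) (simp add: I_def writes_bodies g)
qed

definition block_time :: nat where
  "block_time = T * (n * (d * (13 * k + 19) + 24) + 6) + 20 * n + 11"

lemma block_step: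
  assumes r: "regs r" and n: "0 < n \<or> T * n = 0"
    and m: "edge_words m" "table m" "bits m (L + 2 * n) X"
  shows "wp block_body (\<lambda>t r' m' w'. t \<le> block_time \<and> w' = sdrop (T * n) w \<and> regs r' \<and>
     edge_words m' \<and> table m' \<and> bits m' (L + 2 * n) (chain ((!!) w) (T * n) X) \<and> bits m' (L + 3 * n) X \<and>
     r' 13 = r 13 - of_bool (coalesced ((!!) w) (T * n))) r m w"
proof -
  define b :: nat where "b = of_bool (coalesced ((!!) w) (T * n))"
  have b: "Suc 0 - x = b" if "x = 0 \<longleftrightarrow> lo ((!!) w) (T * n) = hi ((!!) w) (T * n)" for x
    using that by (auto simp: b_def coalesced_def)
  have r': "r 0 = 0" "r 31 = Suc 0" "r 2 = n" "r 6 = T" using r by (simp_all add: regs_def)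
  have sub: "hi ((!!) w) (T * n) \<subseteq> {..<n}"
    using n hi_subset[of "(!!) w" "T * n"] by (metis bnd.simps(1) order_refl snd_conv)
  define r1 where "r1 = r(16 := 0, 15 := n)"
  have l1: "wp (WHILENZ 15 init_body) (\<lambda>t r' m' w'. t \<le> n * 11 + 1 \<and> w' = w \<and>
     bits m' L {} \<and> bits m' (L + n) {..<n} \<and> bits m' (L + 2 * n) X \<and> bits m' (L + 3 * n) X \<and> agree m m' \<and>
     (\<forall>i. i \<notin> {15,16,28,29} \<longrightarrow> r' i = r1 i)) r1 m w"
    by (rule init_loop) (use r m in \<open>simp_all add: r1_def regs_def\<close>)
  show ?thesis
    unfolding block_body_def b_def[symmetric]
  proof (simp add: r' r1_def[symmetric], rule wp_mono[OF l1], goal_cases)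
    case (1 t2 r2 m2 w2)
    then have m2: "bits m2 L {}" "bits m2 (L + n) {..<n}" "bits m2 (L + 2 * n) X" "bits m2 (L + 3 * n) X"
      "agree m m2" and st2: "t2 \<le> n * 11 + 1" "w2 = w" and fr: "\<And>i. i \<notin> {15,16,28,29} \<Longrightarrow> r2 i = r1 i" by blast+
    have em: "edge_words m2" "table m2" using m m2(5) edge_words_agree table_agree by auto
    have r2: "regs r2" "r2 13 = r 13" using fr r by (simp_all add: r1_def regs_def)
    then have r2': "r2 0 = 0" "r2 6 = T" by (simp_all add: regs_def)
    have l2: "wp (WHILENZ 14 round_body) (\<lambda>t r' m' w'. t \<le> T * (n * (d * (13 * k + 19) + 24) + 6) + 1 \<and>
       w' = sdrop (T * n) w \<and>
       bits m' L (lo ((!!) w) (T * n)) \<and> bits m' (L + n) (hi ((!!) w) (T * n)) \<and>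
       bits m' (L + 2 * n) (chain ((!!) w) (T * n) X) \<and> (\<forall>a. a < L \<or> L + 3 * n \<le> a \<longrightarrow> m' a = m2 a) \<and>
       (\<forall>i. i \<notin> {14,15,16,17,18,19,20,21,22,23,24,25,26,27,28,29} \<longrightarrow> r' i = (r2(14 := T)) i)) (r2(14 := T)) m2 w"
      by (rule round_loop) (use r2 m2 em in \<open>simp_all add: regs_def\<close>)
    show ?case
    proof (simp add: r2' st2(2), rule wp_mono[OF l2], goal_cases)
      case (1 t3 r3 m3 w3)
      then have m3: "bits m3 L (lo ((!!) w) (T * n))" "bits m3 (L + n) (hi ((!!) w) (T * n))"
        "bits m3 (L + 2 * n) (chain ((!!) w) (T * n) X)" and ag: "\<forall>a. a < L \<or> L + 3 * n \<le> a \<longrightarrow> m3 a = m2 a"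
        and st3: "t3 \<le> T * (n * (d * (13 * k + 19) + 24) + 6) + 1" "w3 = sdrop (T * n) w"
        and fr3: "\<And>i. i \<notin> {14,15,16,17,18,19,20,21,22,23,24,25,26,27,28,29} \<Longrightarrow> r3 i = (r2(14 := T)) i" by blast+
      have "agree m2 m3" using ag by (simp add: agree_def)
      then have em3: "edge_words m3" "table m3" using em edge_words_agree table_agree by auto
      have old: "bits m3 (L + 3 * n) X" using ag m2(4) by (simp add: bits_def)
      have r3: "regs r3" "r3 13 = r 13" using fr3 r2 by (simp_all add: regs_def)
      then have r3': "r3 0 = 0" "r3 2 = n" by (simp_all add: regs_def)
      have l3: "wp (WHILENZ 15 test_body) (\<lambda>t r' m' w'. t \<le> n * 9 + 1 \<and> w' = w3 \<and> m' = m3 \<and>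
         (r' 30 = 0 \<longleftrightarrow> lo ((!!) w) (T * n) = hi ((!!) w) (T * n)) \<and>
         (\<forall>i. i \<notin> {15,16,28,29,30} \<longrightarrow> r' i = (r3(16 := 0, 15 := n, 30 := 0)) i)) (r3(16 := 0, 15 := n, 30 := 0)) m3 w3"
        by (rule test_loop) (use r3 m3 sub in \<open>simp_all add: regs_def lo_subset_hi\<close>)
      show ?case
      proof (simp add: r3', rule wp_mono[OF l3], goal_cases)
        case (1 t4 r4 m4 w4)
        then have st4: "t4 \<le> n * 9 + 1" "w4 = w3" "m4 = m3" "r4 30 = 0 \<longleftrightarrow> lo ((!!) w) (T * n) = hi ((!!) w) (T * n)"
          and fr4: "\<And>i. i \<notin> {15,16,28,29,30} \<Longrightarrow> r4 i = (r3(16 := 0, 15 := n, 30 := 0)) i" by blast+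
        have r4: "regs r4" "r4 13 = r 13" using fr4 r3 by (simp_all add: regs_def)
        then have r4': "r4 31 = Suc 0" by (simp add: regs_def)
        have "regs (r4(28 := x, 13 := y))" for x y using r4(1) by (simp add: regs_def)
        then show ?case using st2(1) st3(1) st4(1)
          by (simp add: r4' r4 st4(2,3) st3(2) em3 m3 old b[OF st4(4)] block_time_def)
      qed
    qed
  qed
qed

end

section \<open>Preprocessing and output\<close>

text \<open>Register 4 gets the length word of the first edge; without edges that cell lies beyond
  the input and holds 0. The number of edges times \<open>k\<close> is summed up in register 29 and
  then divided by \<open>n\<close> to give the degree.\<close>

definition pre_sizes :: com where
  "pre_sizes = seqs [LIT 31 1, LOAD 2 0, LOAD 3 31, LIT 28 2, LOAD 4 28, ADD 19 3 0,
     WHILENZ 19 (SEQ (ADD 29 29 4) (SUB 19 19 31)),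
     ADD 7 28 3, ADD 7 7 29, ADD 8 7 2, ADD 9 8 2, ADD 10 9 2, ADD 11 10 2, ADD 12 11 2,
     WHILENZ 29 (SEQ (SUB 29 29 2) (ADD 5 5 31))]"

definition pre_fill :: com where
  "pre_fill = seqs [ADD 21 11 0, ADD 20 12 0, ADD 15 2 0,
     WHILENZ 15 (seqs [STORE 21 20, ADD 21 21 31, ADD 20 20 5, SUB 15 15 31])]"

text \<open>As in a bucket sort, the address of the edge goes to the slot named by the fill pointer
  of the vertex, which then advances.\<close>

definition tab_entry :: com where
  "tab_entry = seqs [LOAD 28 21, ADD 28 11 28, LOAD 29 28, STORE 29 22, ADD 29 29 31, STORE 28 29,
     ADD 21 21 31, SUB 20 20 31]"

definition tab_edge :: com where
  "tab_edge = seqs [ADD 21 21 31, ADD 22 21 0, ADD 20 4 0, WHILENZ 20 tab_entry, SUB 19 19 31]"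

definition pre_table :: com where
  "pre_table = seqs [LIT 21 2, ADD 19 3 0, WHILENZ 19 tab_edge]"

text \<open>Doubling 1 until it reaches \<open>n\<close> replaces a logarithm; each doubling adds 14
  rounds. The final 2 is the number of coalescing blocks awaited.\<close>

definition pre_rounds :: com where
  "pre_rounds = seqs [LIT 28 1, LIT 6 2, LIT 30 14, SUB 29 2 28,
     WHILENZ 29 (seqs [ADD 28 28 28, ADD 6 6 30, SUB 29 2 28]), LIT 13 2]"

definition output_com :: com where
  "output_com = seqs [LIT 16 0, ADD 15 2 0,
     WHILENZ 15 (seqs [ADD 28 10 16, LOAD 29 28, STORE 16 29, ADD 16 16 31, SUB 15 15 31])]"

definition prelude :: com where
  "prelude = seqs [pre_sizes, pre_fill, pre_table, pre_rounds]"

definition sampler :: com where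
  "sampler = seqs [prelude, WHILENZ 13 block_body, output_com]"

context ram_input
begin

text \<open>Double counting of incidences; it makes the division by \<open>n\<close> in
  \<open>pre_sizes\<close> exact with quotient \<open>d\<close>.\<close>

lemma handshake: "length es * k = d * n"
proof -
  have fin: "finite (set (es ! c))" for c by simp
  have "length es * k = (\<Sum>c<length es. card (set (es ! c)))"
  proof -
    have "card (set (es ! c)) = k" if "c < length es" for c
      using edges[of "es ! c"] that by (simp add: distinct_card)
    then show ?thesis by simp
  qed
  also have "\<dots> = (\<Sum>c<length es. \<Sum>v<n. of_bool (v \<in> set (es ! c)))"
  proof (rule sum.cong[OF refl])
    fix c assume "c \<in> {..<length es}"
    then have "set (es ! c) \<subseteq> {..<n}" using edges[of "es ! c"] by simp
    then have "{..<n} \<inter> {v. v \<in> set (es ! c)} = set (es ! c)" by blast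
    then show "card (set (es ! c)) = (\<Sum>v<n. of_bool (v \<in> set (es ! c)))" by (simp add: sum_of_bool_eq)
  qed
  also have "\<dots> = (\<Sum>v<n. \<Sum>c<length es. of_bool (v \<in> set (es ! c)))" by (rule sum.swap)
  also have "\<dots> = (\<Sum>v<n. d)"
  proof (rule sum.cong[OF refl])
    fix v assume "v \<in> {..<n}"
    moreover have "{..<length es} \<inter> {c. v \<in> set (es ! c)} = {c. c < length es \<and> v \<in> set (es ! c)}" by blast
    ultimately show "(\<Sum>c<length es. of_bool (v \<in> set (es ! c))) = d" using edge_deg[of v] by (simp add: sum_of_bool_eq)
  qed
  finally show ?thesis by simp
qed

lemma pre_sizes_ok:
  assumes m: "m 0 = n" "m 1 = length es" "m 2 = k"
  shows "wp pre_sizes (\<lambda>t r m' w'. t \<le> 3 * length es + 3 * d + 15 \<and> m' = m \<and> w' = w \<and>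
    r 0 = 0 \<and> r 31 = 1 \<and> r 2 = n \<and> r 3 = length es \<and> r 4 = k \<and> r 5 = d \<and> r 7 = L \<and> r 8 = L + n \<and>
     r 9 = L + 2 * n \<and> r 10 = L + 3 * n \<and> r 11 = L + 4 * n \<and> r 12 = tb) (\<lambda>_. 0) m w"
proof -
  have m1: "m (Suc 0) = length es" using m by simp
  define r1 :: "nat \<Rightarrow> nat" where "r1 = (\<lambda>_. 0)(31 := Suc 0, 2 := n, 3 := length es, 28 := 2, 4 := k, 19 := length es)"
  define I where "I j r' m' w' \<longleftrightarrow> r' 19 = length es - j \<and> r' 29 = j * k \<and> m' = m \<and> w' = w"
    for j and r' m' :: "nat \<Rightarrow> nat" and w'
  have l1: "wp (WHILENZ 19 (SEQ (ADD 29 29 4) (SUB 19 19 31)))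
    (\<lambda>t r' m' w'. t \<le> length es * (2 + 1) + 1 \<and> I (length es) r' m' w' \<and>
      (\<forall>i. i \<notin> writes (SEQ (ADD 29 29 4) (SUB 19 19 31)) \<longrightarrow> r' i = r1 i)) r1 m w"
    by (rule wp_while) (auto simp: I_def r1_def)
  show ?thesis
    unfolding pre_sizes_def
  proof (simp add: m m1 r1_def[symmetric], rule wp_mono[OF l1], goal_cases)
    case (1 t2 r2 m2 w2)
    then have st2: "t2 \<le> 3 * length es + 1" "r2 29 = d * n" "m2 = m" "w2 = w"
      and fr: "\<And>i. i \<notin> {19, 29} \<Longrightarrow> r2 i = r1 i" by (auto simp: I_def handshake)
    have r2: "r2 0 = 0" "r2 5 = 0" "r2 31 = Suc 0" "r2 2 = n" "r2 3 = length es" "r2 4 = k" "r2 28 = 2" using fr by (simp_all add: r1_def)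
    have L': "Suc (Suc (length es + d * n)) = L" "2 + length es + d * n = L" by (simp_all add: L_def handshake)
    define r3 where "r3 = r2(7 := L, 8 := L + n, 9 := L + n + n, 10 := L + n + n + n, 11 := L + n + n + n + n,
      12 := L + n + n + n + n + n)"
    define I2 where "I2 j r' m' w' \<longleftrightarrow> r' 29 = (d - j) * n \<and> r' 5 = j \<and> m' = m \<and> w' = w"
      for j and r' m' :: "nat \<Rightarrow> nat" and w'
    have l2: "wp (WHILENZ 29 (SEQ (SUB 29 29 2) (ADD 5 5 31)))
      (\<lambda>t r' m' w'. t \<le> d * (2 + 1) + 1 \<and> I2 d r' m' w' \<and>
        (\<forall>i. i \<notin> writes (SEQ (SUB 29 29 2) (ADD 5 5 31)) \<longrightarrow> r' i = r3 i)) r3 m w"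
    proof (rule wp_while)
      show "I2 0 r3 m w" by (simp add: I2_def r3_def st2 r2)
    next
      fix j r' m' w'
      assume j: "j < d" and f: "\<forall>i. i \<notin> writes (SEQ (SUB 29 29 2) (ADD 5 5 31)) \<longrightarrow> r' i = r3 i" and I: "I2 j r' m' w'"
      have "n \<noteq> 0" using no_vertices j by auto
      then show "r' 29 \<noteq> 0 \<and> wp (SEQ (SUB 29 29 2) (ADD 5 5 31)) (\<lambda>t r'' m'' w''. t \<le> 2 \<and> I2 (Suc j) r'' m'' w'') r' m' w'"
        using j f I by (auto simp: I2_def r3_def r2 diff_mult_distrib)
    qed (simp add: I2_def)
    show ?case
      apply (simp add: r2 st2 L' r3_def[symmetric])
      apply (rule wp_mono[OF l2])
      using st2(1) apply (simp add: I2_def r3_def r2 tb_def)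
      done
  qed
qed

lemma pre_fill_ok:
  assumes r: "r 0 = 0" "r 31 = 1" "r 2 = n" "r 5 = d" "r 11 = L + 4 * n" "r 12 = tb"
  shows "wp pre_fill (\<lambda>t r' m' w'. t \<le> 5 * n + 4 \<and> w' = w \<and>
    (\<forall>v<n. m' (L + 4 * n + v) = tb + v * d) \<and> (\<forall>a<L + 4 * n. m' a = m a) \<and>
    (\<forall>i. i \<notin> {15,20,21} \<longrightarrow> r' i = r i)) r m w"
proof -
  let ?c = "seqs [STORE 21 20, ADD 21 21 31, ADD 20 20 5, SUB 15 15 31]"
  define r1 where "r1 = r(21 := L + 4 * n, 20 := tb, 15 := n)"
  define I where "I j r' m' w' \<longleftrightarrow> r' 15 = n - j \<and> r' 21 = L + 4 * n + j \<and> r' 20 = tb + j * d \<and> w' = w \<and>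
    (\<forall>v<j. m' (L + 4 * n + v) = tb + v * d) \<and> (\<forall>a<L + 4 * n. m' a = m a)"
    for j and r' m' :: "nat \<Rightarrow> nat" and w'
  have l1: "wp (WHILENZ 15 ?c)
    (\<lambda>t r' m' w'. t \<le> n * (4 + 1) + 1 \<and> I n r' m' w' \<and> (\<forall>i. i \<notin> writes ?c \<longrightarrow> r' i = r1 i)) r1 m w"
  proof (rule wp_while)
    show "I 0 r1 m w" by (simp add: I_def r1_def)
  next
    fix j r' m' w'
    assume j: "j < n" and f: "\<forall>i. i \<notin> writes ?c \<longrightarrow> r' i = r1 i" and I: "I j r' m' w'"
    have r': "r' 31 = Suc 0" "r' 5 = d" using f r by (simp_all add: r1_def)
    show "r' 15 \<noteq> 0 \<and> wp ?c (\<lambda>t r'' m'' w''. t \<le> 4 \<and> I (Suc j) r'' m'' w'') r' m' w'"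
      using j I by (simp add: I_def r' less_Suc_eq)
  qed (simp add: I_def)
  show ?thesis
    unfolding pre_fill_def
    apply (simp add: r r1_def[symmetric])
    apply (rule wp_mono[OF l1[unfolded seqs.simps]])
    apply (simp add: I_def r1_def)
    done
qed

text \<open>The edges met so far at \<open>v\<close> when the scan is at position \<open>j\<close> of edge \<open>c\<close>.\<close>

definition seen :: "nat \<Rightarrow> nat \<Rightarrow> nat \<Rightarrow> nat set" where
  "seen c j v = {c'. c' < c \<and> v \<in> set (es ! c')} \<union> (if v \<in> set (take j (es ! c)) then {c} else {})"

definition tab_inv :: "(nat \<Rightarrow> nat) \<Rightarrow> nat \<Rightarrow> nat \<Rightarrow> (nat \<Rightarrow> nat) \<Rightarrow> bool" where
  "tab_inv m0 c j m \<longleftrightarrow> (\<forall>a<L + 4 * n. m a = m0 a) \<and>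
     (\<forall>v<n. m (L + 4 * n + v) = tb + v * d + card (seen c j v) \<and>
        (\<lambda>i. m (tb + v * d + i)) ` {..<card (seen c j v)} = ea ` seen c j v)"

lemma finite_seen: "finite (seen c j v)"
  by (simp add: seen_def)

lemma seen_next: "c < length es \<Longrightarrow> seen c k v = seen (Suc c) 0 v"
  using edges[of "es ! c"] by (auto simp: seen_def less_Suc_eq)

lemma card_seen_le: "v < n \<Longrightarrow> c < length es \<Longrightarrow> card (seen c j v) \<le> d"
proof -
  assume v: "v < n" "c < length es"
  have "seen c j v \<subseteq> {c. c < length es \<and> v \<in> set (es ! c)}"
    using v set_take_subset[of j "es ! c"] by (auto simp: seen_def split: if_splits)
  then have "card (seen c j v) \<le> card {c. c < length es \<and> v \<in> set (es ! c)}" by (intro card_mono) auto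
  then show ?thesis using edge_deg[OF v(1)] by simp
qed

text \<open>Uniqueness of digits in base \<open>d\<close>: the rows of distinct vertices are
  disjoint, so filling one leaves the others intact.\<close>

lemma slot_neq:
  fixes u v i j :: nat
  assumes "u \<noteq> v" "i < d" "j < d"
  shows "u * d + i \<noteq> v * d + j"
proof
  assume "u * d + i = v * d + j"
  then have "(u * d + i) div d = (v * d + j) div d" by simp
  then show False using assms by simp
qed

lemma tab_inv_step:
  assumes T: "tab_inv m0 c j m" and c: "c < length es" and j: "j < k"
  defines "u \<equiv> es ! c ! j"
  defines "q \<equiv> m (L + 4 * n + u)"
  shows "u < n" "tab_inv m0 c (Suc j) (m(q := ea c, L + 4 * n + u := Suc q))"
proof -
  have e: "distinct (es ! c)" "length (es ! c) = k" "set (es ! c) \<subseteq> {..<n}" using edges[of "es ! c"] c by auto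
  show u: "u < n" using e j by (metis lessThan_iff nth_mem subsetD u_def)
  have q: "q = tb + u * d + card (seen c j u)" using T u by (simp add: tab_inv_def q_def)
  \<comment> \<open>The entries of an edge are distinct, so \<open>seen\<close> at \<open>u\<close>
    grows by exactly one element.\<close>
  have nu: "u \<notin> set (take j (es ! c))"
    using e j by (auto simp: u_def in_set_conv_nth nth_eq_iff_index_eq)
  have tk: "set (take (Suc j) (es ! c)) = insert u (set (take j (es ! c)))"
    using e j by (simp add: take_Suc_conv_app_nth u_def)
  have seen_u: "seen c (Suc j) u = insert c (seen c j u)" "c \<notin> seen c j u"
    using nu by (auto simp: seen_def tk)
  have card_u: "card (seen c (Suc j) u) = Suc (card (seen c j u))" using seen_u finite_seen by simp
  \<comment> \<open>The row still has a free slot: the degree also bounds the count that includes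
    the new edge.\<close>
  then have lt: "card (seen c j u) < d" using card_seen_le[OF u c, of "Suc j"] by simp
  have seen_v: "seen c (Suc j) v = seen c j v" if "v \<noteq> u" for v using that by (auto simp: seen_def tk)
  let ?m = "m(q := ea c, L + 4 * n + u := Suc q)"
  have tb: "tb = L + 5 * n" by (simp add: tb_def)
  have 1: "?m a = m0 a" if "a < L + 4 * n" for a using T that q tb by (simp add: tab_inv_def)
  have 2: "?m (L + 4 * n + v) = tb + v * d + card (seen c (Suc j) v) \<and>
      (\<lambda>i. ?m (tb + v * d + i)) ` {..<card (seen c (Suc j) v)} = ea ` seen c (Suc j) v" if v: "v < n" for v
  proof (cases "v = u")
    case True
    have "(\<lambda>i. ?m (tb + u * d + i)) ` {..<card (seen c j u)} = (\<lambda>i. m (tb + u * d + i)) ` {..<card (seen c j u)}"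
      using q tb u by (intro image_cong) auto
    also have "\<dots> = ea ` seen c j u" using T u by (simp add: tab_inv_def)
    finally have img: "(\<lambda>i. ?m (tb + u * d + i)) ` {..<card (seen c j u)} = ea ` seen c j u" .
    have "?m (tb + u * d + card (seen c j u)) = ea c" using q tb u by simp
    then have "(\<lambda>i. ?m (tb + u * d + i)) ` {..<Suc (card (seen c j u))} = insert (ea c) (ea ` seen c j u)"
      unfolding lessThan_Suc image_insert img by simp
    then show ?thesis unfolding True seen_u(1)[symmetric] card_u using q by (simp add: seen_u(1))
  next
    case False
    have "?m (tb + v * d + i) = m (tb + v * d + i)" if "i < card (seen c j v)" for i
    proof -
      have "i < d" using that card_seen_le[OF v c, of j] by simp
      then have "v * d + i \<noteq> u * d + card (seen c j u)" using slot_neq[OF False _ lt] by blast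
      then show ?thesis using q tb u by simp
    qed
    then have "(\<lambda>i. ?m (tb + v * d + i)) ` {..<card (seen c j v)} = (\<lambda>i. m (tb + v * d + i)) ` {..<card (seen c j v)}"
      by (intro image_cong refl) blast
    also have "\<dots> = ea ` seen c j v" using T v by (simp add: tab_inv_def)
    finally have "(\<lambda>i. ?m (tb + v * d + i)) ` {..<card (seen c j v)} = ea ` seen c j v" .
    moreover have "?m (L + 4 * n + v) = tb + v * d + card (seen c j v)"
      using T v False q tb by (simp add: tab_inv_def)
    ultimately show ?thesis using seen_v[OF False] by simp
  qed
  show "tab_inv m0 c (Suc j) ?m" unfolding tab_inv_def using 1 2 by blast
qed

lemma tab_entry_loop:
  assumes r: "r 31 = 1" "r 11 = L + 4 * n" "r 20 = k" "r 21 = ea c" "r 22 = ea c"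
    and c: "c < length es" and m: "tab_inv m0 c 0 m" and e: "edge_words m0"
  shows "wp (WHILENZ 20 tab_entry) (\<lambda>t r' m' w'. t \<le> 9 * k + 1 \<and> w' = w \<and> tab_inv m0 c k m' \<and>
    r' 21 = ea c + k \<and> (\<forall>i. i \<notin> {20,21,28,29} \<longrightarrow> r' i = r i)) r m w"
proof -
  define I where "I j r' m' w' \<longleftrightarrow> r' 20 = k - j \<and> r' 21 = ea c + j \<and> w' = w \<and> tab_inv m0 c j m'"
    for j and r' m' :: "nat \<Rightarrow> nat" and w'
  have wr: "writes tab_entry = {20,21,28,29}" by (auto simp: tab_entry_def)
  have "wp (WHILENZ 20 tab_entry)
    (\<lambda>t r' m' w'. t \<le> k * (8 + 1) + 1 \<and> I k r' m' w' \<and> (\<forall>i. i \<notin> writes tab_entry \<longrightarrow> r' i = r i)) r m w"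
  proof (rule wp_while)
    show "I 0 r m w" using r m by (simp add: I_def)
  next
    fix j r' m' w'
    assume j: "j < k" and f: "\<forall>i. i \<notin> writes tab_entry \<longrightarrow> r' i = r i" and I: "I j r' m' w'"
    have r': "r' 31 = Suc 0" "r' 11 = L + 4 * n" "r' 22 = ea c" using f r by (simp_all add: wr)
    have I': "r' 20 = k - j" "r' 21 = ea c + j" "w' = w" "tab_inv m0 c j m'" using I by (simp_all add: I_def)
    have "m' (ea c + j) = m0 (ea c + j)" using I'(4) ea_less[OF c j] by (simp add: tab_inv_def)
    then have u: "m' (ea c + j) = es ! c ! j" using e c j by (simp add: edge_words_def)
    show "r' 20 \<noteq> 0 \<and> wp tab_entry (\<lambda>t r'' m'' w''. t \<le> 8 \<and> I (Suc j) r'' m'' w'') r' m' w'"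
      using j tab_inv_step(2)[OF I'(4) c j] by (simp add: tab_entry_def I_def I'(1-3) r' u)
  qed (simp add: I_def)
  then show ?thesis
    by (rule wp_mono) (simp add: I_def wr)
qed

lemma pre_table_ok:
  assumes r: "r 0 = 0" "r 31 = 1" "r 3 = length es" "r 4 = k" "r 11 = L + 4 * n"
    and e: "edge_words m0" and m: "\<forall>v<n. m (L + 4 * n + v) = tb + v * d" "\<forall>a<L + 4 * n. m a = m0 a"
  shows "wp pre_table (\<lambda>t r' m' w'. t \<le> length es * (9 * k + 6) + 3 \<and> w' = w \<and> table m' \<and>
    (\<forall>a<L + 4 * n. m' a = m0 a) \<and> (\<forall>i. i \<notin> {19,20,21,22,28,29} \<longrightarrow> r' i = r i)) r m w"
proof -
  define I where "I c r' m' w' \<longleftrightarrow> r' 19 = length es - c \<and> Suc (r' 21) = ea c \<and> w' = w \<and> tab_inv m0 c 0 m'"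
    for c and r' m' :: "nat \<Rightarrow> nat" and w'
  define r1 where "r1 = r(21 := 2, 19 := length es)"
  have wr: "writes tab_edge = {19,20,21,22,28,29}" by (auto simp: tab_edge_def tab_entry_def)
  have l1: "wp (WHILENZ 19 tab_edge)
    (\<lambda>t r' m' w'. t \<le> length es * ((9 * k + 5) + 1) + 1 \<and> I (length es) r' m' w' \<and>
      (\<forall>i. i \<notin> writes tab_edge \<longrightarrow> r' i = r1 i)) r1 m w"
  proof (rule wp_while)
    show "I 0 r1 m w" using m by (simp add: I_def r1_def tab_inv_def seen_def ea_def)
  next
    fix c r' m' w'
    assume c: "c < length es" and f: "\<forall>i. i \<notin> writes tab_edge \<longrightarrow> r' i = r1 i" and I: "I c r' m' w'"
    have r': "r' 0 = 0" "r' 31 = Suc 0" "r' 11 = L + 4 * n" "r' 4 = k" using f r by (simp_all add: wr r1_def)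
    have I': "r' 19 = length es - c" "Suc (r' 21) = ea c" "w' = w" "tab_inv m0 c 0 m'" using I by (simp_all add: I_def)
    define r2 where "r2 = r'(21 := ea c, 22 := ea c, 20 := k)"
    have l2: "wp (WHILENZ 20 tab_entry) (\<lambda>t r' m' w'. t \<le> 9 * k + 1 \<and> w' = w \<and> tab_inv m0 c k m' \<and>
      r' 21 = ea c + k \<and> (\<forall>i. i \<notin> {20,21,28,29} \<longrightarrow> r' i = r2 i)) r2 m' w"
      by (rule tab_entry_loop) (use r' c I' e in \<open>simp_all add: r2_def\<close>)
    have eaS: "ea (Suc c) = Suc (ea c + k)" by (simp add: ea_def)
    have "tab_inv m0 c k m'' \<longleftrightarrow> tab_inv m0 (Suc c) 0 m''" for m''
      by (simp add: tab_inv_def seen_next[OF c])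
    then show "r' 19 \<noteq> 0 \<and> wp tab_edge (\<lambda>t r'' m'' w''. t \<le> 9 * k + 5 \<and> I (Suc c) r'' m'' w'') r' m' w'"
      unfolding tab_edge_def using c
      apply (simp add: r' I'(1-3) r2_def[symmetric])
      apply (rule wp_mono[OF l2])
      apply (simp add: I_def r2_def eaS r' I'(1))
      done
  qed (simp add: I_def)
  have tab: "table m'" if t: "tab_inv m0 (length es) 0 m'" for m'
    unfolding table_def
  proof (intro allI impI)
    fix v assume v: "v < n"
    have seen: "seen (length es) 0 v = {c. c < length es \<and> v \<in> set (es ! c)}" by (simp add: seen_def)
    have "(\<lambda>i. m' (tb + v * d + i)) ` {..<card (seen (length es) 0 v)} = ea ` seen (length es) 0 v"
      using t v by (simp add: tab_inv_def)
    then show "(\<lambda>j. m' (tb + v * d + j)) ` {..<d} = ea ` {c. c < length es \<and> v \<in> set (es ! c)}"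
      unfolding seen edge_deg[OF v] .
  qed
  show ?thesis
    unfolding pre_table_def
  proof (simp add: r r1_def[symmetric], rule wp_mono[OF l1], goal_cases)
    case (1 t' r' m' w')
    then have "tab_inv m0 (length es) 0 m'" by (simp add: I_def)
    then show ?case using 1 tab by (simp add: I_def wr r1_def tab_inv_def algebra_simps)
  qed
qed

lemma pre_rounds_ok:
  assumes r: "r 2 = n" and T: "T = 2 + 14 * lg" and lg: "\<forall>j<lg. 2 ^ j < n" "n \<le> 2 ^ lg"
  shows "wp pre_rounds (\<lambda>t r' m' w'. t \<le> 4 * lg + 6 \<and> w' = w \<and> m' = m \<and> r' 6 = T \<and> r' 13 = 2 \<and>
    (\<forall>i. i \<notin> {6,13,28,29,30} \<longrightarrow> r' i = r i)) r m w"
proof -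
  let ?c = "seqs [ADD 28 28 28, ADD 6 6 30, SUB 29 2 28]"
  define r1 where "r1 = r(28 := Suc 0, 6 := 2, 30 := 14, 29 := n - Suc 0)"
  define I where "I j r' m' w' \<longleftrightarrow> r' 28 = 2 ^ j \<and> r' 6 = 2 + 14 * j \<and> r' 29 = n - 2 ^ j \<and> w' = w \<and> m' = m"
    for j and r' m' :: "nat \<Rightarrow> nat" and w'
  have l1: "wp (WHILENZ 29 ?c)
    (\<lambda>t r' m' w'. t \<le> lg * (3 + 1) + 1 \<and> I lg r' m' w' \<and> (\<forall>i. i \<notin> writes ?c \<longrightarrow> r' i = r1 i)) r1 m w"
  proof (rule wp_while)
    show "I 0 r1 m w" by (simp add: I_def r1_def)
  next
    fix j r' m' w'
    assume j: "j < lg" and f: "\<forall>i. i \<notin> writes ?c \<longrightarrow> r' i = r1 i" and I: "I j r' m' w'"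
    have r': "r' 30 = 14" "r' 2 = n" using f r by (simp_all add: r1_def)
    show "r' 29 \<noteq> 0 \<and> wp ?c (\<lambda>t r'' m'' w''. t \<le> 3 \<and> I (Suc j) r'' m'' w'') r' m' w'"
      using lg(1)[rule_format, OF j] I by (simp add: I_def r' mult_2)
  qed (use lg(2) in \<open>simp add: I_def\<close>)
  show ?thesis
    unfolding pre_rounds_def
    apply (simp add: r r1_def[symmetric])
    apply (rule wp_mono[OF l1[unfolded seqs.simps]])
    apply (simp add: I_def r1_def T)
    done
qed

lemma output_ok:
  assumes r: "regs r" and m: "bits m (L + 3 * n) S"
  shows "wp output_com (\<lambda>t r' m' w'. t \<le> 6 * n + 3 \<and> bits m' 0 S) r m w"
proof -
  let ?c = "seqs [ADD 28 10 16, LOAD 29 28, STORE 16 29, ADD 16 16 31, SUB 15 15 31]"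
  define r1 where "r1 = r(16 := 0, 15 := n)"
  define I where "I j r' m' w' \<longleftrightarrow> r' 15 = n - j \<and> r' 16 = j \<and> (\<forall>v<j. m' v = of_bool (v \<in> S)) \<and> bits m' (L + 3 * n) S"
    for j and r' m' :: "nat \<Rightarrow> nat" and w' :: "bool stream"
  have l1: "wp (WHILENZ 15 ?c)
    (\<lambda>t r' m' w'. t \<le> n * (5 + 1) + 1 \<and> I n r' m' w' \<and> (\<forall>i. i \<notin> writes ?c \<longrightarrow> r' i = r1 i)) r1 m w"
  proof (rule wp_while)
    show "I 0 r1 m w" using m by (simp add: I_def r1_def)
  next
    fix j r' m' w'
    assume j: "j < n" and f: "\<forall>i. i \<notin> writes ?c \<longrightarrow> r' i = r1 i" and I: "I j r' m' w'"
    have r': "r' 31 = Suc 0" "r' 10 = L + 3 * n" using f r by (simp_all add: r1_def regs_def)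
    have I': "r' 15 = n - j" "r' 16 = j" "\<forall>v<j. m' v = of_bool (v \<in> S)" "bits m' (L + 3 * n) S" using I by (simp_all add: I_def)
    have b: "m' (L + 3 * n + j) = of_bool (j \<in> S)" using I'(4) j by (simp add: bits_def)
    define m2 where "m2 = m'(j := of_bool (j \<in> S))"
    have 1: "\<forall>v<Suc j. m2 v = of_bool (v \<in> S)" using I'(3) by (simp add: m2_def less_Suc_eq)
    have 2: "bits m2 (L + 3 * n) S" using I'(4) j by (simp add: bits_def m2_def)
    show "r' 15 \<noteq> 0 \<and> wp ?c (\<lambda>t r'' m'' w''. t \<le> 5 \<and> I (Suc j) r'' m'' w'') r' m' w'"
      using j 1 2 by (simp add: I_def r' I'(1,2) b m2_def[symmetric])
  qed (simp add: I_def)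
  have r': "r 0 = 0" "r 2 = n" using r by (simp_all add: regs_def)
  show ?thesis
    unfolding output_com_def
    apply (simp add: r' r1_def[symmetric])
    apply (rule wp_mono[OF l1[unfolded seqs.simps]])
    apply (simp add: I_def bits_def)
    done
qed

end

section \<open>The whole program\<close>

context ram_input
begin

text \<open>The array at \<open>L + 3 * n\<close> is meaningful only after a block has been run,
  which has happened by the time the initial count 2 has dropped to 0.\<close>

definition ready :: "nat \<Rightarrow> nat set \<Rightarrow> nat set \<Rightarrow> (nat \<Rightarrow> nat) \<Rightarrow> (nat \<Rightarrow> nat) \<Rightarrow> bool" where
  "ready c x y r m \<longleftrightarrow> regs r \<and> r 13 = c \<and> edge_words m \<and> table m \<and> bits m (L + 2 * n) x \<and>
     (c = 0 \<longrightarrow> bits m (L + 3 * n) y)"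

lemma block_ready:
  assumes "ready c x y r m"
  shows "wp block_body (\<lambda>t r' m' w'. t \<le> block_time \<and> w' = sdrop (T * n) w \<and>
    ready (c - of_bool (coalesced ((!!) w) (T * n))) (chain ((!!) w) (T * n) x) x r' m') r m w"
proof -
  have r: "regs r" "edge_words m" "table m" "bits m (L + 2 * n) x" "r 13 = c" using assms by (simp_all add: ready_def)
  have "0 < n \<or> T * n = 0" by auto
  from block_step[OF r(1) this r(2-4)] show ?thesis
    by (rule wp_mono) (simp add: ready_def r(5))
qed

lemma main_loop:
  assumes "outp (T * n) J c x y w = Some S" "ready c x y r m"
  shows "wp (WHILENZ 13 block_body) (\<lambda>t r' m' w'. t \<le> blocks (T * n) J c w * (block_time + 1) + 1 \<and>
    regs r' \<and> bits m' (L + 3 * n) S) r m w"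
  using assms
proof (induction J arbitrary: c x y w r m)
  case 0
  then have S: "c = 0" "y = S" by (simp_all split: if_splits)
  have "exec (WHILENZ 13 block_body) (r, m, w) 1 (r, m, w)"
    by (rule exec.WhileZero) (use 0 S in \<open>simp add: ready_def\<close>)
  then show ?case using 0 S unfolding wp_def by (fastforce simp: ready_def)
next
  case (Suc J)
  show ?case
  proof (cases "c = 0")
    case True
    have S: "y = S" using Suc.prems(1) True by simp
    have "exec (WHILENZ 13 block_body) (r, m, w) 1 (r, m, w)"
      by (rule exec.WhileZero) (use Suc.prems True in \<open>simp add: ready_def\<close>)
    then show ?thesis using Suc.prems True S unfolding wp_def by (fastforce simp: ready_def)
  next
    case False
    let ?c = "c - of_bool (coalesced ((!!) w) (T * n))"
    obtain t1 r1 m1 where 1: "exec block_body (r, m, w) t1 (r1, m1, sdrop (T * n) w)" "t1 \<le> block_time"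
      "ready ?c (chain ((!!) w) (T * n) x) x r1 m1"
      using block_ready[OF Suc.prems(2), of w] unfolding wp_def by blast
    have "outp (T * n) J ?c (chain ((!!) w) (T * n) x) x (sdrop (T * n) w) = Some S"
      using Suc.prems(1) False by simp
    from Suc.IH[OF this 1(3)] obtain t2 r2 m2 w2 where
      2: "exec (WHILENZ 13 block_body) (r1, m1, sdrop (T * n) w) t2 (r2, m2, w2)"
        "t2 \<le> blocks (T * n) J ?c (sdrop (T * n) w) * (block_time + 1) + 1" "regs r2" "bits m2 (L + 3 * n) S"
      unfolding wp_def by blast
    have "r 13 \<noteq> 0" using Suc.prems(2) False by (simp add: ready_def)
    note e = exec.WhileNonzero[OF this 1(1) 2(1)]
    have "t1 + t2 + 1 \<le> blocks (T * n) (Suc J) c w * (block_time + 1) + 1" using 1(2) 2(2) False by simp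
    then show ?thesis using e 2(3,4) unfolding wp_def by blast
  qed
qed

text \<open>The converse direction, needed because the output event must not be larger than
  computed. Determinism matches the first iteration of the given run with the one described by
  \<open>block_ready\<close>, and the rest takes less time.\<close>

lemma main_loop_halts:
  assumes "exec (WHILENZ 13 block_body) (r, m, w) t s'" "ready c x y r m"
  shows "\<exists>J S. outp (T * n) J c x y w = Some S"
  using assms
proof (induction t arbitrary: c x y w r m rule: less_induct)
  case (less t)
  show ?case
  proof (cases "c = 0")
    case True
    then have "outp (T * n) 0 c x y w = Some y" by simp
    then show ?thesis by blast
  next
    case False
    let ?c = "c - of_bool (coalesced ((!!) w) (T * n))"
    have nz: "r 13 \<noteq> 0" using less.prems(2) False by (simp add: ready_def)
    obtain t1 r1 m1 where 1: "exec block_body (r, m, w) t1 (r1, m1, sdrop (T * n) w)"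
      "ready ?c (chain ((!!) w) (T * n) x) x r1 m1"
      using block_ready[OF less.prems(2), of w] unfolding wp_def by blast
    from less.prems(1) obtain u1 s1 u2 where
      2: "exec block_body (r, m, w) u1 s1" "exec (WHILENZ 13 block_body) s1 u2 s'" "t = u1 + u2 + 1"
      by (rule WhileE) (use nz in auto)
    have "s1 = (r1, m1, sdrop (T * n) w)" using exec_deterministic[OF 1(1) 2(1)] by simp
    then obtain J S where "outp (T * n) J ?c (chain ((!!) w) (T * n) x) x (sdrop (T * n) w) = Some S"
      using less.IH[of u2 r1 m1 "sdrop (T * n) w"] 2 1(2) by fastforce
    then have "outp (T * n) (Suc J) c x y w = Some S" using False by simp
    then show ?thesis by blast
  qed
qed

definition prelude_time :: "nat \<Rightarrow> nat" where
  "prelude_time lg = 3 * length es + 3 * d + 5 * n + length es * (9 * k + 6) + 4 * lg + 28"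

lemma prelude_ok:
  assumes m: "m 0 = n" "m 1 = length es" "m 2 = k" "edge_words m" "\<forall>a\<ge>L. m a = 0"
    and T: "T = 2 + 14 * lg" and lg: "\<forall>j<lg. 2 ^ j < n" "n \<le> 2 ^ lg"
  shows "wp prelude (\<lambda>t r' m' w'. t \<le> prelude_time lg \<and> w' = w \<and> ready 2 {} {} r' m') (\<lambda>_. 0) m w"
  unfolding prelude_def
proof (simp del: wp_basic, rule wp_mono[OF pre_sizes_ok[OF m(1-3)]], goal_cases)
  case (1 t1 r1 m1 w1)
  then have s1: "t1 \<le> 3 * length es + 3 * d + 15" "m1 = m" "w1 = w" by blast+
  have r1: "r1 0 = 0" "r1 31 = 1" "r1 2 = n" "r1 3 = length es" "r1 4 = k" "r1 5 = d" "r1 7 = L" "r1 8 = L + n"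
     "r1 9 = L + 2 * n" "r1 10 = L + 3 * n" "r1 11 = L + 4 * n" "r1 12 = tb" using 1 by blast+
  show ?case
    unfolding s1(2,3) wp_SEQ
  proof (rule wp_mono[OF pre_fill_ok[where r = r1, OF r1(1-3,6,11,12)]], goal_cases)
    case (1 t2 r2 m2 w2)
    then have s2: "t2 \<le> 5 * n + 4" "w2 = w" "\<forall>v<n. m2 (L + 4 * n + v) = tb + v * d" "\<forall>a<L + 4 * n. m2 a = m a"
      and f2: "\<And>i. i \<notin> {15,20,21} \<Longrightarrow> r2 i = r1 i" by blast+
    have r2: "r2 0 = 0" "r2 31 = 1" "r2 3 = length es" "r2 4 = k" "r2 11 = L + 4 * n" using f2 r1 by simp_all
    show ?case
      unfolding s2(2) wp_SEQ
    proof (rule wp_mono[OF pre_table_ok[where r = r2, OF r2 m(4) s2(3,4)]], goal_cases)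
      case (1 t3 r3 m3 w3)
      then have s3: "t3 \<le> length es * (9 * k + 6) + 3" "w3 = w" "table m3" "\<forall>a<L + 4 * n. m3 a = m a"
        and f3: "\<And>i. i \<notin> {19,20,21,22,28,29} \<Longrightarrow> r3 i = r2 i" by blast+
      have r3: "r3 2 = n" using f2 f3 r1 by simp
      show ?case
        unfolding s3(2)
      proof (rule wp_mono[OF pre_rounds_ok[where r = r3, OF r3 T lg]], goal_cases)
        case (1 t4 r4 m4 w4)
        then have s4: "t4 \<le> 4 * lg + 6" "w4 = w" "m4 = m3" "r4 6 = T" "r4 13 = 2"
          and f4: "\<And>i. i \<notin> {6,13,28,29,30} \<Longrightarrow> r4 i = r3 i" by blast+
        have "regs r4" using f4 f3 f2 r1 s4(4) by (simp add: regs_def)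
        moreover have "edge_words m3" using s3(4) m(4) ea_less by (simp add: edge_words_def trans_less_add1)
        moreover have "bits m3 (L + 2 * n) {}" using s3(4) m(5) by (simp add: bits_def)
        ultimately have "ready 2 {} {} r4 m4" using s4 s3(3) by (simp add: ready_def)
        then show ?case using s1(1) s2(1) s3(1) s4(1,2) by (simp add: prelude_time_def)
      qed
    qed
  qed
qed

definition sampler_time :: "nat \<Rightarrow> nat \<Rightarrow> nat" where
  "sampler_time lg b = prelude_time lg + (b * (block_time + 1) + 1) + (6 * n + 3)"

context
  fixes m :: "nat \<Rightarrow> nat" and lg :: nat
  assumes m: "m 0 = n" "m 1 = length es" "m 2 = k" "edge_words m" "\<forall>a\<ge>L. m a = 0"
    and T: "T = 2 + 14 * lg" and lg: "\<forall>j<lg. 2 ^ j < n" "n \<le> 2 ^ lg"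
begin

lemma sampler_ok:
  assumes "outp (T * n) J 2 {} {} w = Some S"
  shows "wp sampler (\<lambda>t r' m' w'. t \<le> sampler_time lg (blocks (T * n) J 2 w) \<and> bits m' 0 S) (\<lambda>_. 0) m w"
  unfolding sampler_def
proof (simp del: wp_basic, rule wp_mono[OF prelude_ok[OF m T lg]], goal_cases)
  case (1 t1 r1 m1 w1)
  then have s1: "t1 \<le> prelude_time lg" "w1 = w" "ready 2 {} {} r1 m1" by blast+
  show ?case
    unfolding s1(2) wp_SEQ
  proof (rule wp_mono[OF main_loop[OF assms s1(3)]], goal_cases)
    case (1 t2 r2 m2 w2)
    then have s2: "t2 \<le> blocks (T * n) J 2 w * (block_time + 1) + 1" "regs r2" "bits m2 (L + 3 * n) S" by blast+
    show ?case
      by (rule wp_mono[OF output_ok[OF s2(2,3)]]) (use s1(1) s2(1) in \<open>simp add: sampler_time_def\<close>)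
  qed
qed

lemma sampler_halts:
  assumes "exec sampler (\<lambda>_. 0, m, w) t s'"
  shows "\<exists>J S. outp (T * n) J 2 {} {} w = Some S"
proof -
  obtain t1 r1 m1 where 1: "exec prelude (\<lambda>_. 0, m, w) t1 (r1, m1, w)" "ready 2 {} {} r1 m1"
    using prelude_ok[OF m T lg, of w] unfolding wp_def by blast
  obtain u1 s1 u2 where 2: "exec prelude (\<lambda>_. 0, m, w) u1 s1" "exec (SEQ (WHILENZ 13 block_body) output_com) s1 u2 s'"
    using assms unfolding sampler_def by (auto elim: SeqE)
  have "s1 = (r1, m1, w)" using exec_deterministic[OF 1(1) 2(1)] by simp
  then obtain u3 s2 where "exec (WHILENZ 13 block_body) (r1, m1, w) u3 s2" using 2(2) by (auto elim: SeqE)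
  then show ?thesis using main_loop_halts 1(2) by blast
qed

text \<open>Halting yields an output of the abstract sampler, and determinism identifies the given
  run with the one from \<open>sampler_ok\<close>.\<close>

lemma sampler_output:
  assumes e: "exec sampler (\<lambda>_. 0, m, w) t (r, m', w')"
  shows "\<exists>J S. outp (T * n) J 2 {} {} w = Some S \<and> bits m' 0 S"
proof -
  obtain J S where S: "outp (T * n) J 2 {} {} w = Some S" using sampler_halts[OF e] by blast
  obtain t2 r2 m2 w2 where "exec sampler (\<lambda>_. 0, m, w) t2 (r2, m2, w2)" "bits m2 0 S"
    using sampler_ok[OF S] unfolding wp_def by blast
  then have "bits m' 0 S" using exec_deterministic[OF e] by fastforce
  then show "\<exists>J S. outp (T * n) J 2 {} {} w = Some S \<and> bits m' 0 S" using S by blast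
qed

end

end

context scan_hypergraph
begin

lemma outp_indep:
  assumes "outp N J c x y w = Some S" "x \<in> indep" "y \<in> indep" "0 < n \<or> N = 0"
  shows "S \<in> indep"
  using assms
proof (induction J arbitrary: c x y w)
  case (Suc J)
  then show ?case using chain_indep[OF Suc.prems(2,4)] by (auto split: if_splits)
qed (auto split: if_splits)

text \<open>Without any output the block count exhausts every budget; its supremum is then infinite
  and still bounds the running time.\<close>

lemma outp_None_blocks: "outp N J c x y w = None \<Longrightarrow> blocks N J c w = J"
  by (induction J arbitrary: c x y w) (auto split: if_splits)

end

lemma length_concat_words:
  assumes "\<And>e. e \<in> set es \<Longrightarrow> length e = k"
  shows "length (concat (map (\<lambda>e. length e # e) es)) = length es * Suc k"
  using assms by (induction es) auto

lemma nth_concat_words: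
  assumes "\<And>e. e \<in> set es \<Longrightarrow> length e = k" "c < length es" "j \<le> k"
  shows "concat (map (\<lambda>e. length e # e) es) ! (c * Suc k + j) = (k # es ! c) ! j"
  using assms
proof (induction es arbitrary: c)
  case (Cons e es)
  show ?case
  proof (cases c)
    case 0
    then show ?thesis using Cons.prems by (simp add: nth_append nth_Cons split: nat.split)
  next
    case (Suc c')
    have "concat (map (\<lambda>e. length e # e) (e # es)) ! (c * Suc k + j) =
        ((k # e) @ concat (map (\<lambda>e. length e # e) es)) ! (length (k # e) + (c' * Suc k + j))"
      using Cons.prems Suc by (simp add: algebra_simps)
    also have "\<dots> = concat (map (\<lambda>e. length e # e) es) ! (c' * Suc k + j)" by (rule nth_append_length_plus)
    also have "\<dots> = (k # es ! c') ! j" using Cons.prems Suc by (intro Cons.IH) auto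
    finally show ?thesis using Suc by simp
  qed
qed simp

text \<open>With \<open>1 \<le> d\<close> the density condition gives \<open>4 k^2 < 2^k\<close>,
  which fails for \<open>k\<close> from 1 to 8, at 8 by equality. The last bound says that
  \<open>- ln (1 - \<epsilon>)\<close> is at most \<open>k * ln 2\<close>.\<close>

lemma class_size_bounds:
  fixes k d :: nat and \<epsilon> :: real
  assumes "0 < \<epsilon>" "1 \<le> k" "1 \<le> d" and d: "real d \<le> (1 - \<epsilon>) / 4 * (2 ^ k / (real k)\<^sup>2)"
  shows "4 * k\<^sup>2 * d < 2 ^ k" "9 \<le> k" "1 \<le> (1 - \<epsilon>) * 2 ^ k"
proof -
  have k: "0 < (real k)\<^sup>2" using assms by simp
  have *: "4 * (real k)\<^sup>2 * real d \<le> (1 - \<epsilon>) * 2 ^ k" using d k by (simp add: field_simps)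
  have "(1 - \<epsilon>) * 2 ^ k < 1 * 2 ^ k" using assms(1) by (intro mult_strict_right_mono) auto
  then have "4 * (real k)\<^sup>2 * real d < 2 ^ k" using * by linarith
  then have "real (4 * k\<^sup>2 * d) < real (2 ^ k)" by simp
  then show kd: "4 * k\<^sup>2 * d < 2 ^ k" by (simp only: of_nat_less_iff)
  have "4 * k\<^sup>2 * 1 \<le> 4 * k\<^sup>2 * d" using assms(3) by (intro mult_left_mono) auto
  then have k2: "4 * k\<^sup>2 < 2 ^ k" using kd by linarith
  show "9 \<le> k"
  proof (rule ccontr)
    assume "\<not> 9 \<le> k"
    then have "k \<in> {1,2,3,4,5,6,7,8}" using assms(2) by auto
    then show False using k2 by auto
  qed
  have "1 \<le> real (4 * k\<^sup>2 * d)" using assms by (simp add: Suc_le_eq flip: of_nat_mult)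
  then show "1 \<le> (1 - \<epsilon>) * 2 ^ k" using * by simp
qed

lemma ex_ceil_log2: "\<exists>lg. (\<forall>j<lg. 2 ^ j < n) \<and> n \<le> 2 ^ lg" for n :: nat
proof (intro exI conjI allI impI)
  let ?lg = "LEAST l. n \<le> 2 ^ l"
  show "n \<le> 2 ^ ?lg" by (rule LeastI[of _ n]) (simp add: less_imp_le less_exp)
  show "2 ^ j < n" if "j < ?lg" for j using not_less_Least[OF that] by simp
qed

text \<open>The fixed cost is added to 4 times the cost of a block, 4 bounding the expected number
  of blocks. With \<open>P = n * d * k\<close> these are at most 70 and 1024 times
  \<open>lg * P\<close>, and \<open>70 + 4 * 1024 = 4166\<close>; then
  \<open>lg \<le> 3 * ln n\<close> gives 12498.\<close>

lemma sampler_time_bound: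
  fixes n k d me lg :: nat and \<epsilon> :: real
  assumes \<epsilon>: "0 < \<epsilon>" "\<epsilon> < 1" "1 \<le> (1 - \<epsilon>) * 2 ^ k" and k: "9 \<le> k" and d: "1 \<le> d" and n: "9 \<le> n"
    and me: "me * k = d * n" and lg: "\<forall>j<lg. 2 ^ j < n" "n \<le> 2 ^ lg"
  shows "real ((3 * me + 3 * d + 5 * n + me * (9 * k + 6) + 4 * lg + 28) + 1 + (6 * n + 3)) +
     4 * real ((2 + 14 * lg) * (n * (d * (13 * k + 19) + 24) + 6) + 20 * n + 11 + 1)
   \<le> 13000 * (- 1 / ln (1 - \<epsilon>) * (real k)\<^sup>2 * (real d)\<^sup>2 * real n * (ln (real n) + ln (real d)))"
proof -
  define P where "P = n * d * k"
  have lg1: "1 \<le> lg" using lg(2) n by (cases lg) auto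
  have "n * 1 * 1 \<le> n * d * k" "1 * d * 1 \<le> n * d * k" using d k n by (intro mult_mono; simp)+
  then have P1: "n \<le> P" "d \<le> P" by (simp_all add: P_def)
  have "n * d * 1 \<le> n * d * k" using k by (intro mult_left_mono) auto
  then have P2: "n * d \<le> P" by (simp add: P_def)
  have "me * 1 \<le> me * k" using k by (intro mult_left_mono) auto
  then have P3: "me \<le> P" using me P2 by (metis mult.commute mult_1_right order_trans)
  have P4: "1 \<le> P" using P1 n by linarith
  have Pl: "P \<le> lg * P" using lg1 by simp
  have "me * (9 * k + 6) = 9 * (me * k) + 6 * me" by (simp add: algebra_simps)
  also have "\<dots> \<le> 15 * P" using me P2 P3 by (simp add: mult.commute)
  finally have A: "(3 * me + 3 * d + 5 * n + me * (9 * k + 6) + 4 * lg + 28) + 1 + (6 * n + 3) \<le> 70 * (lg * P)"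
  proof -
    assume "me * (9 * k + 6) \<le> 15 * P"
    moreover have "lg \<le> lg * P" using P4 by simp
    ultimately show ?thesis using P1 P3 P4 Pl n by linarith
  qed
  have B1: "n * (d * (13 * k + 19) + 24) + 6 \<le> 62 * P"
  proof -
    have "n * (d * (13 * k + 19) + 24) = 13 * P + 19 * (n * d) + 24 * n" by (simp add: P_def algebra_simps)
    then show ?thesis using P1 P2 P4 by linarith
  qed
  have "(2 + 14 * lg) * (n * (d * (13 * k + 19) + 24) + 6) \<le> (16 * lg) * (62 * P)"
    using lg1 by (intro mult_mono B1) auto
  then have B: "(2 + 14 * lg) * (n * (d * (13 * k + 19) + 24) + 6) + 20 * n + 11 + 1 \<le> 1024 * (lg * P)"
  proof -
    assume "(2 + 14 * lg) * (n * (d * (13 * k + 19) + 24) + 6) \<le> (16 * lg) * (62 * P)"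
    moreover have "(16 * lg) * (62 * P) = 992 * (lg * P)" by simp
    ultimately show ?thesis using P1 P4 Pl by linarith
  qed
  have "real ((3 * me + 3 * d + 5 * n + me * (9 * k + 6) + 4 * lg + 28) + 1 + (6 * n + 3)) +
     4 * real ((2 + 14 * lg) * (n * (d * (13 * k + 19) + 24) + 6) + 20 * n + 11 + 1)
     \<le> real (70 * (lg * P)) + 4 * real (1024 * (lg * P))"
    by (intro add_mono mult_left_mono of_nat_mono A B) simp
  also have "\<dots> = 4166 * (real lg * real P)" by simp
  also have "\<dots> \<le> 4166 * ((3 * ln (real n)) * real P)"
  proof (intro mult_left_mono mult_right_mono)
    have "2 ^ (lg - 1) < n" using lg(1) lg1 by auto
    then have "real (2 ^ (lg - 1)) \<le> real n" by (intro of_nat_mono) simp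
    then have "ln (2 ^ (lg - 1)) \<le> ln (real n)" by (subst ln_le_cancel_iff) (use n in auto)
    then have l2: "(real lg - 1) * ln 2 \<le> ln (real n)" using lg1 by (simp add: ln_realpow of_nat_diff)
    have "(real lg - 1) * (1/2) \<le> (real lg - 1) * ln 2"
      using lg1 ln2_ge_two_thirds by (intro mult_left_mono) auto
    then have "(real lg - 1) * (1/2) \<le> ln (real n)" using l2 by (rule order_trans)
    then have "real lg \<le> 2 * ln (real n) + 1" by (simp add: field_simps)
    \<comment> \<open>This absorbs the rounding up of the binary logarithm; it uses that
      \<open>n\<close> exceeds 3.\<close>
    moreover have "1 \<le> ln (real n)"
    proof -
      have "exp 1 \<le> (3 :: real)" using exp_le by simp
      then have "exp 1 \<le> real n" using n by linarith
      then show ?thesis using n by (subst ln_ge_iff) auto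
    qed
    ultimately show "real lg \<le> 3 * ln (real n)" by argo
  qed auto
  also have "\<dots> = 12498 * (real P * ln (real n))" by simp
  also have "\<dots> \<le> 13000 * (- 1 / ln (1 - \<epsilon>) * (real k)\<^sup>2 * (real d)\<^sup>2 * real n * (ln (real n) + ln (real d)))"
  proof -
    define z where "z = - 1 / ln (1 - \<epsilon>)"
    have neg: "ln (1 - \<epsilon>) < 0" using \<epsilon> by simp
    have "(1/2) ^ k \<le> 1 - \<epsilon>" using \<epsilon>(3) by (simp add: power_divide field_simps)
    then have "ln ((1/2) ^ k) \<le> ln (1 - \<epsilon>)" by (subst ln_le_cancel_iff) (use \<epsilon> in auto)
    then have "- ln (1 - \<epsilon>) \<le> real k * ln 2" by (simp add: ln_realpow ln_div)
    also have "\<dots> \<le> real k * 1" using ln_2_less_1 by (intro mult_left_mono) auto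
    finally have "- ln (1 - \<epsilon>) \<le> real k" by simp
    then have zk: "1 \<le> z * real k" using neg by (simp add: z_def field_simps)
    have lnn: "0 \<le> ln (real n)" "0 \<le> ln (real d)" using n d by auto
    have "real P * ln (real n) = (1 * (real k * (real d * 1) * real n)) * ln (real n)" by (simp add: P_def)
    also have "\<dots> \<le> ((z * real k) * (real k * (real d * real d) * real n)) * (ln (real n) + ln (real d))"
      using zk lnn d by (intro mult_mono) auto
    also have "\<dots> = z * (real k)\<^sup>2 * (real d)\<^sup>2 * real n * (ln (real n) + ln (real d))"
      by (simp add: power2_eq_square)
    finally have "real P * ln (real n) \<le> z * (real k)\<^sup>2 * (real d)\<^sup>2 * real n * (ln (real n) + ln (real d))" .
    moreover have "0 \<le> real P * ln (real n)" using lnn by simp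
    ultimately show ?thesis unfolding z_def by linarith
  qed
  finally show ?thesis .
qed

section \<open>Uniform output and expected time\<close>

lemma sampler_correct:
  fixes \<epsilon> :: real and k d :: nat and V :: "'a set" and E :: "'a set set"
  assumes \<epsilon>: "0 < \<epsilon>" "\<epsilon> < 1" and cls: "(V, E) \<in> hypergraph_class \<epsilon> k d" and rep: "represents vs es V E"
  shows "output_prob sampler vs es S = pmf (pmf_of_set (independent_sets V E)) S"
    "card V \<ge> 1 \<Longrightarrow> d \<ge> 1 \<Longrightarrow> expected_time sampler (input_word vs es)
       \<le> ennreal (13000 * (- 1 / ln (1 - \<epsilon>) * (real k)\<^sup>2 * (real d)\<^sup>2 * real (card V)
                              * (ln (real (card V)) + ln (real d))))"
proof -

  \<comment> \<open>Renaming the vertices to 0, ..., n - 1\<close>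
  define n where "n = length vs"
  define \<iota> where "\<iota> I = (!) vs ` I" for I
  have cl: "k_uniform k E" "d_regular d V E" "linear_hypergraph E" "1 \<le> k"
    "real d \<le> (1 - \<epsilon>) / 4 * (2 ^ k / (real k)\<^sup>2)"
    using cls by (auto simp: hypergraph_class_def)
  have rp: "distinct vs" "set vs = V" "\<And>e. e \<in> set es \<Longrightarrow> distinct e \<and> set e \<subseteq> {..<n}"
    "distinct (map set es)" "E = (\<lambda>e. \<iota> (set e)) ` set es"
    using rep by (auto simp: represents_def n_def \<iota>_def)
  have cardV: "card V = n" using rp(1,2) distinct_card n_def by blast
  have inj: "inj_on ((!) vs) {..<n}" using rp(1) by (auto simp: inj_on_def n_def nth_eq_iff_index_eq)
  have V: "V = \<iota> {..<n}" using rp(2) by (auto simp: \<iota>_def n_def set_conv_nth)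
  have \<iota>_eq: "\<iota> A = \<iota> B \<longleftrightarrow> A = B" if "A \<subseteq> {..<n}" "B \<subseteq> {..<n}" for A B
    unfolding \<iota>_def by (rule inj_on_image_eq_iff[OF inj that])
  have \<iota>_sub: "\<iota> A \<subseteq> \<iota> B \<longleftrightarrow> A \<subseteq> B" if "A \<subseteq> {..<n}" "B \<subseteq> {..<n}" for A B
    unfolding \<iota>_def by (rule inj_on_image_subset_iff[OF inj that])
  have \<iota>_mem: "vs ! v \<in> \<iota> A \<longleftrightarrow> v \<in> A" if "v < n" "A \<subseteq> {..<n}" for v A
    unfolding \<iota>_def by (rule inj_on_image_mem_iff[OF inj]) (use that in auto)
  have \<iota>_card: "card (\<iota> A) = card A" if "A \<subseteq> {..<n}" for A
    unfolding \<iota>_def by (rule card_image[OF inj_on_subset[OF inj that]])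
  have len: "length e = k" if "e \<in> set es" for e
  proof -
    have "\<iota> (set e) \<in> E" using that rp(5) by blast
    then have "card (\<iota> (set e)) = k" using cl(1) by (simp add: k_uniform_def)
    then show ?thesis using \<iota>_card rp(3)[OF that] by (simp add: distinct_card)
  qed
  have deg: "card {c. c < length es \<and> v \<in> set (es ! c)} = d" if v: "v < n" for v
  proof -
    have "bij_betw (\<lambda>c. \<iota> (set (es ! c))) {c. c < length es \<and> v \<in> set (es ! c)} {C \<in> E. vs ! v \<in> C}"
    proof (rule bij_betwI')
      fix c c' assume "c \<in> {c. c < length es \<and> v \<in> set (es ! c)}" "c' \<in> {c. c < length es \<and> v \<in> set (es ! c)}"
      then have c: "c < length es" "c' < length es" by auto
      have "\<iota> (set (es ! c)) = \<iota> (set (es ! c')) \<longleftrightarrow> set (es ! c) = set (es ! c')"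
        using rp(3) c by (intro \<iota>_eq) auto
      also have "\<dots> \<longleftrightarrow> map set es ! c = map set es ! c'" using c by simp
      also have "\<dots> \<longleftrightarrow> c = c'" using rp(4) c by (intro nth_eq_iff_index_eq) auto
      finally show "(\<iota> (set (es ! c)) = \<iota> (set (es ! c'))) = (c = c')" .
    next
      fix c assume "c \<in> {c. c < length es \<and> v \<in> set (es ! c)}"
      then show "\<iota> (set (es ! c)) \<in> {C \<in> E. vs ! v \<in> C}"
        using \<iota>_mem[OF v] rp(3)[of "es ! c"] by (auto simp: rp(5))
    next
      fix C assume "C \<in> {C \<in> E. vs ! v \<in> C}"
      then obtain e where e: "e \<in> set es" "C = \<iota> (set e)" "vs ! v \<in> C" using rp(5) by blast
      then have "v \<in> set e" using \<iota>_mem[OF v] rp(3)[OF e(1)] by blast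
      moreover obtain c where "c < length es" "e = es ! c" using e(1) by (metis in_set_conv_nth)
      ultimately show "\<exists>c\<in>{c. c < length es \<and> v \<in> set (es ! c)}. C = \<iota> (set (es ! c))" using e(2) by blast
    qed
    then have "card {c. c < length es \<and> v \<in> set (es ! c)} = card {C \<in> E. vs ! v \<in> C}" by (rule bij_betw_same_card)
    also have "\<dots> = d" using cl(2) v rp(2) by (auto simp: d_regular_def n_def)
    finally show ?thesis .
  qed
  \<comment> \<open>The values that the machine computes: without edges it reads 0 as the size of an
    edge, and without vertices it finds degree 0.\<close>
  define k' where "k' = (if es = [] then 0 else k)"
  define d' where "d' = (if n = 0 then 0 else d)"
  obtain lg where lg: "\<forall>j<lg. 2 ^ j < n" "n \<le> 2 ^ lg" using ex_ceil_log2[of n] by blast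
  define T where "T = 2 + 14 * lg"
  interpret R: ram_input n k' d' T es
  proof
    show "distinct e \<and> length e = k' \<and> set e \<subseteq> {..<n}" if "e \<in> set es" for e
      using rp(3)[OF that] len[OF that] that by (auto simp: k'_def)
    show "card {c. c < length es \<and> v \<in> set (es ! c)} = d'" if "v < n" for v
      using deg[OF that] that by (simp add: d'_def)
  qed (simp add: d'_def)

  \<comment> \<open>The initial memory\<close>
  define xs where "xs = input_word vs es"
  define m0 where "m0 = (\<lambda>a. if a < length xs then xs ! a else 0)"
  have init: "initial_state xs w = (\<lambda>_. 0, m0, w)" for w by (simp add: initial_state_def m0_def)
  have len': "length e = k'" if "e \<in> set es" for e using R.edges[OF that] by blast
  have lenxs: "length xs = R.L"
    using length_concat_words[of es k'] len' by (simp add: xs_def input_word_def R.L_def)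
  have word: "m0 (2 + (c * Suc k' + j)) = (k' # es ! c) ! j" if "c < length es" "j \<le> k'" for c j
  proof -
    have "Suc c * Suc k' \<le> length es * Suc k'" using that by (intro mult_right_mono) auto
    then have "2 + (c * Suc k' + j) < length xs" using that unfolding lenxs by (simp add: R.L_def)
    then have "m0 (2 + (c * Suc k' + j)) = concat (map (\<lambda>e. length e # e) es) ! (c * Suc k' + j)"
      by (simp add: m0_def xs_def input_word_def)
    then show ?thesis using nth_concat_words[of es k' c j] len' that by simp
  qed
  have m0: "m0 0 = n" "m0 1 = length es" "m0 2 = k'" "R.edge_words m0" "\<forall>a\<ge>R.L. m0 a = 0"
  proof -
    show "m0 0 = n" "m0 1 = length es" by (simp_all add: m0_def xs_def input_word_def n_def)
    show "m0 2 = k'"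
    proof (cases "es = []")
      case True
      then show ?thesis by (simp add: m0_def xs_def input_word_def k'_def)
    next
      case False
      then show ?thesis using word[of 0 0] by simp
    qed
    show "R.edge_words m0"
      unfolding R.edge_words_def
    proof (intro allI impI)
      fix c j assume c: "c < length es" "j < k'"
      have "R.ea c + j = 2 + (c * Suc k' + Suc j)" by (simp add: R.ea_def)
      then have "m0 (R.ea c + j) = m0 (2 + (c * Suc k' + Suc j))" by (simp only:)
      also have "\<dots> = es ! c ! j" using word[of c "Suc j"] c by (simp only: nth_Cons_Suc Suc_le_eq)
      finally show "m0 (R.ea c + j) = es ! c ! j" .
    qed
    show "\<forall>a\<ge>R.L. m0 a = 0" by (simp add: m0_def lenxs)
  qed
  note ok = R.sampler_ok[OF m0 T_def lg] and halts = R.sampler_output[OF m0 T_def lg]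
  define N where "N = T * n"
  have n0: "0 < n \<or> N = 0" by (auto simp: N_def)
  have empty: "{} \<in> R.indep"
  proof -
    have "set e \<noteq> {}" if "e \<in> set es" for e using len[OF that] cl(4) by auto
    then show ?thesis by (auto simp: R.indep_def)
  qed

  \<comment> \<open>Probability that a block coalesces\<close>
  have half: "real (card {l. length l = N \<and> \<not> R.coalesced ((!) l) N}) \<le> 2 ^ N / 2"
  proof (cases "es = []")
    case True
    then have "R.coalesced f (T * n)" for f by (intro R.no_edges_coalesced) (auto simp: T_def)
    then show ?thesis by (simp add: N_def)
  next
    case False
    then obtain e where e: "e \<in> set es" by (cases es) auto
    obtain v where v: "v \<in> set e" using len[OF e] cl(4) by (cases e) auto
    then have vn: "v < n" using rp(3)[OF e] by blast
    have "{c. c < length es \<and> v \<in> set (es ! c)} \<noteq> {}" using e v by (metis (mono_tags, lifting) empty_Collect_eq in_set_conv_nth)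
    then have d1: "1 \<le> d" using deg[OF vn] by (metis One_nat_def Suc_le_eq card_gt_0_iff finite_Collect_conjI finite_Collect_less_nat)
    note size = class_size_bounds[OF \<epsilon>(1) cl(4) d1 cl(5)]
    interpret P: linear_scan n "set ` set es" k d T
    proof
      show "0 < n" using vn by simp
      show "finite (set ` set es)" by simp
      show "9 \<le> k" "4 * k\<^sup>2 * d < 2 ^ k" by (rule size)+
      show "card C = k" if "C \<in> set ` set es" for C using that len rp(3) by (auto simp: distinct_card)
      show "card {C \<in> set ` set es. v \<in> C} \<le> d" if "v < n" for v
      proof -
        have "{C \<in> set ` set es. v \<in> C} \<subseteq> (\<lambda>c. set (es ! c)) ` {c. c < length es \<and> v \<in> set (es ! c)}"
        proof
          fix C assume "C \<in> {C \<in> set ` set es. v \<in> C}"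
          then obtain e where e: "e \<in> set es" "C = set e" "v \<in> set e" by blast
          obtain c where "c < length es" "e = es ! c" using e(1) by (metis in_set_conv_nth)
          then show "C \<in> (\<lambda>c. set (es ! c)) ` {c. c < length es \<and> v \<in> set (es ! c)}" using e(2,3) by blast
        qed
        then have "card {C \<in> set ` set es. v \<in> C} \<le> card ((\<lambda>c. set (es ! c)) ` {c. c < length es \<and> v \<in> set (es ! c)})"
          by (intro card_mono) auto
        also have "\<dots> \<le> card {c. c < length es \<and> v \<in> set (es ! c)}" by (intro card_image_le) simp
        finally show ?thesis using deg[OF that] by simp
      qed
      show "card (C \<inter> C') \<le> 1" if "C \<in> set ` set es" "C' \<in> set ` set es" "C \<noteq> C'" for C C'
      proof -
        have sub: "C \<subseteq> {..<n}" "C' \<subseteq> {..<n}" using that rp(3) by auto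
        have "\<iota> C \<in> E" "\<iota> C' \<in> E" using that rp(5) by auto
        moreover have "\<iota> C \<noteq> \<iota> C'" using \<iota>_eq[OF sub] that by simp
        ultimately have "card (\<iota> C \<inter> \<iota> C') \<le> 1" using cl(3) by (simp add: linear_hypergraph_def)
        moreover have "\<iota> C \<inter> \<iota> C' = \<iota> (C \<inter> C')"
          unfolding \<iota>_def using inj_on_image_Int[OF inj sub] by simp
        moreover have "card (\<iota> (C \<inter> C')) = card (C \<inter> C')" using sub by (intro \<iota>_card) blast
        ultimately show ?thesis by simp
      qed
    qed
    show ?thesis unfolding N_def by (rule P.card_not_coalesced_le_half[OF T_def lg(2)])
  qed
  have pos: "{l. length l = N \<and> R.coalesced ((!) l) N} \<noteq> {}"
  proof
    assume "{l. length l = N \<and> R.coalesced ((!) l) N} = {}"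
    then have "{l. length l = N \<and> \<not> R.coalesced ((!) l) N} = {l. length l = N}" by blast
    then show False using half card_bool_lists[of N] by simp
  qed

  \<comment> \<open>The law of the output\<close>
  have sub_indep: "I \<subseteq> {..<n}" if "I \<in> R.indep" for I using that by (simp add: R.indep_def)
  have out_bits: "output_set vs m = \<iota> I" if "R.bits m 0 I" "I \<subseteq> {..<n}" for m I
  proof -
    have "i < length vs \<and> m i \<noteq> 0 \<longleftrightarrow> i \<in> I" for i
      using that by (auto simp: R.bits_def n_def[symmetric])
    then show ?thesis unfolding output_set_def \<iota>_def by blast
  qed
  have event: "(\<exists>m. halts_with sampler xs w m \<and> output_set vs m = S) \<longleftrightarrow>
      (\<exists>I\<in>R.indep. w \<in> R.outputs N 2 {} {} I \<and> \<iota> I = S)" for w S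
  proof
    assume "\<exists>m. halts_with sampler xs w m \<and> output_set vs m = S"
    then obtain m where m: "halts_with sampler xs w m" "output_set vs m = S" by blast
    then obtain J I where I: "R.outp N J 2 {} {} w = Some I" "R.bits m 0 I"
      using halts[of w] unfolding halts_with_def init N_def by blast
    have "I \<in> R.indep" using R.outp_indep[OF I(1) empty empty n0] .
    then show "\<exists>I\<in>R.indep. w \<in> R.outputs N 2 {} {} I \<and> \<iota> I = S"
      using I m(2) out_bits[OF I(2) sub_indep] by (auto simp: R.outputs_def)
  next
    assume "\<exists>I\<in>R.indep. w \<in> R.outputs N 2 {} {} I \<and> \<iota> I = S"
    then obtain I J where I: "I \<in> R.indep" "R.outp N J 2 {} {} w = Some I" "\<iota> I = S" by (auto simp: R.outputs_def)
    obtain t r m w' where "exec sampler (\<lambda>_. 0, m0, w) t (r, m, w')" "R.bits m 0 I"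
      using ok[of J w I] I(2) unfolding wp_def N_def by blast
    then show "\<exists>m. halts_with sampler xs w m \<and> output_set vs m = S"
      using out_bits sub_indep[OF I(1)] I(3) by (auto simp: halts_with_def init)
  qed
  have indep_eq: "independent_sets V E = \<iota> ` R.indep"
  proof
    show "independent_sets V E \<subseteq> \<iota> ` R.indep"
    proof
      fix S assume "S \<in> independent_sets V E"
      then have S: "S \<subseteq> V" "\<forall>C\<in>E. \<not> C \<subseteq> S" by (auto simp: independent_sets_def)
      obtain I where I: "I \<subseteq> {..<n}" "S = \<iota> I" using S(1) unfolding V \<iota>_def by (meson subset_imageE)
      have "\<not> set e \<subseteq> I" if "e \<in> set es" for e
        using S(2) \<iota>_sub[OF _ I(1), of "set e"] rp(3)[OF that] that unfolding I(2) rp(5) by blast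
      then show "S \<in> \<iota> ` R.indep" using I by (auto simp: R.indep_def)
    qed
    show "\<iota> ` R.indep \<subseteq> independent_sets V E"
    proof
      fix S assume "S \<in> \<iota> ` R.indep"
      then obtain I where I: "I \<in> R.indep" "S = \<iota> I" by blast
      have "\<not> \<iota> (set e) \<subseteq> \<iota> I" if "e \<in> set es" for e
        using \<iota>_sub[OF _ sub_indep[OF I(1)], of "set e"] rp(3)[OF that] I(1) that by (auto simp: R.indep_def)
      moreover have "\<iota> I \<subseteq> V" using sub_indep[OF I(1)] unfolding V \<iota>_def by blast
      ultimately show "S \<in> independent_sets V E" unfolding I(2) independent_sets_def rp(5) by blast
    qed
  qed
  have inj_\<iota>: "inj_on \<iota> R.indep" using \<iota>_eq sub_indep by (auto simp: inj_on_def)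
  have card_indep: "card (independent_sets V E) = card R.indep" unfolding indep_eq by (rule card_image[OF inj_\<iota>])
  have pmf: "pmf (pmf_of_set (independent_sets V E)) S = of_bool (S \<in> independent_sets V E) / real (card R.indep)" for S
    using empty R.finite_indep unfolding card_indep[symmetric]
    by (subst pmf_of_set) (auto simp: indep_eq indicator_def)
  show "output_prob sampler vs es S = pmf (pmf_of_set (independent_sets V E)) S"
  proof (cases "S \<in> independent_sets V E")
    case True
    then obtain I where I: "I \<in> R.indep" "S = \<iota> I" unfolding indep_eq by blast
    have "{w \<in> space coin_space. \<exists>m. halts_with sampler xs w m \<and> output_set vs m = S} = R.outputs N 2 {} {} I"
      unfolding event using inj_onD[OF inj_\<iota> _ _ I(1)] I by auto
    then show ?thesis
      unfolding output_prob_def xs_def[symmetric] pmf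
      using R.measure_outputs_two[OF n0 empty pos, of "{}" I] I True by simp
  next
    case False
    then have ev: "{w \<in> space coin_space. \<exists>m. halts_with sampler xs w m \<and> output_set vs m = S} = {}"
      unfolding event indep_eq by auto
    show ?thesis unfolding output_prob_def xs_def[symmetric] pmf ev using False by simp
  qed

  \<comment> \<open>The expected running time\<close>
  show "expected_time sampler (input_word vs es) \<le> ennreal (13000 * (- 1 / ln (1 - \<epsilon>) * (real k)\<^sup>2 * (real d)\<^sup>2 * real (card V)
                              * (ln (real (card V)) + ln (real d))))" if V1: "card V \<ge> 1" and d1: "d \<ge> 1"
  proof -
    note size = class_size_bounds[OF \<epsilon>(1) cl(4) d1 cl(5)]
    have np: "0 < n" using V1 cardV by simp
    then have d': "d' = d" by (simp add: d'_def)
    have "es \<noteq> []" using deg[OF np] d1 by auto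
    then have k': "k' = k" by (simp add: k'_def)
    have n9: "9 \<le> n"
    proof -
      obtain e where e: "e \<in> set es" using \<open>es \<noteq> []\<close> by (cases es) auto
      then have "card (set e) \<le> card {..<n}" using rp(3) by (intro card_mono) auto
      then show ?thesis using len[OF e] rp(3)[OF e] size(2) by (simp add: distinct_card)
    qed
    \<comment> \<open>\<open>A\<close> collects the costs outside the main loop and its last test,
      \<open>B\<close> the cost of one block with its test.\<close>
    define A B where "A = real (R.prelude_time lg + 1 + (6 * n + 3))" and "B = real (R.block_time + 1)"
    have AB: "0 \<le> A" "0 < B" by (simp_all add: A_def B_def)
    define G where "G w = (SUP J. ennreal (real (R.blocks N J 2 w)))" for w
    have rt: "ennreal_of_enat (running_time sampler xs w) \<le> ennreal A + ennreal B * G w" for w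
    proof (cases "\<exists>J I. R.outp N J 2 {} {} w = Some I")
      case True
      then obtain J I where I: "R.outp N J 2 {} {} w = Some I" by blast
      obtain t r m w' where t: "exec sampler (\<lambda>_. 0, m0, w) t (r, m, w')" "t \<le> R.sampler_time lg (R.blocks N J 2 w)"
        using ok[of J w I] I unfolding wp_def N_def by blast
      have "running_time sampler xs w \<le> enat t"
        unfolding running_time_def init using t(1) by (intro Inf_lower) blast
      then have "ennreal_of_enat (running_time sampler xs w) \<le> ennreal_of_enat (enat t)" by (simp only: ennreal_of_enat_le_iff)
      also have "\<dots> = ennreal (real t)" by (simp add: ennreal_of_nat_eq_real_of_nat)
      also have "\<dots> \<le> ennreal (A + B * real (R.blocks N J 2 w))"
      proof (rule ennreal_leI)
        have "real t \<le> real (R.sampler_time lg (R.blocks N J 2 w))" using t(2) by simp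
        then show "real t \<le> A + B * real (R.blocks N J 2 w)"
          by (simp add: R.sampler_time_def A_def B_def algebra_simps)
      qed
      also have "\<dots> = ennreal A + ennreal B * ennreal (real (R.blocks N J 2 w))"
        using AB by (simp add: ennreal_plus ennreal_mult)
      also have "\<dots> \<le> ennreal A + ennreal B * G w"
        unfolding G_def by (intro add_left_mono mult_left_mono SUP_upper) auto
      finally show ?thesis .
    next
      case False
      \<comment> \<open>Tosses without output are not excluded pointwise; there the bound holds
        because \<open>G w\<close> is infinite.\<close>
      then have "R.blocks N J 2 w = J" for J using R.outp_None_blocks[of N J 2 "{}" "{}" w] by (metis option.exhaust)
      then have "G w = top" unfolding G_def using ennreal_SUP_of_nat_eq_top by (simp add: ennreal_of_nat_eq_real_of_nat)
      then show ?thesis using AB by (simp add: ennreal_mult_top)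
    qed
    have mG: "G \<in> borel_measurable coin_space"
      unfolding G_def using R.measurable_blocks by (intro borel_measurable_SUP) auto
    have "expected_time sampler xs \<le> (\<integral>\<^sup>+w. ennreal A + ennreal B * G w \<partial>coin_space)"
      unfolding expected_time_def by (intro nn_integral_mono rt)
    also have "\<dots> = ennreal A + ennreal B * (\<integral>\<^sup>+w. G w \<partial>coin_space)"
    proof -
      have "emeasure coin_space UNIV = 1" using coin.emeasure_space_1 by simp
      then show ?thesis using mG by (simp add: nn_integral_add nn_integral_cmult)
    qed
    also have "\<dots> \<le> ennreal A + ennreal B * ennreal (2 * real (2 :: nat))"
      unfolding G_def by (intro add_left_mono mult_left_mono R.nn_integral_SUP_blocks_le half) auto
    also have "\<dots> = ennreal (A + 4 * B)"
    proof -
      have "ennreal B * ennreal (2 * real (2 :: nat)) = ennreal (B * (2 * real (2 :: nat)))"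
        using AB by (intro ennreal_mult[symmetric]) auto
      also have "\<dots> = ennreal (4 * B)" by (simp add: mult.commute)
      finally have e: "ennreal B * ennreal (2 * real (2 :: nat)) = ennreal (4 * B)" .
      show ?thesis unfolding e using AB by (intro ennreal_plus[symmetric]) auto
    qed
    also have "\<dots> \<le> ennreal (13000 * (- 1 / ln (1 - \<epsilon>) * (real k)\<^sup>2 * (real d)\<^sup>2 * real (card V)
                              * (ln (real (card V)) + ln (real d))))"
    proof (rule ennreal_leI)
      have "length es * k = d * n" using R.handshake k' d' by simp
      from sampler_time_bound[OF \<epsilon> size(3,2) d1 n9 this lg]
      show "A + 4 * B \<le> 13000 * (- 1 / ln (1 - \<epsilon>) * (real k)\<^sup>2 * (real d)\<^sup>2 * real (card V)
                              * (ln (real (card V)) + ln (real d)))"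
        unfolding cardV A_def B_def R.prelude_time_def R.block_time_def unfolding k' d' T_def .
    qed
    finally show ?thesis by (simp add: xs_def)
  qed
qed

theorem theorem1p3:
  "\<exists>K::real. K > 0 \<and>
     (\<forall>\<epsilon>::real. 0 < \<epsilon> \<and> \<epsilon> < 1 \<longrightarrow>
       (\<exists>P::com. \<forall>(k::nat) (d::nat) (V::nat set) (E::nat set set) vs es.
          (V, E) \<in> hypergraph_class \<epsilon> k d \<and> represents vs es V E \<longrightarrow>
            (\<forall>S. output_prob P vs es S = pmf (pmf_of_set (independent_sets V E)) S) \<and>
            (card V \<ge> 1 \<and> d \<ge> 1 \<longrightarrow>
               expected_time P (input_word vs es)
                 \<le> ennreal (K * (- 1 / ln (1 - \<epsilon>) * (real k)\<^sup>2 * (real d)\<^sup>2 * real (card V)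
                              * (ln (real (card V)) + ln (real d)))))))"
proof (intro exI[of _ "13000 :: real"] conjI allI impI)
  fix \<epsilon> :: real
  assume \<epsilon>: "0 < \<epsilon> \<and> \<epsilon> < 1"
  show "\<exists>P::com. \<forall>(k::nat) (d::nat) (V::nat set) (E::nat set set) vs es.
          (V, E) \<in> hypergraph_class \<epsilon> k d \<and> represents vs es V E \<longrightarrow>
            (\<forall>S. output_prob P vs es S = pmf (pmf_of_set (independent_sets V E)) S) \<and>
            (card V \<ge> 1 \<and> d \<ge> 1 \<longrightarrow>
               expected_time P (input_word vs es)
                 \<le> ennreal (13000 * (- 1 / ln (1 - \<epsilon>) * (real k)\<^sup>2 * (real d)\<^sup>2 * real (card V)
                              * (ln (real (card V)) + ln (real d)))))"
    by (rule exI[of _ sampler]) (use \<epsilon> sampler_correct in blast)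
qed simp

end
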